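(* Let $[\Gamma]$ be a real analytic projective structure on an open set $U\subset\mathbb{R}^2$ and let $p\in U$, the rank of $\mathcal M([\Gamma])$ being assumed constant in a sufficiently small neighbourhood of $p$. Then $[\Gamma]$ is metrisable in a sufficiently small neighbourhood of $p$ if and only if the rank of the $21\times6$ matrix with the rows $$\mathcal M_{\max}=\big(\mathbf V,\ D_a\mathbf V,\ D_{(a}D_{b)}\mathbf V,\ D_{(a}D_bD_{c)}\mathbf V,\ D_{(a}D_bD_cD_{d)}\mathbf V,\ D_{(a}D_bD_cD_dD_{e)}\mathbf V\big)$$ is smaller than $6$ and there exists a vector $\mathbf W=(W_1,\dots,W_6)^T$ in the kernel of this matrix such that $W_1W_3-W_2^2$ does not vanish at $p$.
   Context: Coordinates on $U$ are $(x^1,x^2)=(x,y)$; $\partial_1=\partial_x$, $\partial_2=\partial_y$. A projective structure $[\Gamma]$ on $U$ is an equivalence class of torsion-free connections, where $\Gamma\sim\hat\Gamma$ iff they have the same unparametrised geodesics, i.e. $\hat\Gamma^c_{ab}=\Gamma^c_{ab}+\delta^c_a\omega_b+\delta^c_b\omega_a$ for some one-form $\omega$. $[\Gamma]$ is metrisable in a neighbourhood of $p\in U$ if on that neighbourhood there is a metric $g$ (symmetric, non-degenerate, of any signature) whose Levi-Civita connection belongs to $[\Gamma]$. The functions $$A_3=\Gamma^1_{22},\quad A_2=2\Gamma^1_{12}-\Gamma^2_{22},\quad A_1=\Gamma^1_{11}-2\Gamma^2_{12},\quad A_0=-\Gamma^2_{11}$$ depend only on $[\Gamma]$ and determine it;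 $[\Gamma]$ is real analytic if they are. Liouville expressions: $L_1=\frac23\partial_x\partial_yA_1-\frac13\partial_x^2A_2-\partial_y^2A_0+A_0\partial_yA_2+A_2\partial_yA_0-A_3\partial_xA_0-2A_0\partial_xA_3-\frac23A_1\partial_yA_1+\frac13A_1\partial_xA_2$, $L_2=\frac23\partial_x\partial_yA_2-\frac13\partial_y^2A_1-\partial_x^2A_3-A_3\partial_xA_1-A_1\partial_xA_3+A_0\partial_yA_3+2A_3\partial_yA_0+\frac23A_2\partial_xA_2-\frac13A_2\partial_yA_1$. The row vector $\mathbf V=(V_1,\dots,V_6)$: $V_1=2\partial_yL_2+4A_2L_2+8A_3L_1$, $V_2=-2\partial_yL_1-2\partial_xL_2-\frac43A_1L_2+\frac43A_2L_1$, $V_3=2\partial_xL_1-8A_0L_2-4A_1L_1$, $V_4=-5L_2$, $V_5=-5L_1$, $V_6=0$. The $6\times6$ matrices $\mathbf\Omega_1,\mathbf\Omega_2$: $$\mathbf\Omega_1=\begin{pmatrix} -\frac23A_1&2A_0&0&0&0&0 \\ 0&0&0&-\frac12&0&0 \\ -2A_3&-\frac23A_2&\frac43A_1&0&1&0 \\ {a_{41}}&a_{42}&a_{43}&-\frac13A_1&-3A_0&0 \\ 0&0&0&0&0&-1 \\ {a_{61}}&a_{62}&a_{63}&a_{64}&a_{65}&-\frac13A_1 \end{pmatrix},\quad \mathbf\Omega_2=\begin{pmatrix} -\frac43A_2&\frac23A_1&2A_0&1&0&0 \\ 0&0&0&0&-\frac12&0 \\ 0&-2A_3&\frac23A_2&0&0&0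 \\ 0&0&0&0&0&-1 \\ {b_{51}}&b_{52}&b_{53}&3A_3&\frac13A_2&0 \\ {b_{61}}&b_{62}&b_{63}&b_{64}&b_{65}&\frac13A_2 \end{pmatrix}$$ with $a_{41}=-\frac43\partial_xA_2+4A_0A_3+\frac23\partial_yA_1$; $a_{42}=-2\partial_yA_0+\frac23\partial_xA_1+4A_2A_0-\frac49A_1^2$; $a_{43}=2\partial_xA_0-4A_0A_1$; $a_{61}=-\frac43\partial_x\partial_yA_2-\frac{20}3A_0A_2A_3+\frac23\partial_y^2A_1+4A_3\partial_yA_0-2A_0\partial_yA_3-\frac{16}9A_2\partial_xA_2+\frac89A_2\partial_yA_1$; $a_{62}=\frac23\partial_x\partial_yA_1-\frac43A_1\partial_yA_1+2A_0\partial_yA_2-2\partial_y^2A_0+4A_2\partial_yA_0+4A_3\partial_xA_0+6A_0\partial_xA_3+\frac89A_1\partial_xA_2+\frac43A_0A_1A_3-\frac43A_0A_2^2$; $a_{63}=2\partial_x\partial_yA_0+\frac23A_0\partial_xA_2-\frac43A_2\partial_xA_0-4A_1\partial_yA_0-\frac43A_0\partial_yA_1+\frac83A_0A_1A_2+4A_3A_0^2$; $a_{64}=\frac43\partial_xA_2-\partial_yA_1+5A_0A_3$; $a_{65}=\frac13\partial_xA_1-4\partial_yA_0+3A_2A_0-\frac29A_1^2$; $b_{51}=-2\partial_yA_3-4A_3A_2$; $b_{52}=2\partial_xA_3-\frac23\partial_yA_2+4A_1A_3-\frac49A_2^2$; $b_{53}=\frac43\partial_yA_1-\frac23\partial_xA_2+4A_0A_3$;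 $b_{61}=-2\partial_x\partial_yA_3-4A_2\partial_xA_3-\frac43A_3\partial_xA_2+\frac23A_3\partial_yA_1-\frac43A_1\partial_yA_3-4A_0A_3^2-\frac83A_1A_2A_3$; $b_{62}=2\partial_x^2A_3-\frac43A_2\partial_xA_2-\frac43A_0A_2A_3-\frac23\partial_x\partial_yA_2+4A_1\partial_xA_3+4A_0\partial_yA_3+6A_3\partial_yA_0+\frac43A_3A_1^2+2A_3\partial_xA_1+\frac89A_2\partial_yA_1$; $b_{63}=-\frac23\partial_x^2A_2+\frac89A_1\partial_xA_2+4A_0\partial_xA_3-2A_3\partial_xA_0-\frac{16}9A_1\partial_yA_1+\frac43\partial_x\partial_yA_1+\frac{20}3A_0A_1A_3$; $b_{64}=4\partial_xA_3-\frac13\partial_yA_2+3A_1A_3-\frac29A_2^2$; $b_{65}=\partial_xA_2-\frac43\partial_yA_1+5A_0A_3$. For a row-vector valued function $\mathbf W:U\to\mathbb{R}^6$ set $D_a\mathbf W=\partial_a\mathbf W-\mathbf W\,\mathbf\Omega_a$ ($a=1,2$), iterated: $D_aD_b\cdots D_d\mathbf V=\partial_a(D_b\cdots D_d\mathbf V)-(D_b\cdots D_d\mathbf V)\mathbf\Omega_a$. Round brackets around indices denote symmetrisation. $\mathcal M([\Gamma])$ is the $6\times6$ matrix with rows $\mathbf V,D_1\mathbf V,D_2\mathbf V,D_{(1}D_{1)}\mathbf V,D_{(1}D_{2)}\mathbf V,D_{(2}D_{2)}\mathbf V$. The $21$ rows of $\mathcal M_{\max}$ are $\mathbf V$ and all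 symmetrised derivatives $D_{(a_1}\cdots D_{a_k)}\mathbf V$ with $1\le k\le5$. The kernel of a matrix consists of the column vectors it annihilates. *)

theory Defs
  imports "HOL-Analysis.Analysis" "HOL-Combinatorics.Permutations"
begin

text \<open>
  Points of the plane are elements of \<^typ>\<open>real^2\<close>.  The index type \<^typ>\<open>2\<close> has the
  elements \<open>1\<close> and \<open>2\<close> (which is \<open>0\<close>), so that index notation can be copied literally.
  Functions are total; only their values on the open set in question are ever used.
\<close>

subsection \<open>Regularity\<close>

definition pd :: "2 \<Rightarrow> (real^2 \<Rightarrow> real) \<Rightarrow> real^2 \<Rightarrow> real" where
  "pd a f z = deriv (\<lambda>t. f (z + t *\<^sub>R axis a 1)) 0"

abbreviation dx :: "(real^2 \<Rightarrow> real) \<Rightarrow> real^2 \<Rightarrow> real" where "dx \<equiv> pd 1"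
abbreviation dy :: "(real^2 \<Rightarrow> real) \<Rightarrow> real^2 \<Rightarrow> real" where "dy \<equiv> pd 2"

fun Ck_on :: "nat \<Rightarrow> (real^2) set \<Rightarrow> (real^2 \<Rightarrow> real) \<Rightarrow> bool" where
  "Ck_on 0 U f \<longleftrightarrow> continuous_on U f"
| "Ck_on (Suc k) U f \<longleftrightarrow> f differentiable_on U \<and> (\<forall>a. Ck_on k U (pd a f))"

definition smooth_on :: "(real^2) set \<Rightarrow> (real^2 \<Rightarrow> real) \<Rightarrow> bool" where
  "smooth_on U f \<longleftrightarrow> (\<forall>k. Ck_on k U f)"

definition real_analytic_on :: "(real^2) set \<Rightarrow> (real^2 \<Rightarrow> real) \<Rightarrow> bool" where
  "real_analytic_on U f \<longleftrightarrow>
    (\<forall>p\<in>U. \<exists>r>0. \<exists>c :: nat \<Rightarrow> nat \<Rightarrow> real. \<forall>z\<in>ball p r.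
       ((\<lambda>(i, j). c i j * (z $ 1 - p $ 1) ^ i * (z $ 2 - p $ 2) ^ j) has_sum f z) UNIV)"


subsection \<open>Projective structures and metrisability\<close>

text \<open>\<open>\<Gamma> c a b\<close> is the connection coefficient with upper index \<open>c\<close> and lower indices \<open>a\<close>, \<open>b\<close>.\<close>

type_synonym connection = "2 \<Rightarrow> 2 \<Rightarrow> 2 \<Rightarrow> real^2 \<Rightarrow> real"

definition torsion_free_connection_on :: "(real^2) set \<Rightarrow> connection \<Rightarrow> bool" where
  "torsion_free_connection_on U \<Gamma> \<longleftrightarrow>
    (\<forall>c a b. smooth_on U (\<Gamma> c a b)) \<and> (\<forall>c a b. \<forall>z\<in>U. \<Gamma> c a b z = \<Gamma> c b a z)"

definition kdelta :: "2 \<Rightarrow> 2 \<Rightarrow> real" where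
  "kdelta c a = (if c = a then 1 else 0)"

definition projectively_equivalent_on :: "(real^2) set \<Rightarrow> connection \<Rightarrow> connection \<Rightarrow> bool" where
  "projectively_equivalent_on U \<Gamma> \<Gamma>' \<longleftrightarrow>
    (\<exists>\<omega> :: 2 \<Rightarrow> real^2 \<Rightarrow> real. (\<forall>a. smooth_on U (\<omega> a)) \<and>
       (\<forall>c a b. \<forall>z\<in>U. \<Gamma>' c a b z = \<Gamma> c a b z + kdelta c a * \<omega> b z + kdelta c b * \<omega> a z))"

definition projective_rel :: "(real^2) set \<Rightarrow> (connection \<times> connection) set" where
  "projective_rel U = {(\<Gamma>, \<Gamma>'). torsion_free_connection_on U \<Gamma> \<and> torsion_free_connection_on U \<Gamma>' \<and>
     projectively_equivalent_on U \<Gamma> \<Gamma>'}"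

definition projective_structures :: "(real^2) set \<Rightarrow> connection set set" where
  "projective_structures U = {\<Gamma>. torsion_free_connection_on U \<Gamma>} // projective_rel U"

definition metric_on :: "(real^2) set \<Rightarrow> (real^2 \<Rightarrow> real^2^2) \<Rightarrow> bool" where
  "metric_on U g \<longleftrightarrow> (\<forall>a b. smooth_on U (\<lambda>z. g z $ a $ b)) \<and>
     (\<forall>z\<in>U. transpose (g z) = g z \<and> invertible (g z))"

definition levi_civita :: "(real^2 \<Rightarrow> real^2^2) \<Rightarrow> connection" where
  "levi_civita g c a b z = 1/2 * (\<Sum>d\<in>UNIV. matrix_inv (g z) $ c $ d *
     (pd a (\<lambda>u. g u $ b $ d) z + pd b (\<lambda>u. g u $ a $ d) z - pd d (\<lambda>u. g u $ a $ b) z))"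

text \<open>The structure \<open>P\<close>, given on \<open>U\<close>, is restricted to the neighbourhood \<open>N\<close> here.\<close>

definition metrisable_near :: "(real^2) set \<Rightarrow> connection set \<Rightarrow> real^2 \<Rightarrow> bool" where
  "metrisable_near U P p \<longleftrightarrow>
    (\<exists>N g. open N \<and> p \<in> N \<and> N \<subseteq> U \<and> metric_on N g \<and>
       (\<forall>\<Gamma>\<in>P. (\<Gamma>, levi_civita g) \<in> projective_rel N))"

definition A0 :: "connection \<Rightarrow> real^2 \<Rightarrow> real" where "A0 \<Gamma> z = - \<Gamma> 2 1 1 z"
definition A1 :: "connection \<Rightarrow> real^2 \<Rightarrow> real" where "A1 \<Gamma> z = \<Gamma> 1 1 1 z - 2 * \<Gamma> 2 1 2 z"
definition A2 :: "connection \<Rightarrow> real^2 \<Rightarrow> real" where "A2 \<Gamma> z = 2 * \<Gamma> 1 1 2 z - \<Gamma> 2 2 2 z"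
definition A3 :: "connection \<Rightarrow> real^2 \<Rightarrow> real" where "A3 \<Gamma> z = \<Gamma> 1 2 2 z"

definition real_analytic_projective_structure :: "(real^2) set \<Rightarrow> connection set \<Rightarrow> bool" where
  "real_analytic_projective_structure U P \<longleftrightarrow> P \<in> projective_structures U \<and>
     (\<forall>\<Gamma>\<in>P. real_analytic_on U (A0 \<Gamma>) \<and> real_analytic_on U (A1 \<Gamma>) \<and>
             real_analytic_on U (A2 \<Gamma>) \<and> real_analytic_on U (A3 \<Gamma>))"

text \<open>
  Everything below is expressed through \<open>A0\<close>, ..., \<open>A3\<close>, so on the open set \<open>U\<close> it does not
  depend on the connection \<open>\<Gamma>\<close> chosen in a projective structure.
\<close>

lemma A_projective_invariant:
  assumes "(\<Gamma>, \<Gamma>') \<in> projective_rel U" "z \<in> U"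
  shows "A0 \<Gamma>' z = A0 \<Gamma> z" "A1 \<Gamma>' z = A1 \<Gamma> z" "A2 \<Gamma>' z = A2 \<Gamma> z" "A3 \<Gamma>' z = A3 \<Gamma> z"
  using assms
  by (auto simp: projective_rel_def projectively_equivalent_on_def A0_def A1_def A2_def A3_def kdelta_def)


subsection \<open>The Liouville expressions, the row vector \<open>V\<close> and the connection matrices\<close>

definition L1 :: "connection \<Rightarrow> real^2 \<Rightarrow> real" where
  "L1 \<Gamma> z =
    2/3 * dx (dy (A1 \<Gamma>)) z - 1/3 * dx (dx (A2 \<Gamma>)) z - dy (dy (A0 \<Gamma>)) z
      + A0 \<Gamma> z * dy (A2 \<Gamma>) z + A2 \<Gamma> z * dy (A0 \<Gamma>) z
      - A3 \<Gamma> z * dx (A0 \<Gamma>) z - 2 * A0 \<Gamma> z * dx (A3 \<Gamma>) z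
      - 2/3 * A1 \<Gamma> z * dy (A1 \<Gamma>) z + 1/3 * A1 \<Gamma> z * dx (A2 \<Gamma>) z"

definition L2 :: "connection \<Rightarrow> real^2 \<Rightarrow> real" where
  "L2 \<Gamma> z =
    2/3 * dx (dy (A2 \<Gamma>)) z - 1/3 * dy (dy (A1 \<Gamma>)) z - dx (dx (A3 \<Gamma>)) z
      - A3 \<Gamma> z * dx (A1 \<Gamma>) z - A1 \<Gamma> z * dx (A3 \<Gamma>) z
      + A0 \<Gamma> z * dy (A3 \<Gamma>) z + 2 * A3 \<Gamma> z * dy (A0 \<Gamma>) z
      + 2/3 * A2 \<Gamma> z * dx (A2 \<Gamma>) z - 1/3 * A2 \<Gamma> z * dy (A1 \<Gamma>) z"

definition Vrow :: "connection \<Rightarrow> real^2 \<Rightarrow> real^6" where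
  "Vrow \<Gamma> z = vector [2 * dy (L2 \<Gamma>) z + 4 * A2 \<Gamma> z * L2 \<Gamma> z + 8 * A3 \<Gamma> z * L1 \<Gamma> z,
     -2 * dy (L1 \<Gamma>) z - 2 * dx (L2 \<Gamma>) z - 4/3 * A1 \<Gamma> z * L2 \<Gamma> z + 4/3 * A2 \<Gamma> z * L1 \<Gamma> z,
     2 * dx (L1 \<Gamma>) z - 8 * A0 \<Gamma> z * L2 \<Gamma> z - 4 * A1 \<Gamma> z * L1 \<Gamma> z,
     -5 * L2 \<Gamma> z,
     -5 * L1 \<Gamma> z,
     0]"

definition a41 :: "connection \<Rightarrow> real^2 \<Rightarrow> real" where
  "a41 \<Gamma> z =
    -4/3 * dx (A2 \<Gamma>) z + 4 * A0 \<Gamma> z * A3 \<Gamma> z + 2/3 * dy (A1 \<Gamma>) z"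

definition a42 :: "connection \<Rightarrow> real^2 \<Rightarrow> real" where
  "a42 \<Gamma> z =
    -2 * dy (A0 \<Gamma>) z + 2/3 * dx (A1 \<Gamma>) z + 4 * A2 \<Gamma> z * A0 \<Gamma> z
      - 4/9 * (A1 \<Gamma> z)^2"

definition a43 :: "connection \<Rightarrow> real^2 \<Rightarrow> real" where
  "a43 \<Gamma> z =
    2 * dx (A0 \<Gamma>) z - 4 * A0 \<Gamma> z * A1 \<Gamma> z"

definition a61 :: "connection \<Rightarrow> real^2 \<Rightarrow> real" where
  "a61 \<Gamma> z =
    -4/3 * dx (dy (A2 \<Gamma>)) z - 20/3 * A0 \<Gamma> z * A2 \<Gamma> z * A3 \<Gamma> z
      + 2/3 * dy (dy (A1 \<Gamma>)) z + 4 * A3 \<Gamma> z * dy (A0 \<Gamma>) z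
      - 2 * A0 \<Gamma> z * dy (A3 \<Gamma>) z - 16/9 * A2 \<Gamma> z * dx (A2 \<Gamma>) z
      + 8/9 * A2 \<Gamma> z * dy (A1 \<Gamma>) z"

definition a62 :: "connection \<Rightarrow> real^2 \<Rightarrow> real" where
  "a62 \<Gamma> z =
    2/3 * dx (dy (A1 \<Gamma>)) z - 4/3 * A1 \<Gamma> z * dy (A1 \<Gamma>) z
      + 2 * A0 \<Gamma> z * dy (A2 \<Gamma>) z - 2 * dy (dy (A0 \<Gamma>)) z
      + 4 * A2 \<Gamma> z * dy (A0 \<Gamma>) z + 4 * A3 \<Gamma> z * dx (A0 \<Gamma>) z
      + 6 * A0 \<Gamma> z * dx (A3 \<Gamma>) z + 8/9 * A1 \<Gamma> z * dx (A2 \<Gamma>) z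
      + 4/3 * A0 \<Gamma> z * A1 \<Gamma> z * A3 \<Gamma> z - 4/3 * A0 \<Gamma> z * (A2 \<Gamma> z)^2"

definition a63 :: "connection \<Rightarrow> real^2 \<Rightarrow> real" where
  "a63 \<Gamma> z =
    2 * dx (dy (A0 \<Gamma>)) z + 2/3 * A0 \<Gamma> z * dx (A2 \<Gamma>) z
      - 4/3 * A2 \<Gamma> z * dx (A0 \<Gamma>) z - 4 * A1 \<Gamma> z * dy (A0 \<Gamma>) z
      - 4/3 * A0 \<Gamma> z * dy (A1 \<Gamma>) z + 8/3 * A0 \<Gamma> z * A1 \<Gamma> z * A2 \<Gamma> z
      + 4 * A3 \<Gamma> z * (A0 \<Gamma> z)^2"

definition a64 :: "connection \<Rightarrow> real^2 \<Rightarrow> real" where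
  "a64 \<Gamma> z =
    4/3 * dx (A2 \<Gamma>) z - dy (A1 \<Gamma>) z + 5 * A0 \<Gamma> z * A3 \<Gamma> z"

definition a65 :: "connection \<Rightarrow> real^2 \<Rightarrow> real" where
  "a65 \<Gamma> z =
    1/3 * dx (A1 \<Gamma>) z - 4 * dy (A0 \<Gamma>) z + 3 * A2 \<Gamma> z * A0 \<Gamma> z
      - 2/9 * (A1 \<Gamma> z)^2"

definition b51 :: "connection \<Rightarrow> real^2 \<Rightarrow> real" where
  "b51 \<Gamma> z =
    -2 * dy (A3 \<Gamma>) z - 4 * A3 \<Gamma> z * A2 \<Gamma> z"

definition b52 :: "connection \<Rightarrow> real^2 \<Rightarrow> real" where
  "b52 \<Gamma> z =
    2 * dx (A3 \<Gamma>) z - 2/3 * dy (A2 \<Gamma>) z + 4 * A1 \<Gamma> z * A3 \<Gamma> z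
      - 4/9 * (A2 \<Gamma> z)^2"

definition b53 :: "connection \<Rightarrow> real^2 \<Rightarrow> real" where
  "b53 \<Gamma> z =
    4/3 * dy (A1 \<Gamma>) z - 2/3 * dx (A2 \<Gamma>) z + 4 * A0 \<Gamma> z * A3 \<Gamma> z"

definition b61 :: "connection \<Rightarrow> real^2 \<Rightarrow> real" where
  "b61 \<Gamma> z =
    -2 * dx (dy (A3 \<Gamma>)) z - 4 * A2 \<Gamma> z * dx (A3 \<Gamma>) z
      - 4/3 * A3 \<Gamma> z * dx (A2 \<Gamma>) z + 2/3 * A3 \<Gamma> z * dy (A1 \<Gamma>) z
      - 4/3 * A1 \<Gamma> z * dy (A3 \<Gamma>) z - 4 * A0 \<Gamma> z * (A3 \<Gamma> z)^2
      - 8/3 * A1 \<Gamma> z * A2 \<Gamma> z * A3 \<Gamma> z"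

definition b62 :: "connection \<Rightarrow> real^2 \<Rightarrow> real" where
  "b62 \<Gamma> z =
    2 * dx (dx (A3 \<Gamma>)) z - 4/3 * A2 \<Gamma> z * dx (A2 \<Gamma>) z
      - 4/3 * A0 \<Gamma> z * A2 \<Gamma> z * A3 \<Gamma> z - 2/3 * dx (dy (A2 \<Gamma>)) z
      + 4 * A1 \<Gamma> z * dx (A3 \<Gamma>) z + 4 * A0 \<Gamma> z * dy (A3 \<Gamma>) z
      + 6 * A3 \<Gamma> z * dy (A0 \<Gamma>) z + 4/3 * A3 \<Gamma> z * (A1 \<Gamma> z)^2
      + 2 * A3 \<Gamma> z * dx (A1 \<Gamma>) z + 8/9 * A2 \<Gamma> z * dy (A1 \<Gamma>) z"

definition b63 :: "connection \<Rightarrow> real^2 \<Rightarrow> real" where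
  "b63 \<Gamma> z =
    -2/3 * dx (dx (A2 \<Gamma>)) z + 8/9 * A1 \<Gamma> z * dx (A2 \<Gamma>) z
      + 4 * A0 \<Gamma> z * dx (A3 \<Gamma>) z - 2 * A3 \<Gamma> z * dx (A0 \<Gamma>) z
      - 16/9 * A1 \<Gamma> z * dy (A1 \<Gamma>) z + 4/3 * dx (dy (A1 \<Gamma>)) z
      + 20/3 * A0 \<Gamma> z * A1 \<Gamma> z * A3 \<Gamma> z"

definition b64 :: "connection \<Rightarrow> real^2 \<Rightarrow> real" where
  "b64 \<Gamma> z =
    4 * dx (A3 \<Gamma>) z - 1/3 * dy (A2 \<Gamma>) z + 3 * A1 \<Gamma> z * A3 \<Gamma> z
      - 2/9 * (A2 \<Gamma> z)^2"

definition b65 :: "connection \<Rightarrow> real^2 \<Rightarrow> real" where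
  "b65 \<Gamma> z =
    dx (A2 \<Gamma>) z - 4/3 * dy (A1 \<Gamma>) z + 5 * A0 \<Gamma> z * A3 \<Gamma> z"

definition Omega1 :: "connection \<Rightarrow> real^2 \<Rightarrow> real^6^6" where
  "Omega1 \<Gamma> z = vector [vector [-2/3 * A1 \<Gamma> z, 2 * A0 \<Gamma> z, 0, 0, 0, 0],
     vector [0, 0, 0, -1/2, 0, 0],
     vector [-2 * A3 \<Gamma> z, -2/3 * A2 \<Gamma> z, 4/3 * A1 \<Gamma> z, 0, 1, 0],
     vector [a41 \<Gamma> z, a42 \<Gamma> z, a43 \<Gamma> z, -1/3 * A1 \<Gamma> z, -3 * A0 \<Gamma> z, 0],
     vector [0, 0, 0, 0, 0, -1],
     vector [a61 \<Gamma> z, a62 \<Gamma> z, a63 \<Gamma> z, a64 \<Gamma> z, a65 \<Gamma> z, -1/3 * A1 \<Gamma> z]]"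

definition Omega2 :: "connection \<Rightarrow> real^2 \<Rightarrow> real^6^6" where
  "Omega2 \<Gamma> z = vector [vector [-4/3 * A2 \<Gamma> z, 2/3 * A1 \<Gamma> z, 2 * A0 \<Gamma> z, 1, 0, 0],
     vector [0, 0, 0, 0, -1/2, 0],
     vector [0, -2 * A3 \<Gamma> z, 2/3 * A2 \<Gamma> z, 0, 0, 0],
     vector [0, 0, 0, 0, 0, -1],
     vector [b51 \<Gamma> z, b52 \<Gamma> z, b53 \<Gamma> z, 3 * A3 \<Gamma> z, 1/3 * A2 \<Gamma> z, 0],
     vector [b61 \<Gamma> z, b62 \<Gamma> z, b63 \<Gamma> z, b64 \<Gamma> z, b65 \<Gamma> z, 1/3 * A2 \<Gamma> z]]"

definition Omega :: "2 \<Rightarrow> connection \<Rightarrow> real^2 \<Rightarrow> real^6^6" where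
  "Omega a = (if a = 1 then Omega1 else Omega2)"


subsection \<open>Symmetrised derivatives and the matrices\<close>

definition covD :: "connection \<Rightarrow> 2 \<Rightarrow> (real^2 \<Rightarrow> real^6) \<Rightarrow> real^2 \<Rightarrow> real^6" where
  "covD \<Gamma> a W z = (\<chi> j. pd a (\<lambda>u. W u $ j) z) - W z v* Omega a \<Gamma> z"

definition covD_iter :: "connection \<Rightarrow> 2 list \<Rightarrow> (real^2 \<Rightarrow> real^6) \<Rightarrow> real^2 \<Rightarrow> real^6" where
  "covD_iter \<Gamma> as W = foldr (covD \<Gamma>) as W"

definition covD_sym :: "connection \<Rightarrow> 2 list \<Rightarrow> (real^2 \<Rightarrow> real^6) \<Rightarrow> real^2 \<Rightarrow> real^6" where
  "covD_sym \<Gamma> as W z = (1 / fact (length as)) *\<^sub>R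
     (\<Sum>\<sigma> | \<sigma> permutes {..<length as}. covD_iter \<Gamma> (permute_list \<sigma> as) W z)"

text \<open>
  A symmetrised derivative of order \<open>k\<close> depends only on the number \<open>m\<close> of indices equal to \<open>2\<close>.
  Rows are ordered by the order \<open>k\<close> and then by \<open>m\<close>: for \<open>n = 2\<close> the index lists are
  \<open>[], [1], [2], [1,1], [1,2], [2,2]\<close>; for \<open>n = 5\<close> there are \<open>21\<close> of them.
\<close>

definition sym_rows :: "nat \<Rightarrow> connection \<Rightarrow> real^2 \<Rightarrow> (real^6) list" where
  "sym_rows n \<Gamma> z = concat (map (\<lambda>k. map (\<lambda>m.
      covD_sym \<Gamma> (replicate (k - m) 1 @ replicate m 2) (Vrow \<Gamma>) z) [0..<Suc k]) [0..<Suc n])"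

definition M_mat :: "connection \<Rightarrow> real^2 \<Rightarrow> real^6^6" where
  "M_mat \<Gamma> z = vector (sym_rows 2 \<Gamma> z)"

text \<open>
  The entries of \<open>M_max\<close> are functions on \<open>U\<close>.  Accordingly a rank bound is meant on a neighbourhood
  of \<open>p\<close>, and a kernel vector near \<open>p\<close> is a continuous vector of functions there.  The rank and
  kernel of the single numerical matrix \<open>M_max \<Gamma> p\<close> do not decide metrisability, even when
  the rank of \<open>M_mat \<Gamma>\<close> is locally constant.
\<close>

definition M_max :: "connection \<Rightarrow> real^2 \<Rightarrow> real^6^21" where
  "M_max \<Gamma> z = vector (sym_rows 5 \<Gamma> z)"

end

theory Submission
  imports Defs
begin

text \<open>
  Liouville's substitution \<open>g = \<psi> / \<Delta>\<^sup>2\<close>, \<open>\<Delta> = \<psi>\<^sub>1 \<psi>\<^sub>3 - \<psi>\<^sub>2\<^sup>2\<close>, turns metrisability into a linear system for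
  \<open>\<psi>\<close>, whose prolongation says that \<open>\<Phi> = (\<psi>\<^sub>1, \<psi>\<^sub>2, \<psi>\<^sub>3, \<mu>, \<nu>, \<rho>)\<close> satisfies \<open>d\<Phi> + \<Omega>\<Phi> = 0\<close>. The curvature
  of \<open>\<Omega>\<close> has \<open>V\<close> as its last row and is zero otherwise. Hence parallel sections are annihilated by all
  iterated derivatives of \<open>V\<close>.

  Conversely, let \<open>W\<close> be a continuous kernel vector with \<open>\<Delta>(W(p)) \<noteq> 0\<close>. Points \<open>q\<close> at which the spans
  of the derivatives of \<open>V\<close> of order \<open>< k\<close>, \<open>k \<le> 6\<close>, have locally constant dimension are dense. Near such
  a point these spans grow strictly until they stabilise. As their dimension stays below \<open>6\<close>, they are
  stable at order \<open>5\<close>, so \<open>W(q)\<close> is annihilated by all derivatives of \<open>V\<close> at \<open>q\<close>. By analyticity the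
  transport \<open>\<Phi>\<close> of \<open>W(q)\<close> along the horizontal line through \<open>q\<close> and then along the vertical lines satisfies
  \<open>V \<bullet> \<Phi> = 0\<close>, and so \<open>\<Phi>\<close> is parallel on a box around \<open>p\<close> whose size does not depend on \<open>q\<close>. For \<open>q\<close> close
  to \<open>p\<close>, \<open>\<Phi>(p)\<close> is close to \<open>W(p)\<close> and hence nondegenerate.
\<close>

subsection \<open>Partial derivatives\<close>

text \<open>The order 5 comes from the six-dimensional fibre: a nonzero kernel vector bounds the
  seven spans of orders < 0, ..., < 6 by dimension 5, so two neighbouring ones coincide. The rank
  may drop at p itself, which forces the detour over q; it helps only if the section built from q
  reaches p, hence the box may depend only on bounds for \<open>Omega\<close> and a first derivative
  of it on a fixed ball. The exponent in g = psi / Delta^2 is dictated by det g = Delta^(-3): the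
  inverse substitution psi = |det g|^(-2/3) g then works in every signature. V is the only
  obstruction because the integrability conditions of the first five rows were spent on fixing the
  derivatives of mu, nu, rho. Symmetrising loses nothing, since D_1 D_2 X - D_2 D_1 X is a multiple
  of V and so of lower order. Analyticity enters through bounds C n! L^n on covariant derivatives of
  order n, which control one-variable Taylor remainders along coordinate lines; the section itself
  is never shown to be analytic.\<close>

lemma UNIV_6: "UNIV = {1, 2, 3, 4, 5, 6::6}"
proof -
  have "x = 1 \<or> x = 2 \<or> x = 3 \<or> x = 4 \<or> x = 5 \<or> x = 6" for x :: 6
  proof (induct x)
    case (of_int z)
    then have "z = 0 \<or> z = 1 \<or> z = 2 \<or> z = 3 \<or> z = 4 \<or> z = 5" by fastforce
    then show ?case by auto
  qed
  then show ?thesis by auto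
qed

lemma forall_6: "(\<forall>i::6. Q i) \<longleftrightarrow> Q 1 \<and> Q 2 \<and> Q 3 \<and> Q 4 \<and> Q 5 \<and> Q 6"
proof -
  have "(\<forall>i::6. Q i) \<longleftrightarrow> (\<forall>i\<in>UNIV. Q i)" by simp
  then show ?thesis unfolding UNIV_6 by simp
qed

lemma sum_6: "sum f (UNIV::6 set) = f 1 + f 2 + f 3 + f 4 + f 5 + f 6"
  unfolding UNIV_6 by (simp add: ac_simps)

lemma vector_6:
  "(vector [a, b, c, d, e, f] :: 'a::zero ^ 6) $ 1 = a"
  "(vector [a, b, c, d, e, f] :: 'a ^ 6) $ 2 = b"
  "(vector [a, b, c, d, e, f] :: 'a ^ 6) $ 3 = c"
  "(vector [a, b, c, d, e, f] :: 'a ^ 6) $ 4 = d"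
  "(vector [a, b, c, d, e, f] :: 'a ^ 6) $ 5 = e"
  "(vector [a, b, c, d, e, f] :: 'a ^ 6) $ 6 = f"
  unfolding vector_def by simp_all

lemma has_derivative_line:
  assumes "(f has_derivative f') (at z)"
  shows "((\<lambda>t. f (z + t *\<^sub>R v)) has_derivative (\<lambda>t. f' (t *\<^sub>R v))) (at 0)"
proof -
  have "((\<lambda>t. z + t *\<^sub>R v) has_derivative (\<lambda>t. t *\<^sub>R v)) (at 0)"
    by (auto intro!: derivative_eq_intros)
  moreover have "(f has_derivative f') (at (z + 0 *\<^sub>R v))" using assms by simp
  ultimately show ?thesis by (rule has_derivative_compose)
qed

lemma pd_eq:
  assumes "((\<lambda>t. f (z + t *\<^sub>R axis a 1)) has_real_derivative D) (at 0)"
  shows "pd a f z = D"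
  unfolding pd_def using assms by (rule DERIV_imp_deriv)

lemma has_derivative_imp_line:
  fixes f :: "real^2 \<Rightarrow> real"
  assumes "(f has_derivative f') (at z)"
  shows "((\<lambda>t. f (z + t *\<^sub>R axis a 1)) has_real_derivative f' (axis a 1)) (at 0)"
proof -
  interpret bounded_linear f' using assms by (rule has_derivative_bounded_linear)
  have "(\<lambda>t. f' (t *\<^sub>R axis a 1)) = (*) (f' (axis a 1))"
    by (simp add: fun_eq_iff scaleR)
  then show ?thesis using has_derivative_line[OF assms, of "axis a 1"]
    by (simp add: has_field_derivative_def)
qed

lemma pd_has_derivative:
  assumes "(f has_derivative f') (at z)"
  shows "pd a f z = f' (axis a 1)"
  using has_derivative_imp_line[OF assms] by (rule pd_eq)

lemma pd_line:
  assumes "f differentiable (at z)"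
  shows "((\<lambda>t. f (z + t *\<^sub>R axis a 1)) has_real_derivative pd a f z) (at 0)"
  using assms has_derivative_imp_line pd_has_derivative unfolding differentiable_def by metis

lemma has_derivative_pd:
  assumes "f differentiable (at z)"
  shows "(f has_derivative (\<lambda>h. h $ 1 * pd 1 f z + h $ 2 * pd 2 f z)) (at z)"
proof -
  obtain f' where f': "(f has_derivative f') (at z)" using assms unfolding differentiable_def by blast
  interpret bounded_linear f' using f' by (rule has_derivative_bounded_linear)
  have "f' h = h $ 1 * pd 1 f z + h $ 2 * pd 2 f z" for h
  proof -
    have "h = h $ 1 *\<^sub>R axis 1 1 + h $ 2 *\<^sub>R axis 2 1"
      by (simp add: vec_eq_iff forall_2 axis_def)
    then have "f' h = h $ 1 *\<^sub>R f' (axis 1 1) + h $ 2 *\<^sub>R f' (axis 2 1)"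
      by (metis add scaleR)
    then show ?thesis using pd_has_derivative[OF f'] by simp
  qed
  then show ?thesis using f' by (simp add: has_derivative_eq_rhs ext)
qed

lemma pd_const [simp]: "pd a (\<lambda>u. c) z = 0"
  by (rule pd_eq) simp

lemma pd_add:
  assumes "f differentiable (at z)" "g differentiable (at z)"
  shows "pd a (\<lambda>u. f u + g u) z = pd a f z + pd a g z"
  by (rule pd_eq) (auto intro!: derivative_eq_intros pd_line assms)

lemma pd_diff:
  assumes "f differentiable (at z)" "g differentiable (at z)"
  shows "pd a (\<lambda>u. f u - g u) z = pd a f z - pd a g z"
  by (rule pd_eq) (auto intro!: derivative_eq_intros pd_line assms)

lemma pd_minus:
  assumes "f differentiable (at z)"
  shows "pd a (\<lambda>u. - f u) z = - pd a f z"
  by (rule pd_eq) (auto intro!: derivative_eq_intros pd_line assms)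

lemma pd_mult:
  assumes "f differentiable (at z)" "g differentiable (at z)"
  shows "pd a (\<lambda>u. f u * g u) z = pd a f z * g z + f z * pd a g z"
  by (rule pd_eq) (auto intro!: derivative_eq_intros pd_line assms)

lemma pd_cmult:
  assumes "f differentiable (at z)"
  shows "pd a (\<lambda>u. c * f u) z = c * pd a f z"
  by (rule pd_eq) (auto intro!: derivative_eq_intros pd_line assms)

lemma pd_sum:
  assumes "\<And>i. i \<in> I \<Longrightarrow> f i differentiable (at z)"
  shows "pd a (\<lambda>u. \<Sum>i\<in>I. f i u) z = (\<Sum>i\<in>I. pd a (f i) z)"
  by (rule pd_eq) (auto intro!: derivative_eq_intros pd_line assms)

text \<open>Functions are total but their identities hold only on an open set, so derivatives have
  to be rewritten locally and not by equality of functions.\<close>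

lemma pd_cong:
  assumes "open S" "z \<in> S" "\<And>u. u \<in> S \<Longrightarrow> f u = g u"
  shows "pd a f z = pd a g z"
proof -
  have "((\<lambda>t. z + t *\<^sub>R axis a 1) \<longlongrightarrow> z + 0 *\<^sub>R axis a (1::real)) (nhds 0)"
    by (intro tendsto_intros filterlim_ident)
  then have "\<forall>\<^sub>F t in nhds 0. z + t *\<^sub>R axis a 1 \<in> S"
    using assms(1,2) by (intro topological_tendstoD) auto
  then have "\<forall>\<^sub>F t in nhds 0. f (z + t *\<^sub>R axis a 1) = g (z + t *\<^sub>R axis a 1)"
    by (rule eventually_mono) (rule assms(3))
  then show ?thesis unfolding pd_def by (rule deriv_cong_ev) simp
qed

subsection \<open>Smooth functions\<close>

lemma differentiable_on_open: "open S \<Longrightarrow> f differentiable_on S \<longleftrightarrow> (\<forall>z\<in>S. f differentiable (at z))"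
  unfolding differentiable_on_def by (metis at_within_open)

lemma Ck_on_cong:
  assumes "open S" "\<And>u. u \<in> S \<Longrightarrow> f u = g u" "Ck_on k S f"
  shows "Ck_on k S g"
  using assms
proof (induction k arbitrary: f g)
  case 0
  then show ?case by (metis Ck_on.simps(1) continuous_on_cong)
next
  case (Suc k)
  have "g differentiable_on S"
    unfolding differentiable_on_open[OF assms(1)]
  proof
    fix z assume z: "z \<in> S"
    then obtain f' where "(f has_derivative f') (at z)"
      using Suc.prems(3) by (auto simp: differentiable_on_open[OF assms(1)] differentiable_def)
    then have "(g has_derivative f') (at z)"
      by (rule has_derivative_transform_within_open[OF _ assms(1) z Suc.prems(2)])
    then show "g differentiable (at z)" unfolding differentiable_def by blast
  qed
  moreover have "Ck_on k S (pd a g)" for a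
  proof (rule Suc.IH[OF Suc.prems(1)])
    show "pd a f u = pd a g u" if "u \<in> S" for u using pd_cong[OF Suc.prems(1) that Suc.prems(2)] .
    show "Ck_on k S (pd a f)" using Suc.prems(3) by simp
  qed
  ultimately show ?case by simp
qed

lemma Ck_on_mono:
  assumes "open S" "k \<le> n" "Ck_on n S f" shows "Ck_on k S f"
  using assms(2,3)
proof (induction k arbitrary: n f)
  case 0
  then show ?case by (cases n) (auto simp: differentiable_imp_continuous_on)
next
  case (Suc k)
  then obtain m where "n = Suc m" by (cases n) auto
  with Suc show ?case by auto
qed

lemma Ck_on_subset: "open S \<Longrightarrow> T \<subseteq> S \<Longrightarrow> Ck_on k S f \<Longrightarrow> Ck_on k T f"
  by (induction k arbitrary: f) (auto intro: continuous_on_subset differentiable_on_subset)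

lemma Ck_on_const [simp]: "Ck_on k S (\<lambda>u. c)"
proof (induction k arbitrary: c)
  case (Suc k)
  have "pd a (\<lambda>u. c) = (\<lambda>u. 0)" for a by (auto simp: fun_eq_iff)
  with Suc show ?case by simp
qed simp

lemma Ck_on_add:
  assumes "open S" "Ck_on k S f" "Ck_on k S g" shows "Ck_on k S (\<lambda>u. f u + g u)"
  using assms(2,3)
proof (induction k arbitrary: f g)
  case (Suc k)
  have "Ck_on k S (pd a (\<lambda>u. f u + g u))" for a
    by (rule Ck_on_cong[OF assms(1) _ Suc.IH[of "pd a f" "pd a g"]])
      (use Suc.prems assms(1) in \<open>auto simp: pd_add differentiable_on_open\<close>)
  with Suc.prems show ?case by (auto intro: differentiable_on_add)
qed (auto intro: continuous_on_add)

lemma Ck_on_mult: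
  assumes "open S" "Ck_on k S f" "Ck_on k S g" shows "Ck_on k S (\<lambda>u. f u * g u)"
  using assms(2,3)
proof (induction k arbitrary: f g)
  case (Suc k)
  have "Ck_on k S f" "Ck_on k S g" using Suc.prems Ck_on_mono[OF assms(1), of k "Suc k"] by auto
  then have "Ck_on k S (\<lambda>u. pd a f u * g u + f u * pd a g u)" for a
    using Suc.prems by (intro Ck_on_add Suc.IH assms(1)) auto
  then have "Ck_on k S (pd a (\<lambda>u. f u * g u))" for a
    by (rule Ck_on_cong[OF assms(1), rotated])
      (use Suc.prems assms(1) in \<open>auto simp: pd_mult differentiable_on_open\<close>)
  with Suc.prems show ?case by (auto intro: differentiable_on_mult)
qed (auto intro: continuous_on_mult)

lemma smooth_on_Ck: "smooth_on S f \<Longrightarrow> Ck_on k S f"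
  by (simp add: smooth_on_def)

lemma smooth_on_cong:
  "open S \<Longrightarrow> (\<And>u. u \<in> S \<Longrightarrow> f u = g u) \<Longrightarrow> smooth_on S f \<Longrightarrow> smooth_on S g"
  unfolding smooth_on_def by (intro allI) (erule Ck_on_cong, assumption, erule spec)

lemma smooth_on_subset: "open S \<Longrightarrow> T \<subseteq> S \<Longrightarrow> smooth_on S f \<Longrightarrow> smooth_on T f"
  unfolding smooth_on_def by (intro allI) (rule Ck_on_subset, auto)

lemma smooth_on_const [simp]: "smooth_on S (\<lambda>u. c)"
  by (simp add: smooth_on_def)

lemma smooth_on_add: "open S \<Longrightarrow> smooth_on S f \<Longrightarrow> smooth_on S g \<Longrightarrow> smooth_on S (\<lambda>u. f u + g u)"
  by (simp add: smooth_on_def Ck_on_add)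

lemma smooth_on_mult: "open S \<Longrightarrow> smooth_on S f \<Longrightarrow> smooth_on S g \<Longrightarrow> smooth_on S (\<lambda>u. f u * g u)"
  by (simp add: smooth_on_def Ck_on_mult)

lemma smooth_on_minus: "open S \<Longrightarrow> smooth_on S f \<Longrightarrow> smooth_on S (\<lambda>u. - f u)"
  by (drule smooth_on_mult[OF _ smooth_on_const[of S "-1"]]) simp_all

lemma smooth_on_diff: "open S \<Longrightarrow> smooth_on S f \<Longrightarrow> smooth_on S g \<Longrightarrow> smooth_on S (\<lambda>u. f u - g u)"
  unfolding diff_conv_add_uminus by (intro smooth_on_add smooth_on_minus)

lemma smooth_on_power: "open S \<Longrightarrow> smooth_on S f \<Longrightarrow> smooth_on S (\<lambda>u. f u ^ n)"
  by (induction n) (simp_all add: smooth_on_mult)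

lemma smooth_on_sum:
  "open S \<Longrightarrow> (\<And>i. i \<in> I \<Longrightarrow> smooth_on S (f i)) \<Longrightarrow> smooth_on S (\<lambda>u. \<Sum>i\<in>I. f i u)"
  by (induction I rule: infinite_finite_induct) (simp_all add: smooth_on_add)

lemma smooth_on_pd: "smooth_on S f \<Longrightarrow> smooth_on S (pd a f)"
proof -
  assume "smooth_on S f"
  then have "Ck_on (Suc k) S f" for k unfolding smooth_on_def by blast
  then show "smooth_on S (pd a f)" unfolding smooth_on_def by simp
qed

lemma smooth_on_differentiable: "open S \<Longrightarrow> smooth_on S f \<Longrightarrow> z \<in> S \<Longrightarrow> f differentiable (at z)"
  using smooth_on_Ck[of S f 1] by (simp add: differentiable_on_open)

lemma smooth_on_continuous: "smooth_on S f \<Longrightarrow> continuous_on S f"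
  using smooth_on_Ck[of S f 0] by simp

text \<open>A single outer function is not closed under differentiation, but a sequence of
  successive derivatives is: the chain rule replaces \<open>h n\<close> by \<open>h (Suc n)\<close>
  times a partial derivative of \<open>f\<close>. This is why the induction on \<open>k\<close>
  keeps \<open>n\<close> arbitrary.\<close>

lemma Ck_on_compose_deriv:
  fixes h :: "nat \<Rightarrow> real \<Rightarrow> real"
  assumes "open S" "smooth_on S f" "\<And>u. u \<in> S \<Longrightarrow> f u \<in> T"
    and h: "\<And>n x. x \<in> T \<Longrightarrow> (h n has_real_derivative h (Suc n) x) (at x)"
  shows "Ck_on k S (\<lambda>u. h n (f u))"
proof (induction k arbitrary: n)
  case 0
  have "isCont (h n) x" if "x \<in> T" for x by (rule DERIV_isCont[OF h[OF that]])
  then have "continuous_on T (h n)" by (simp add: continuous_at_imp_continuous_on)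
  then show ?case using smooth_on_continuous[OF assms(2)] assms(3)
    by (auto intro: continuous_on_compose2)
next
  case (Suc k)
  have D: "((\<lambda>u. h n (f u)) has_derivative (\<lambda>v. h (Suc n) (f z) * (v $ 1 * pd 1 f z + v $ 2 * pd 2 f z))) (at z)"
    if "z \<in> S" for z
    using has_derivative_compose[OF has_derivative_pd[OF smooth_on_differentiable[OF assms(1,2) that]]
      h[OF assms(3)[OF that], unfolded has_field_derivative_def]] .
  have pd: "pd a (\<lambda>u. h n (f u)) z = h (Suc n) (f z) * pd a f z" if "z \<in> S" for a z
  proof -
    have fd: "f differentiable (at z)" by (rule smooth_on_differentiable[OF assms(1,2) that])
    have "((\<lambda>t. h n (f (z + t *\<^sub>R axis a 1))) has_real_derivative h (Suc n) (f z) * pd a f z) (at 0)"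
    proof (rule DERIV_chain2[OF _ pd_line[OF fd]])
      show "(h n has_real_derivative h (Suc n) (f z)) (at (f (z + 0 *\<^sub>R axis a 1)))"
        using h[OF assms(3)[OF that], of n] by simp
    qed
    then show ?thesis by (rule pd_eq)
  qed
  have "Ck_on k S (pd a (\<lambda>u. h n (f u)))" for a
    by (rule Ck_on_cong[OF assms(1) _ Ck_on_mult[OF assms(1) Suc.IH[of "Suc n"] smooth_on_Ck[OF smooth_on_pd[OF assms(2), of a]]]])
      (simp add: pd)
  moreover have "(\<lambda>u. h n (f u)) differentiable_on S"
    using D by (auto simp: differentiable_on_open[OF assms(1)] differentiable_def)
  ultimately show ?case by simp
qed

lemma smooth_on_compose_deriv:
  fixes h :: "nat \<Rightarrow> real \<Rightarrow> real"
  assumes "open S" "smooth_on S f" "\<And>u. u \<in> S \<Longrightarrow> f u \<in> T"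
    and "\<And>n x. x \<in> T \<Longrightarrow> (h n has_real_derivative h (Suc n) x) (at x)"
  shows "smooth_on S (\<lambda>u. h 0 (f u))"
  unfolding smooth_on_def by (intro allI Ck_on_compose_deriv[where h = h and T = T] assms)

lemma smooth_on_inverse:
  assumes "open S" "smooth_on S f" "\<And>u. u \<in> S \<Longrightarrow> f u \<noteq> 0"
  shows "smooth_on S (\<lambda>u. inverse (f u))"
proof -
  \<comment> \<open>The n-th derivative of the reciprocal.\<close>
  define h :: "nat \<Rightarrow> real \<Rightarrow> real" where "h n x = (-1) ^ n * fact n * inverse x ^ Suc n" for n x
  have "(h n has_real_derivative h (Suc n) x) (at x)" if "x \<noteq> 0" for n x
  proof -
    have "((\<lambda>x. inverse x ^ Suc n) has_real_derivative real (Suc n) * (- (inverse x ^ Suc (Suc 0)) * inverse x ^ n)) (at x)"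
      using DERIV_power[OF DERIV_inverse[OF that], of "Suc n"] by simp
    from DERIV_cmult[OF this, of "(-1) ^ n * fact n"] show ?thesis
      unfolding h_def by (simp add: algebra_simps)
  qed
  from smooth_on_compose_deriv[OF assms(1,2), where T = "{x. x \<noteq> 0}" and h = h] this assms(3)
  show ?thesis by (simp add: h_def)
qed

lemma smooth_on_powr:
  assumes "open S" "smooth_on S f" "\<And>u. u \<in> S \<Longrightarrow> f u > 0"
  shows "smooth_on S (\<lambda>u. f u powr r)"
proof -
  define h :: "nat \<Rightarrow> real \<Rightarrow> real" where "h n x = (\<Prod>i<n. r - real i) * x powr (r - real n)" for n x
  have "(h n has_real_derivative h (Suc n) x) (at x)" if "x > 0" for n x
  proof -
    have "((\<lambda>x. x powr (r - real n)) has_real_derivative (r - real n) * x powr (r - real n - 1)) (at x)"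
      using that by (rule has_real_derivative_powr)
    from DERIV_cmult[OF this, of "\<Prod>i<n. r - real i"] show ?thesis
      unfolding h_def by (simp add: algebra_simps)
  qed
  from smooth_on_compose_deriv[OF assms(1,2), where T = "{0<..}" and h = h] this assms(3)
  show ?thesis by (simp add: h_def)
qed

section \<open>Symmetry of mixed second derivatives\<close>

lemma second_difference_mvt:
  assumes S: "open S" and f: "Ck_on 2 S f" and h: "h > 0"
    and box: "\<And>s t. 0 \<le> s \<Longrightarrow> s \<le> h \<Longrightarrow> 0 \<le> t \<Longrightarrow> t \<le> h \<Longrightarrow> z + s *\<^sub>R axis a 1 + t *\<^sub>R axis b 1 \<in> S"
  shows "\<exists>s t. 0 < s \<and> s < h \<and> 0 < t \<and> t < h \<and>
    f (z + h *\<^sub>R axis a 1 + h *\<^sub>R axis b 1) - f (z + h *\<^sub>R axis a 1) - f (z + h *\<^sub>R axis b 1) + f z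
      = h * (h * pd b (pd a f) (z + s *\<^sub>R axis a 1 + t *\<^sub>R axis b 1))"
proof -
  have d: "g differentiable (at u)" if "Ck_on (Suc k) S g" "u \<in> S" for g u k
    using that S by (simp add: differentiable_on_open)
  have f1: "Ck_on (Suc 0) S (pd a f)" and f2: "Ck_on (Suc (Suc 0)) S f" using f by (simp_all add: numeral_2_eq_2)
  have lin: "((\<lambda>s. g (w + s *\<^sub>R axis c 1)) has_real_derivative pd c g (w + s *\<^sub>R axis c 1)) (at s)"
    if "g differentiable (at (w + s *\<^sub>R axis c 1))" for g w c s
  proof -
    have "((\<lambda>t. g (w + (s + t) *\<^sub>R axis c 1)) has_real_derivative pd c g (w + s *\<^sub>R axis c 1)) (at 0)"
      using pd_line[OF that, of c] by (simp add: algebra_simps)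
    then show ?thesis using DERIV_shift[of "\<lambda>s. g (w + s *\<^sub>R axis c 1)" "pd c g (w + s *\<^sub>R axis c 1)" 0 s]
      by (simp add: add.commute)
  qed
  \<comment> \<open>The second difference is a first difference of this function in direction
    \<open>a\<close>. The mean value theorem there leaves a difference of \<open>pd a f\<close> in
    direction \<open>b\<close>, to which it is applied once more.\<close>
  define \<phi> where "\<phi> s = f (z + h *\<^sub>R axis b 1 + s *\<^sub>R axis a 1) - f (z + s *\<^sub>R axis a 1)" for s
  have "\<exists>s>0. s < h \<and> \<phi> h - \<phi> 0 = (h - 0) * (pd a f (z + h *\<^sub>R axis b 1 + s *\<^sub>R axis a 1) - pd a f (z + s *\<^sub>R axis a 1))"
  proof (rule MVT2[OF h])
    fix s assume s: "0 \<le> s" "s \<le> h"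
    show "(\<phi> has_real_derivative pd a f (z + h *\<^sub>R axis b 1 + s *\<^sub>R axis a 1) - pd a f (z + s *\<^sub>R axis a 1)) (at s)"
      unfolding \<phi>_def
      using box[of s h] box[of s 0] s h
      by (intro DERIV_diff lin d[OF f2]) (auto simp: algebra_simps)
  qed
  then obtain s where s: "0 < s" "s < h"
    and 1: "\<phi> h - \<phi> 0 = h * (pd a f (z + h *\<^sub>R axis b 1 + s *\<^sub>R axis a 1) - pd a f (z + s *\<^sub>R axis a 1))" by auto
  define \<psi> where "\<psi> t = pd a f (z + s *\<^sub>R axis a 1 + t *\<^sub>R axis b 1)" for t
  have "\<exists>t>0. t < h \<and> \<psi> h - \<psi> 0 = (h - 0) * pd b (pd a f) (z + s *\<^sub>R axis a 1 + t *\<^sub>R axis b 1)"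
  proof (rule MVT2[OF h])
    fix t assume t: "0 \<le> t" "t \<le> h"
    show "(\<psi> has_real_derivative pd b (pd a f) (z + s *\<^sub>R axis a 1 + t *\<^sub>R axis b 1)) (at t)"
      unfolding \<psi>_def using box[of s t] s t by (intro lin d[OF f1]) auto
  qed
  then obtain t where t: "0 < t" "t < h"
    and 2: "\<psi> h - \<psi> 0 = h * pd b (pd a f) (z + s *\<^sub>R axis a 1 + t *\<^sub>R axis b 1)" by auto
  have "f (z + h *\<^sub>R axis a 1 + h *\<^sub>R axis b 1) - f (z + h *\<^sub>R axis a 1) - f (z + h *\<^sub>R axis b 1) + f z = \<phi> h - \<phi> 0"
    by (simp add: \<phi>_def algebra_simps)
  also have "\<dots> = h * (\<psi> h - \<psi> 0)" unfolding 1 \<psi>_def by (simp add: algebra_simps)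
  finally show ?thesis unfolding 2 using s t by blast
qed

text \<open>The second difference does not see the order of the two directions, while its quotient
  by the squared step tends to the mixed derivative taken in either order, by continuity.\<close>

lemma pd_commute:
  assumes S: "open S" and f: "Ck_on 2 S f" and z: "z \<in> S"
  shows "pd a (pd b f) z = pd b (pd a f) z"
proof -
  obtain r where r: "r > 0" "ball z r \<subseteq> S" using S z openE by blast
  have cont: "isCont (pd a (pd b f)) z" for a b
  proof -
    have "continuous_on S (pd a (pd b f))" using f by (simp add: numeral_2_eq_2)
    then show ?thesis using S z continuous_on_eq_continuous_at by blast
  qed
  \<comment> \<open>Any positive null sequence with \<open>2 * H n < r\<close> will do; the bound
    keeps the whole parallelogram inside the ball, and the 3 secures it already for
    \<open>n = 0\<close>.\<close>
  define H where "H n = r / (real n + 3)" for n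
  have H: "H n > 0" "2 * H n < r" for n 
  proof -
    have "r * real n \<ge> 0" using r by simp
    then show "H n > 0" "2 * H n < r" using r by (simp_all add: H_def field_simps add_pos_nonneg)
  qed
  have H0: "H \<longlonglongrightarrow> 0" unfolding H_def
    by (rule tendsto_divide_0[OF tendsto_const]) (intro filterlim_at_top_imp_at_infinity filterlim_tendsto_add_at_top[OF tendsto_const filterlim_real_sequentially, of 3, simplified add.commute])
  have nb: "dist z (z + s *\<^sub>R axis a 1 + t *\<^sub>R axis b 1) \<le> 2 * H n"
    if "0 \<le> s" "s \<le> H n" "0 \<le> t" "t \<le> H n" for s t n a b
  proof -
    have "dist z (z + s *\<^sub>R axis a 1 + t *\<^sub>R axis b 1) = norm (s *\<^sub>R axis a 1 + t *\<^sub>R axis b (1::real) :: real^2)"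
      by (simp add: dist_norm add.assoc norm_minus_commute; simp add: add.commute)
    also have "\<dots> \<le> \<bar>s\<bar> + \<bar>t\<bar>" by (rule norm_triangle_le) (simp add: norm_axis_1)
    finally show ?thesis using that by simp
  qed
  then have box: "z + s *\<^sub>R axis a 1 + t *\<^sub>R axis b 1 \<in> S"
    if "0 \<le> s" "s \<le> H n" "0 \<le> t" "t \<le> H n" for s t n a b
    using r(2) H(2)[of n] that by (meson less_le_trans mem_ball not_le order.strict_trans1 subsetD)
  define \<Delta> where "\<Delta> n a b = f (z + H n *\<^sub>R axis a 1 + H n *\<^sub>R axis b 1) - f (z + H n *\<^sub>R axis a 1) - f (z + H n *\<^sub>R axis b 1) + f z" for n a b
  have sym: "\<Delta> n a b = \<Delta> n b a" for n a b by (simp add: \<Delta>_def algebra_simps)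
  have lim: "(\<lambda>n. \<Delta> n a b / (H n)\<^sup>2) \<longlonglongrightarrow> pd b (pd a f) z" for a b
  proof -
    have "\<exists>w. dist z w \<le> 2 * H n \<and> \<Delta> n a b = H n * (H n * pd b (pd a f) w)" for n
    proof -
      obtain s t where st: "0 < s" "s < H n" "0 < t" "t < H n"
        and eq: "\<Delta> n a b = H n * (H n * pd b (pd a f) (z + s *\<^sub>R axis a 1 + t *\<^sub>R axis b 1))"
        using second_difference_mvt[OF S f H(1)[of n] box[where n = n], of a b] unfolding \<Delta>_def by blast
      show ?thesis using nb[of s n t a b] st eq by (intro exI conjI) auto
    qed
    then obtain w where w: "\<And>n. dist z (w n) \<le> 2 * H n" "\<And>n. \<Delta> n a b = H n * (H n * pd b (pd a f) (w n))"
      by metis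
    have "w \<longlonglongrightarrow> z"
    proof (rule metric_LIMSEQ_I)
      fix e :: real assume "e > 0"
      then have "\<forall>\<^sub>F n in sequentially. H n < e / 2" using order_tendstoD(2)[OF H0, of "e/2"] by simp
      then obtain n0 where "\<And>n. n \<ge> n0 \<Longrightarrow> H n < e / 2" unfolding eventually_sequentially by blast
      then show "\<exists>n0. \<forall>n\<ge>n0. dist (w n) z < e" using w(1) by (metis dist_commute less_divide_eq_numeral1(1) mult.commute order.strict_trans1)
    qed
    then have "(\<lambda>n. pd b (pd a f) (w n)) \<longlonglongrightarrow> pd b (pd a f) z"
      using cont isCont_tendsto_compose by blast
    moreover have "\<Delta> n a b / (H n)\<^sup>2 = pd b (pd a f) (w n)" for n
      using H(1)[of n] w(2)[of n] by (simp add: power2_eq_square)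
    ultimately show ?thesis by simp
  qed
  have "(\<lambda>n. \<Delta> n a b / (H n)\<^sup>2) = (\<lambda>n. \<Delta> n b a / (H n)\<^sup>2)" by (simp add: sym[of _ a b])
  then show ?thesis using LIMSEQ_unique[OF lim[of b a]] lim[of a b] by simp
qed

lemma smooth_pd_commute:
  assumes "open S" "smooth_on S f" "z \<in> S" shows "pd a (pd b f) z = pd b (pd a f) z"
  using pd_commute[OF assms(1) smooth_on_Ck[OF assms(2)] assms(3)] .

subsection \<open>Factorial bounds on derivatives\<close>

lemma smooth_on_foldr_pd: "smooth_on S f \<Longrightarrow> smooth_on S (foldr pd as f)"
  by (induction as) (simp_all add: smooth_on_pd)

lemma foldr_pd_zero: "foldr pd as (\<lambda>u. 0) = (\<lambda>u. 0)"
proof (induction as)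
  case (Cons a as)
  have "pd a (\<lambda>u. 0) = (\<lambda>u. 0)" by (simp add: fun_eq_iff)
  with Cons show ?case by simp
qed simp

lemma foldr_pd_cong:
  assumes "open S" "\<And>u. u \<in> S \<Longrightarrow> f u = g u" "z \<in> S"
  shows "foldr pd as f z = foldr pd as g z"
  using assms(3) by (induction as arbitrary: z) (auto intro: assms(2) pd_cong[OF assms(1)])

lemma foldr_pd_add:
  assumes "open S" "smooth_on S f" "smooth_on S g" "z \<in> S"
  shows "foldr pd as (\<lambda>u. f u + g u) z = foldr pd as f z + foldr pd as g z"
  using assms(4)
proof (induction as arbitrary: z)
  case (Cons a as)
  have "pd a (foldr pd as (\<lambda>u. f u + g u)) z = pd a (\<lambda>u. foldr pd as f u + foldr pd as g u) z"
    using Cons by (intro pd_cong[OF assms(1)])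
  also have "\<dots> = pd a (foldr pd as f) z + pd a (foldr pd as g) z"
    using Cons.prems by (intro pd_add smooth_on_differentiable[OF assms(1)] smooth_on_foldr_pd assms)
  finally show ?case by simp
qed simp

lemma foldr_pd_minus:
  assumes "open S" "smooth_on S f" "z \<in> S"
  shows "foldr pd as (\<lambda>u. - f u) z = - foldr pd as f z"
  using assms(3)
proof (induction as arbitrary: z)
  case (Cons a as)
  have "pd a (foldr pd as (\<lambda>u. - f u)) z = pd a (\<lambda>u. - foldr pd as f u) z"
    using Cons by (intro pd_cong[OF assms(1)])
  also have "\<dots> = - pd a (foldr pd as f) z"
    using Cons.prems by (intro pd_minus smooth_on_differentiable[OF assms(1)] smooth_on_foldr_pd assms)
  finally show ?case by simp
qed simp

lemma foldr_pd_sum: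
  assumes "open S" "finite I" "\<And>i. i \<in> I \<Longrightarrow> smooth_on S (f i)" "z \<in> S"
  shows "foldr pd as (\<lambda>u. \<Sum>i\<in>I. f i u) z = (\<Sum>i\<in>I. foldr pd as (f i) z)"
  using assms(2,3)
proof (induction I)
  case empty
  then show ?case by (simp add: foldr_pd_zero)
next
  case (insert i I)
  then show ?case
    by (simp add: foldr_pd_add[OF assms(1) _ smooth_on_sum[OF assms(1)] assms(4)])
qed

text \<open>The bounds \<open>C * pochhammer \<alpha> n * M ^ n\<close> are the derivatives at \<open>0\<close> of \<open>C * (1 - M * t) powr - \<alpha>\<close>;
  the exponents \<open>\<alpha>\<close> add under multiplication, which makes the Leibniz rule a one-step induction.\<close>

lemma foldr_pd_mult_bound:
  assumes "open S" "z \<in> S" "smooth_on S f" "smooth_on S g"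
    and "\<And>as u. u \<in> S \<Longrightarrow> \<bar>foldr pd as f u\<bar> \<le> C * pochhammer \<alpha> (length as) * M ^ length as"
    and "\<And>as u. u \<in> S \<Longrightarrow> \<bar>foldr pd as g u\<bar> \<le> D * pochhammer \<beta> (length as) * M ^ length as"
  shows "\<bar>foldr pd as (\<lambda>u. f u * g u) z\<bar> \<le> C * D * pochhammer (\<alpha> + \<beta>) (length as) * M ^ length as"
  using assms(3-)
\<comment> \<open>The last entry of the list is the innermost derivative. Peeling it off first lets
  the product rule act once on \<open>f * g\<close>, leaving two products with one entry
  fewer.\<close>
proof (induction as arbitrary: f g C D \<alpha> \<beta> rule: rev_induct)
  case Nil
  from Nil(3)[of z "[]"] Nil(4)[of z "[]"] assms(2)
  have 1: "\<bar>f z\<bar> \<le> C" "\<bar>g z\<bar> \<le> D" by simp_all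
  then have "0 \<le> C" by linarith
  then show ?case using 1 by (simp add: abs_mult mult_mono)
next
  case (snoc a as)
  note sm = smooth_on_pd[OF snoc.prems(1), of a] smooth_on_pd[OF snoc.prems(2), of a]
  let ?n = "length as"
  \<comment> \<open>Differentiating \<open>f\<close> raises its exponent by one and multiplies its
    constant by \<open>\<alpha> * M\<close>, by the recursion of \<open>pochhammer\<close>; the two
    contributions later add up to the factor \<open>\<alpha> + \<beta>\<close>.\<close>
  have bf: "\<bar>foldr pd bs (pd a f) u\<bar> \<le> C * \<alpha> * M * pochhammer (\<alpha> + 1) (length bs) * M ^ length bs"
    if "u \<in> S" for bs u
    using snoc.prems(3)[OF that, of "bs @ [a]"] by (simp add: pochhammer_rec mult_ac)
  have bg: "\<bar>foldr pd bs (pd a g) u\<bar> \<le> D * \<beta> * M * pochhammer (\<beta> + 1) (length bs) * M ^ length bs"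
    if "u \<in> S" for bs u
    using snoc.prems(4)[OF that, of "bs @ [a]"] by (simp add: pochhammer_rec mult_ac)
  have "foldr pd (as @ [a]) (\<lambda>u. f u * g u) z = foldr pd as (\<lambda>u. pd a f u * g u + f u * pd a g u) z"
    using snoc.prems(1,2)
    by (simp, intro foldr_pd_cong[OF assms(1) _ assms(2)] pd_mult smooth_on_differentiable[OF assms(1)])
  also have "\<dots> = foldr pd as (\<lambda>u. pd a f u * g u) z + foldr pd as (\<lambda>u. f u * pd a g u) z"
    by (intro foldr_pd_add[OF assms(1) _ _ assms(2)] smooth_on_mult assms(1) snoc.prems sm)
  finally have "\<bar>foldr pd (as @ [a]) (\<lambda>u. f u * g u) z\<bar> \<le>
    \<bar>foldr pd as (\<lambda>u. pd a f u * g u) z\<bar> + \<bar>foldr pd as (\<lambda>u. f u * pd a g u) z\<bar>" by linarith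
  also have "\<dots> \<le> C * \<alpha> * M * D * pochhammer (\<alpha> + 1 + \<beta>) ?n * M ^ ?n + C * (D * \<beta> * M) * pochhammer (\<alpha> + (\<beta> + 1)) ?n * M ^ ?n"
    by (intro add_mono snoc.IH sm snoc.prems bf bg)
  also have "\<dots> = C * D * pochhammer (\<alpha> + \<beta>) (length (as @ [a])) * M ^ length (as @ [a])"
    by (simp add: pochhammer_rec algebra_simps)
  finally show ?case .
qed

text \<open>Cauchy estimates with constants uniform on \<open>S\<close>, for derivatives taken in
  any order. They survive sums, products and derivatives, and they are the form in which analyticity
  is used along a line.\<close>

definition analytic_bounded_on :: "(real^2) set \<Rightarrow> (real^2 \<Rightarrow> real) \<Rightarrow> bool" where
  "analytic_bounded_on S f \<longleftrightarrow> smooth_on S f \<and>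
    (\<exists>C\<ge>0. \<exists>M\<ge>0. \<forall>z\<in>S. \<forall>as. \<bar>foldr pd as f z\<bar> \<le> C * fact (length as) * M ^ length as)"

text \<open>The bound persists for every larger rate, so several functions can be given a common
  one.\<close>

lemma analytic_bounded_onE:
  assumes "analytic_bounded_on S f"
  obtains C M where "C \<ge> 0" "M \<ge> 0"
    "\<And>M' z as. M \<le> M' \<Longrightarrow> z \<in> S \<Longrightarrow> \<bar>foldr pd as f z\<bar> \<le> C * fact (length as) * M' ^ length as"
proof -
  obtain C M where C: "C \<ge> 0" "M \<ge> 0"
    "\<And>z as. z \<in> S \<Longrightarrow> \<bar>foldr pd as f z\<bar> \<le> C * fact (length as) * M ^ length as"
    using assms unfolding analytic_bounded_on_def by blast
  show ?thesis
  proof (rule that[OF C(1,2)])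
    fix M' z as assume "M \<le> M'" "z \<in> S"
    have "\<bar>foldr pd as f z\<bar> \<le> C * fact (length as) * M ^ length as" by (rule C(3)[OF \<open>z \<in> S\<close>])
    also have "\<dots> \<le> C * fact (length as) * M' ^ length as"
      using C \<open>M \<le> M'\<close> by (intro mult_left_mono power_mono) auto
    finally show "\<bar>foldr pd as f z\<bar> \<le> C * fact (length as) * M' ^ length as" .
  qed
qed

lemma analytic_bounded_on_smooth: "analytic_bounded_on S f \<Longrightarrow> smooth_on S f"
  by (simp add: analytic_bounded_on_def)

lemma analytic_bounded_on_const [simp]: "analytic_bounded_on S (\<lambda>u. c)"
proof -
  have "foldr pd as (\<lambda>u. c) z = 0" if "as \<noteq> []" for as z
  proof -
    obtain bs b where "as = bs @ [b]" using \<open>as \<noteq> []\<close> by (metis rev_exhaust)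
    moreover have "pd b (\<lambda>u. c) = (\<lambda>u. 0)" by (simp add: fun_eq_iff)
    ultimately show ?thesis by (simp add: foldr_pd_zero)
  qed
  then have "\<bar>foldr pd as (\<lambda>u. c) z\<bar> \<le> \<bar>c\<bar> * fact (length as) * 0 ^ length as" for as z
    by (cases "as = []") auto
  then show ?thesis unfolding analytic_bounded_on_def
    by (intro conjI smooth_on_const exI[of _ "\<bar>c\<bar>"] exI[of _ "0::real"]) auto
qed

lemma analytic_bounded_on_add:
  assumes "open S" "analytic_bounded_on S f" "analytic_bounded_on S g"
  shows "analytic_bounded_on S (\<lambda>u. f u + g u)"
proof -
  note sm = assms(2,3)[THEN analytic_bounded_on_smooth]
  obtain C M where C: "C \<ge> 0" "M \<ge> 0"
    "\<And>M' z as. M \<le> M' \<Longrightarrow> z \<in> S \<Longrightarrow> \<bar>foldr pd as f z\<bar> \<le> C * fact (length as) * M' ^ length as"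
    using analytic_bounded_onE[OF assms(2)] by blast
  obtain D N where D: "D \<ge> 0" "N \<ge> 0"
    "\<And>M' z as. N \<le> M' \<Longrightarrow> z \<in> S \<Longrightarrow> \<bar>foldr pd as g z\<bar> \<le> D * fact (length as) * M' ^ length as"
    using analytic_bounded_onE[OF assms(3)] by blast
  have "\<bar>foldr pd as (\<lambda>u. f u + g u) z\<bar> \<le> (C + D) * fact (length as) * (max M N) ^ length as" if "z \<in> S" for z as
    using C(3)[of "max M N" z as] D(3)[of "max M N" z as] that
    by (simp add: foldr_pd_add[OF assms(1) sm that] distrib_right)
  moreover have "smooth_on S (\<lambda>u. f u + g u)" by (intro smooth_on_add assms(1) sm)
  ultimately show ?thesis unfolding analytic_bounded_on_def
    by (intro conjI exI[of _ "C + D"] exI[of _ "max M N"]) (use C D in auto)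
qed

lemma Suc_le_two_power: "real (Suc n) \<le> 2 ^ n"
  by (induction n) auto

lemma analytic_bounded_on_mult:
  assumes "open S" "analytic_bounded_on S f" "analytic_bounded_on S g"
  shows "analytic_bounded_on S (\<lambda>u. f u * g u)"
proof -
  note sm = assms(2,3)[THEN analytic_bounded_on_smooth]
  obtain C M where C: "C \<ge> 0" "M \<ge> 0"
    "\<And>M' z as. M \<le> M' \<Longrightarrow> z \<in> S \<Longrightarrow> \<bar>foldr pd as f z\<bar> \<le> C * fact (length as) * M' ^ length as"
    using analytic_bounded_onE[OF assms(2)] by blast
  obtain D N where D: "D \<ge> 0" "N \<ge> 0"
    "\<And>M' z as. N \<le> M' \<Longrightarrow> z \<in> S \<Longrightarrow> \<bar>foldr pd as g z\<bar> \<le> D * fact (length as) * M' ^ length as"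
    using analytic_bounded_onE[OF assms(3)] by blast
  let ?M = "max M N"
  have "\<bar>foldr pd as (\<lambda>u. f u * g u) z\<bar> \<le> C * D * fact (length as) * (2 * ?M) ^ length as" if "z \<in> S" for z as
  proof -
    have "\<bar>foldr pd as (\<lambda>u. f u * g u) z\<bar> \<le> C * D * pochhammer (1 + 1) (length as) * ?M ^ length as"
      by (rule foldr_pd_mult_bound[OF assms(1) that sm]) (use C(3) D(3) in \<open>auto simp: pochhammer_fact[symmetric]\<close>)
    \<comment> \<open>Exponent 2 yields (n + 1)! instead of n!; the extra factor n + 1 is at most
      2^n and is absorbed by doubling the rate.\<close>
    also have "pochhammer (1 + 1 :: real) (length as) = real (Suc (length as)) * fact (length as)"
      using pochhammer_rec[of "1::real" "length as"] by (simp add: pochhammer_fact[symmetric])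
    also have "C * D * (real (Suc (length as)) * fact (length as)) * ?M ^ length as
      \<le> C * D * (2 ^ length as * fact (length as)) * ?M ^ length as"
      using C D Suc_le_two_power by (intro mult_right_mono mult_left_mono) auto
    finally show ?thesis by (simp add: power_mult_distrib mult_ac)
  qed
  moreover have "smooth_on S (\<lambda>u. f u * g u)" by (intro smooth_on_mult assms(1) sm)
  moreover have "C * D \<ge> 0" "2 * ?M \<ge> 0" using C D by auto
  ultimately show ?thesis unfolding analytic_bounded_on_def
    by (intro conjI exI[of _ "C * D"] exI[of _ "2 * ?M"]) auto
qed

lemma analytic_bounded_on_pd:
  assumes "analytic_bounded_on S f"
  shows "analytic_bounded_on S (pd a f)"
proof -
  obtain C M where C: "C \<ge> 0" "M \<ge> 0"
    "\<And>M' z as. M \<le> M' \<Longrightarrow> z \<in> S \<Longrightarrow> \<bar>foldr pd as f z\<bar> \<le> C * fact (length as) * M' ^ length as"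
    using analytic_bounded_onE[OF assms] by blast
  have "\<bar>foldr pd as (pd a f) z\<bar> \<le> C * M * fact (length as) * (2 * M) ^ length as" if "z \<in> S" for z as
  proof -
    have "\<bar>foldr pd as (pd a f) z\<bar> \<le> (C * M * fact (length as) * M ^ length as) * real (Suc (length as))"
      using C(3)[OF order_refl that, of "as @ [a]"] by (simp add: algebra_simps)
    also have "\<dots> \<le> (C * M * fact (length as) * M ^ length as) * 2 ^ length as"
      using C Suc_le_two_power by (intro mult_left_mono) auto
    finally show ?thesis by (simp add: power_mult_distrib mult_ac)
  qed
  moreover have "C * M \<ge> 0" "2 * M \<ge> 0" using C by auto
  ultimately show ?thesis using smooth_on_pd[OF analytic_bounded_on_smooth[OF assms]]
    unfolding analytic_bounded_on_def
    by (intro conjI exI[of _ "C * M"] exI[of _ "2 * M"]) auto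
qed

lemma analytic_bounded_on_minus:
  "open S \<Longrightarrow> analytic_bounded_on S f \<Longrightarrow> analytic_bounded_on S (\<lambda>u. - f u)"
  by (drule analytic_bounded_on_mult[OF _ analytic_bounded_on_const[of S "-1"]]) simp_all

lemma analytic_bounded_on_diff:
  "open S \<Longrightarrow> analytic_bounded_on S f \<Longrightarrow> analytic_bounded_on S g \<Longrightarrow> analytic_bounded_on S (\<lambda>u. f u - g u)"
  unfolding diff_conv_add_uminus by (intro analytic_bounded_on_add analytic_bounded_on_minus)

lemma analytic_bounded_on_power:
  "open S \<Longrightarrow> analytic_bounded_on S f \<Longrightarrow> analytic_bounded_on S (\<lambda>u. f u ^ n)"
  by (induction n) (simp_all add: analytic_bounded_on_mult)

subsection \<open>Double power series\<close>

lemma Suc_times_power_bound: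
  fixes q :: real
  assumes "0 \<le> q" "q < 1"
  shows "\<exists>B\<ge>0. \<forall>i. real (Suc i) * q ^ i \<le> B"
proof -
  have "(\<lambda>i. real i * q ^ i + q ^ i) \<longlonglongrightarrow> 0 + 0"
    using assms by (intro tendsto_add powser_times_n_limit_0 LIMSEQ_power_zero) auto
  then have "Bseq (\<lambda>i. real i * q ^ i + q ^ i)" by (intro convergent_imp_Bseq convergentI)
  then obtain B where B: "B > 0" "\<And>i. norm (real i * q ^ i + q ^ i) \<le> B" unfolding Bseq_def by blast
  have "real (Suc i) * q ^ i \<le> B" for i
  proof -
    have "real i * q ^ i + q ^ i \<le> B" using B(2)[of i] unfolding real_norm_def by linarith
    then show ?thesis by (simp add: algebra_simps)
  qed
  then show ?thesis using \<open>B > 0\<close> by (intro exI[of _ B]) auto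
qed

text \<open>Summing over \<open>j\<close> first gives an ordinary power series in \<open>x\<close>,
  which may be differentiated termwise. What remains is to regroup the result as a double series,
  for which that double series must be shown absolutely summable.\<close>

lemma double_power_series_deriv:
  fixes c :: "nat \<Rightarrow> nat \<Rightarrow> real"
  assumes ps: "\<And>x y. \<bar>x\<bar> < \<rho> \<Longrightarrow> \<bar>y\<bar> < \<rho> \<Longrightarrow> ((\<lambda>(i, j). c i j * x ^ i * y ^ j) has_sum f x y) UNIV"
    and x: "\<bar>x\<bar> < \<rho>" and y: "\<bar>y\<bar> < \<rho>"
  shows "\<exists>D. ((\<lambda>x. f x y) has_real_derivative D) (at x) \<and>
    ((\<lambda>(i, j). (real (Suc i) * c (Suc i) j) * x ^ i * y ^ j) has_sum D) UNIV"
proof -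
  \<comment> \<open>Absolute summability at the larger abscissa \<open>r\<close> leaves room for the
    factor \<open>Suc i\<close> that differentiation creates.\<close>
  obtain r where r: "\<bar>x\<bar> < r" "r < \<rho>" using x dense by blast
  then have r0: "r > 0" by linarith
  have "(\<lambda>(i, j). c i j * r ^ i * y ^ j) summable_on UNIV"
    using has_sum_imp_summable[OF ps[of r y]] r r0 y by auto
  then have abs: "(\<lambda>(i, j). \<bar>c i j\<bar> * r ^ i * \<bar>y\<bar> ^ j) summable_on UNIV"
    using r0 by (drule_tac summable_on_iff_abs_summable_on_real[THEN iffD1])
      (simp add: case_prod_unfold abs_mult power_abs)
  have slice: "(\<lambda>j. c i j * y ^ j) summable_on UNIV" for i
  proof -
    have "(\<lambda>(i, j). c i j * r ^ i * y ^ j) summable_on (Pair i ` UNIV)"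
      using \<open>(\<lambda>(i, j). c i j * r ^ i * y ^ j) summable_on UNIV\<close> by (rule summable_on_subset_banach) simp
    then have "(\<lambda>j. c i j * r ^ i * y ^ j) summable_on UNIV"
      by (subst (asm) summable_on_reindex) (auto simp: inj_on_def o_def)
    then have "(\<lambda>j. inverse (r ^ i) * (c i j * r ^ i * y ^ j)) summable_on UNIV"
      by (rule summable_on_cmult_right)
    then show ?thesis using r0 by (simp add: field_simps)
  qed
  define d where "d i = (\<Sum>\<^sub>\<infinity>j. c i j * y ^ j)" for i
  have d: "((\<lambda>j. c i j * y ^ j) has_sum d i) UNIV" for i
    unfolding d_def using slice by (rule has_sum_infsum)
  have sums: "(\<lambda>i. d i * t ^ i) sums f t y" if "\<bar>t\<bar> < \<rho>" for t
  proof (rule has_sum_imp_sums, rule has_sum_SigmaD[where B = "\<lambda>_. UNIV" and f = "\<lambda>(i, j). c i j * t ^ i * y ^ j"])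
    show "((\<lambda>(i, j). c i j * t ^ i * y ^ j) has_sum f t y) (UNIV \<times> UNIV)" using ps[OF that y] by simp
    show "((\<lambda>j. case (i, j) of (i, j) \<Rightarrow> c i j * t ^ i * y ^ j) has_sum d i * t ^ i) UNIV" for i
      using has_sum_cmult_left[OF d[of i], of "t ^ i"] by (simp add: mult_ac)
  qed
  have "((\<lambda>x. \<Sum>i. d i * x ^ i) has_real_derivative (\<Sum>i. diffs d i * x ^ i)) (at x)"
    using sums_summable[OF sums[of r]] r r0 by (intro termdiffs_strong[of d r]) auto
  then have D1: "((\<lambda>x. f x y) has_real_derivative (\<Sum>i. diffs d i * x ^ i)) (at x)"
    by (rule has_field_derivative_transform_within_open[where S = "{-\<rho><..<\<rho>}"])
      (use x sums in \<open>auto simp: sums_iff\<close>)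
  let ?h = "\<lambda>(i, j). (real (Suc i) * c (Suc i) j) * x ^ i * y ^ j"
  \<comment> \<open>The room between the absolute value of \<open>x\<close> and \<open>r\<close>:
    \<open>B\<close> bounds the new factor times the geometric decay, so the series at
    \<open>r\<close> is a majorant.\<close>
  obtain B where B: "B \<ge> 0" "\<And>i. real (Suc i) * (\<bar>x\<bar> / r) ^ i \<le> B"
    using Suc_times_power_bound[of "\<bar>x\<bar> / r"] r r0 by auto
  have "(\<lambda>(i, j). \<bar>c i j\<bar> * r ^ i * \<bar>y\<bar> ^ j) summable_on (map_prod Suc id ` UNIV)"
    using abs by (rule summable_on_subset_banach) simp
  then have "(\<lambda>(i, j). \<bar>c (Suc i) j\<bar> * r ^ Suc i * \<bar>y\<bar> ^ j) summable_on UNIV"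
    by (subst (asm) summable_on_reindex) (auto simp: inj_on_def o_def case_prod_unfold)
  then have "(\<lambda>ij. B / r * (case ij of (i, j) \<Rightarrow> \<bar>c (Suc i) j\<bar> * r ^ Suc i * \<bar>y\<bar> ^ j)) summable_on UNIV"
    by (rule summable_on_cmult_right)
  then have "(\<lambda>ij. norm (?h ij)) summable_on UNIV"
  proof (rule summable_on_comparison_test)
    fix ij :: "nat \<times> nat"
    obtain i j where [simp]: "ij = (i, j)" by force
    have "real (Suc i) * \<bar>x\<bar> ^ i \<le> B * r ^ i"
      using B(2)[of i] r0 by (simp add: power_divide field_simps)
    then have "\<bar>c (Suc i) j\<bar> * \<bar>y\<bar> ^ j * (real (Suc i) * \<bar>x\<bar> ^ i) \<le> \<bar>c (Suc i) j\<bar> * \<bar>y\<bar> ^ j * (B * r ^ i)"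
      by (intro mult_left_mono) auto
    then show "norm (?h ij) \<le> B / r * (case ij of (i, j) \<Rightarrow> \<bar>c (Suc i) j\<bar> * r ^ Suc i * \<bar>y\<bar> ^ j)"
      using r0 by (simp add: abs_mult power_abs mult_ac del: of_nat_Suc)
  qed auto
  then have h: "?h summable_on UNIV" by (rule abs_summable_summable)
  have "(\<lambda>i. real (Suc i) * d (Suc i) * x ^ i) sums infsum ?h UNIV"
  proof (rule has_sum_imp_sums, rule has_sum_SigmaD[where B = "\<lambda>_. UNIV" and f = ?h])
    show "(?h has_sum infsum ?h UNIV) (UNIV \<times> UNIV)" using has_sum_infsum[OF h] by simp
    show "((\<lambda>j. ?h (i, j)) has_sum real (Suc i) * d (Suc i) * x ^ i) UNIV" for i
      using has_sum_cmult_right[OF d[of "Suc i"], of "real (Suc i) * x ^ i"] by (simp add: mult_ac del: of_nat_Suc)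
  qed
  then have "(\<Sum>i. diffs d i * x ^ i) = infsum ?h UNIV" by (simp add: sums_iff diffs_def)
  then show ?thesis using D1 has_sum_infsum[OF h] by auto
qed

text \<open>The quotient is \<open>fact k\<close> times a binomial coefficient, and a binomial
  coefficient is at most a power of two.\<close>

lemma fact_ratio_bound: "fact (s + k) / fact s \<le> (2 ^ (s + k) * fact k :: real)"
proof -
  have "real ((s + k) choose k) \<le> real (2 ^ (s + k))" by (intro of_nat_mono binomial_le_pow2)
  then show ?thesis by (simp add: binomial_fact field_simps)
qed

lemma power_series_partials:
  fixes f :: "real^2 \<Rightarrow> real" and p :: "real^2"
  assumes ps: "\<And>z. \<bar>z $ 1 - p $ 1\<bar> < \<rho> \<Longrightarrow> \<bar>z $ 2 - p $ 2\<bar> < \<rho> \<Longrightarrow>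
      ((\<lambda>(i, j). c i j * (z $ 1 - p $ 1) ^ i * (z $ 2 - p $ 2) ^ j) has_sum f z) UNIV"
    and z: "\<bar>z $ 1 - p $ 1\<bar> < \<rho>" "\<bar>z $ 2 - p $ 2\<bar> < \<rho>"
  shows "((\<lambda>(i, j). (real (Suc i) * c (Suc i) j) * (z $ 1 - p $ 1) ^ i * (z $ 2 - p $ 2) ^ j) has_sum pd 1 f z) UNIV"
    and "((\<lambda>(i, j). (real (Suc j) * c i (Suc j)) * (z $ 1 - p $ 1) ^ i * (z $ 2 - p $ 2) ^ j) has_sum pd 2 f z) UNIV"
proof -
  define F where "F x y = f (vector [p $ 1 + x, p $ 2 + y])" for x y
  have F: "((\<lambda>(i, j). c i j * x ^ i * y ^ j) has_sum F x y) UNIV" if "\<bar>x\<bar> < \<rho>" "\<bar>y\<bar> < \<rho>" for x y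
    using ps[of "vector [p $ 1 + x, p $ 2 + y]"] that by (simp add: F_def)
  \<comment> \<open>Exchanging the summation indices turns differentiation in the second variable
    into the case already treated.\<close>
  have F': "((\<lambda>(j, i). c i j * y ^ j * x ^ i) has_sum F x y) UNIV" if "\<bar>y\<bar> < \<rho>" "\<bar>x\<bar> < \<rho>" for x y
    using has_sum_swap[where f = "\<lambda>(i, j). c i j * x ^ i * y ^ j" and A = UNIV and B = UNIV] F[OF that(2,1)]
    by (simp add: mult_ac)
  obtain D1 where D1: "((\<lambda>x. F x (z $ 2 - p $ 2)) has_real_derivative D1) (at (z $ 1 - p $ 1))"
    "((\<lambda>(i, j). (real (Suc i) * c (Suc i) j) * (z $ 1 - p $ 1) ^ i * (z $ 2 - p $ 2) ^ j) has_sum D1) UNIV"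
    using double_power_series_deriv[of \<rho> c F, OF F z] by blast
  obtain D2 where D2: "((\<lambda>y. F (z $ 1 - p $ 1) y) has_real_derivative D2) (at (z $ 2 - p $ 2))"
    "((\<lambda>(j, i). (real (Suc j) * c i (Suc j)) * (z $ 2 - p $ 2) ^ j * (z $ 1 - p $ 1) ^ i) has_sum D2) UNIV"
    using double_power_series_deriv[of \<rho> "\<lambda>j i. c i j" "\<lambda>y x. F x y", OF F' z(2,1)] by blast
  have e1: "vector [z $ 1 + t, z $ 2] = z + t *\<^sub>R axis 1 (1::real)" for t
    by (simp add: vec_eq_iff forall_2 axis_def)
  have e2: "vector [z $ 1, z $ 2 + t] = z + t *\<^sub>R axis 2 (1::real)" for t
    by (simp add: vec_eq_iff forall_2 axis_def)
  have "((\<lambda>t. F (z $ 1 - p $ 1 + t) (z $ 2 - p $ 2)) has_real_derivative D1) (at 0)"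
    using D1(1) DERIV_shift[of "\<lambda>x. F x (z $ 2 - p $ 2)" D1 0 "z $ 1 - p $ 1"] by (simp add: add.commute)
  then have "pd 1 f z = D1" by (intro pd_eq) (simp add: F_def e1[symmetric] algebra_simps)
  with D1(2) show "((\<lambda>(i, j). (real (Suc i) * c (Suc i) j) * (z $ 1 - p $ 1) ^ i * (z $ 2 - p $ 2) ^ j) has_sum pd 1 f z) UNIV"
    by simp
  have "((\<lambda>t. F (z $ 1 - p $ 1) (z $ 2 - p $ 2 + t)) has_real_derivative D2) (at 0)"
    using D2(1) DERIV_shift[of "\<lambda>y. F (z $ 1 - p $ 1) y" D2 0 "z $ 2 - p $ 2"] by (simp add: add.commute)
  then have "pd 2 f z = D2" by (intro pd_eq) (simp add: F_def e2[symmetric] algebra_simps)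
  then show "((\<lambda>(i, j). (real (Suc j) * c i (Suc j)) * (z $ 1 - p $ 1) ^ i * (z $ 2 - p $ 2) ^ j) has_sum pd 2 f z) UNIV"
    using D2(2) has_sum_swap[where f = "\<lambda>(j, i). (real (Suc j) * c i (Suc j)) * (z $ 2 - p $ 2) ^ j * (z $ 1 - p $ 1) ^ i" and A = UNIV and B = UNIV]
    by (simp add: mult_ac)
qed

text \<open>One differentiation multiplies a coefficient by an exponent, which is at most its total
  degree. The quotient of factorials is the product of these degrees, so the bound does not depend
  on which variables are differentiated.\<close>

lemma power_series_foldr_pd:
  fixes f :: "real^2 \<Rightarrow> real" and p :: "real^2"
  assumes ps: "\<And>z. \<bar>z $ 1 - p $ 1\<bar> < \<rho> \<Longrightarrow> \<bar>z $ 2 - p $ 2\<bar> < \<rho> \<Longrightarrow>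
      ((\<lambda>(i, j). c i j * (z $ 1 - p $ 1) ^ i * (z $ 2 - p $ 2) ^ j) has_sum f z) UNIV"
    and c: "\<And>i j. \<bar>c i j\<bar> \<le> C * R ^ (i + j)"
  shows "\<exists>d. (\<forall>z. \<bar>z $ 1 - p $ 1\<bar> < \<rho> \<longrightarrow> \<bar>z $ 2 - p $ 2\<bar> < \<rho> \<longrightarrow>
      ((\<lambda>(i, j). d i j * (z $ 1 - p $ 1) ^ i * (z $ 2 - p $ 2) ^ j) has_sum foldr pd as f z) UNIV) \<and>
    (\<forall>i j. \<bar>d i j\<bar> \<le> C * R ^ (i + j + length as) * (fact (i + j + length as) / fact (i + j)))"
proof (induction as)
  case Nil
  show ?case using assms by (intro exI[of _ c]) simp
next
  case (Cons a as)
  then obtain d where d: "\<And>z. \<bar>z $ 1 - p $ 1\<bar> < \<rho> \<Longrightarrow> \<bar>z $ 2 - p $ 2\<bar> < \<rho> \<Longrightarrow>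
      ((\<lambda>(i, j). d i j * (z $ 1 - p $ 1) ^ i * (z $ 2 - p $ 2) ^ j) has_sum foldr pd as f z) UNIV"
    and b: "\<And>i j. \<bar>d i j\<bar> \<le> C * R ^ (i + j + length as) * (fact (i + j + length as) / fact (i + j))"
    by blast
  have step: "real (Suc m) * \<bar>d i j\<bar> \<le> C * R ^ (s + length (a # as)) * (fact (s + length (a # as)) / fact s)"
    if "i + j = Suc s" "m \<le> s" for i j m s
  proof -
    have "real (Suc m) * \<bar>d i j\<bar> \<le> real (Suc s) * \<bar>d i j\<bar>" using that by (intro mult_right_mono) auto
    also have "\<dots> \<le> real (Suc s) * (C * R ^ (i + j + length as) * (fact (i + j + length as) / fact (i + j)))"
      using b by (intro mult_left_mono) auto
    also have "\<dots> = C * R ^ (s + length (a # as)) * (fact (s + length (a # as)) / fact s)"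
      unfolding that(1) by (simp add: field_simps del: of_nat_Suc)
    finally show ?thesis .
  qed
  show ?case
  proof (cases "a = 1")
    case True
    have "\<bar>real (Suc i) * d (Suc i) j\<bar> \<le> C * R ^ (i + j + length (a # as)) * (fact (i + j + length (a # as)) / fact (i + j))" for i j
      using step[of "Suc i" j "i + j" i] by (simp add: abs_mult del: of_nat_Suc)
    then show ?thesis
      using power_series_partials(1)[where f = "foldr pd as f" and c = d, OF d] True
      by (intro exI[of _ "\<lambda>i j. real (Suc i) * d (Suc i) j"]) (simp del: of_nat_Suc)
  next
    case False
    then have "a = 2" using exhaust_2 by metis
    have "\<bar>real (Suc j) * d i (Suc j)\<bar> \<le> C * R ^ (i + j + length (a # as)) * (fact (i + j + length (a # as)) / fact (i + j))" for i j
      using step[of i "Suc j" "i + j" j] by (simp add: abs_mult del: of_nat_Suc)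
    then show ?thesis
      using power_series_partials(2)[where f = "foldr pd as f" and c = d, OF d] \<open>a = 2\<close>
      by (intro exI[of _ "\<lambda>i j. real (Suc j) * d i (Suc j)"]) (simp del: of_nat_Suc)
  qed
qed

lemma has_sum_geometric_half: "((\<lambda>(i, j). K * (1/2) ^ i * (1/2) ^ j) has_sum (4 * K :: real)) (UNIV :: (nat \<times> nat) set)"
proof -
  have g: "((\<lambda>i. (1/2 :: real) ^ i) has_sum 2) UNIV"
    using geometric_sums[of "1/2 :: real"] by (intro norm_summable_imp_has_sum) (auto simp: summable_geometric)
  have inner: "((\<lambda>j. case (i, j) of (i, j) \<Rightarrow> (1/2 :: real) ^ i * (1/2) ^ j) has_sum (1/2) ^ i * 2) UNIV" for i :: nat
    using has_sum_cmult_right[OF g, of "(1/2) ^ i"] by simp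
  have outer: "((\<lambda>i::nat. (1/2 :: real) ^ i * 2) has_sum 2 * 2) UNIV" by (rule has_sum_cmult_left[OF g])
  have "(\<lambda>(i, j). (1/2 :: real) ^ i * (1/2) ^ j) summable_on (UNIV :: nat set) \<times> (UNIV :: nat set)"
    by (rule summable_on_SigmaI[OF inner]) (use outer in \<open>auto simp: has_sum_imp_summable\<close>)
  from has_sum_SigmaI[OF inner outer this]
  have "((\<lambda>(i, j). (1/2 :: real) ^ i * (1/2) ^ j) has_sum 4) (UNIV :: (nat \<times> nat) set)" by simp
  from has_sum_cmult_right[OF this, of K] show ?thesis by (simp add: case_prod_unfold mult_ac)
qed

text \<open>Absolute convergence at a point off the axes bounds the coefficients geometrically;
  differentiating the series and moving closer to \<open>p\<close> leaves a double geometric series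
  of ratio 1/2.\<close>

lemma real_analytic_imp_analytic_bounded:
  assumes ra: "real_analytic_on U f" and sm: "smooth_on U f" and U: "open U" and p: "p \<in> U"
  shows "\<exists>r>0. ball p r \<subseteq> U \<and> analytic_bounded_on (ball p r) f"
proof -
  obtain r c where r: "r > 0" and c: "\<And>z. z \<in> ball p r \<Longrightarrow>
      ((\<lambda>(i, j). c i j * (z $ 1 - p $ 1) ^ i * (z $ 2 - p $ 2) ^ j) has_sum f z) UNIV"
    using ra p unfolding real_analytic_on_def by meson
  \<comment> \<open>Halving turns the ball into a square: the norm is at most the sum of the two
    coordinates, so the square of half-width \<open>\<rho>\<close> lies in the ball.\<close>
  define \<rho> where "\<rho> = r / 2"
  have \<rho>: "\<rho> > 0" using r by (simp add: \<rho>_def)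
  have box: "z \<in> ball p r" if "\<bar>z $ 1 - p $ 1\<bar> \<le> \<rho>" "\<bar>z $ 2 - p $ 2\<bar> < \<rho>" for z
  proof -
    have "norm (z - p) \<le> (\<Sum>i\<in>UNIV. \<bar>(z - p) $ i\<bar>)" by (rule norm_le_l1_cart)
    also have "\<dots> < r" using that by (simp add: sum_2 \<rho>_def)
    finally show ?thesis by (simp add: dist_norm norm_minus_commute)
  qed
  define s where "s = \<rho> / 2"
  have s: "s > 0" "s < \<rho>" using \<rho> by (auto simp: s_def)
  define w :: "real^2" where "w = vector [p $ 1 + s, p $ 2 + s]"
  have "(\<lambda>(i, j). c i j * s ^ i * s ^ j) summable_on UNIV"
    using c[OF box[of w]] s by (auto simp: w_def dest: has_sum_imp_summable)
  then have abs: "(\<lambda>ij. norm (case ij of (i, j) \<Rightarrow> c i j * s ^ i * s ^ j)) summable_on UNIV"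
    by (rule summable_on_iff_abs_summable_on_real[THEN iffD1])
  define C where "C = (\<Sum>\<^sub>\<infinity>ij. norm (case ij of (i, j) \<Rightarrow> c i j * s ^ i * s ^ j))"
  have C: "\<bar>c i j\<bar> \<le> C * (1 / s) ^ (i + j)" for i j
  proof -
    have "(\<Sum>\<^sub>\<infinity>ij\<in>{(i, j)}. norm (case ij of (i, j) \<Rightarrow> c i j * s ^ i * s ^ j)) \<le> C"
      unfolding C_def by (intro infsum_mono_neutral summable_on_finite abs) auto
    then show ?thesis using s by (simp add: abs_mult power_add power_divide field_simps)
  qed
  have C0: "C \<ge> 0" unfolding C_def by (intro infsum_nonneg) auto
  \<comment> \<open>The 2 pays for the powers of two from \<open>fact_ratio_bound\<close>.\<close>
  define R where "R = 2 / s"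
  have R: "R > 0" using s by (simp add: R_def)
  obtain r0 where r0: "r0 > 0" "ball p r0 \<subseteq> U" using U p openE by blast
  \<comment> \<open>With distance below \<open>1 / (2 * R)\<close> each variable contributes ratio
    1/2, and the double geometric series sums to the factor 4 in the final bound.\<close>
  define e where "e = min r0 (min \<rho> (1 / (2 * R)))"
  have e: "e > 0" using r0 \<rho> R by (simp add: e_def)
  have "\<bar>foldr pd as f z\<bar> \<le> 4 * C * fact (length as) * R ^ length as" if "z \<in> ball p e" for z as
  proof -
    have zc: "\<bar>z $ i - p $ i\<bar> < e" for i
      using that component_le_norm_cart[of "z - p" i] by (simp add: dist_norm norm_minus_commute)
    obtain d where d: "\<And>z. \<bar>z $ 1 - p $ 1\<bar> < \<rho> \<Longrightarrow> \<bar>z $ 2 - p $ 2\<bar> < \<rho> \<Longrightarrow>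
      ((\<lambda>(i, j). d i j * (z $ 1 - p $ 1) ^ i * (z $ 2 - p $ 2) ^ j) has_sum foldr pd as f z) UNIV"
      and b: "\<And>i j. \<bar>d i j\<bar> \<le> C * (1/s) ^ (i + j + length as) * (fact (i + j + length as) / fact (i + j))"
      using power_series_foldr_pd[of p \<rho> c f C "1/s" as, OF c[OF box] C] by force
    let ?K = "C * fact (length as) * R ^ length as"
    have "norm (d i j * (z $ 1 - p $ 1) ^ i * (z $ 2 - p $ 2) ^ j) \<le> ?K * (1/2) ^ i * (1/2) ^ j" for i j
    proof -
      have "\<bar>d i j\<bar> \<le> C * (1/s) ^ (i + j + length as) * (2 ^ (i + j + length as) * fact (length as))"
        using b[of i j] fact_ratio_bound[of "i + j" "length as"] C0 s
        by (smt (verit, best) mult_left_mono mult_nonneg_nonneg zero_le_power divide_nonneg_pos)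
      also have "\<dots> = ?K * R ^ i * R ^ j"
        by (simp add: R_def power_add power_divide mult_ac)
      finally have "\<bar>d i j\<bar> * (\<bar>z $ 1 - p $ 1\<bar> ^ i * \<bar>z $ 2 - p $ 2\<bar> ^ j) \<le>
          (?K * R ^ i * R ^ j) * ((1 / (2 * R)) ^ i * (1 / (2 * R)) ^ j)"
        using zc[of 1] zc[of 2] C0 R by (intro mult_mono power_mono) (auto simp: e_def)
      also have "\<dots> = ?K * (1/2) ^ i * (1/2) ^ j"
        using R by (simp add: power_divide power_mult_distrib)
      finally show ?thesis by (simp add: abs_mult power_abs mult_ac)
    qed
    then have "norm (foldr pd as f z) \<le> 4 * ?K"
      using zc[of 1] zc[of 2]
      by (intro norm_infsum_le[OF d has_sum_geometric_half]) (auto simp: e_def)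
    then show ?thesis by (simp add: mult_ac)
  qed
  moreover have "smooth_on (ball p e) f"
    by (rule smooth_on_subset[OF U _ sm]) (use r0 in \<open>auto simp: e_def\<close>)
  ultimately have "analytic_bounded_on (ball p e) f"
    unfolding analytic_bounded_on_def using C0 R
    by (intro conjI exI[of _ "4 * C"] exI[of _ R]) auto
  moreover have "ball p e \<subseteq> U" using r0 by (auto simp: e_def)
  ultimately show ?thesis using e by blast
qed

lemma analytic_bounded_on_subset:
  assumes "open S" "T \<subseteq> S" "analytic_bounded_on S f"
  shows "analytic_bounded_on T f"
proof -
  obtain C M where "C \<ge> 0" "M \<ge> 0" "\<And>z as. z \<in> S \<Longrightarrow> \<bar>foldr pd as f z\<bar> \<le> C * fact (length as) * M ^ length as"
    using assms(3) unfolding analytic_bounded_on_def by blast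
  then show ?thesis using assms(2) smooth_on_subset[OF assms(1,2) analytic_bounded_on_smooth[OF assms(3)]]
    unfolding analytic_bounded_on_def by (intro conjI exI[of _ C] exI[of _ M]) auto
qed

subsection \<open>Identity principle on an interval\<close>

text \<open>The common zero set of all \<open>F n\<close> is open by Taylor's formula, whose
  remainder decays like (L e)^n, and its complement is open by continuity. The derivatives are
  passed as a sequence because they will be given explicitly, as pairings with iterated covariant
  derivatives.\<close>

lemma derivative_sequence_vanishes:
  fixes F :: "nat \<Rightarrow> real \<Rightarrow> real"
  assumes T: "open T" "connected T" and t0: "t0 \<in> T"
    and deriv: "\<And>n t. t \<in> T \<Longrightarrow> (F n has_real_derivative F (Suc n) t) (at t)"
    and bound: "\<And>n t. t \<in> T \<Longrightarrow> \<bar>F n t\<bar> \<le> C * fact n * L ^ n" and L: "L \<ge> 0"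
    and zero: "\<And>n. F n t0 = 0" and t: "t \<in> T"
  shows "F n t = 0"
proof -
  have loc: "\<exists>e>0. \<forall>s\<in>ball c e. s \<in> T \<and> F 0 s = 0" if c: "c \<in> T" and Fc: "\<And>n. F n c = 0" for c
  proof -
    obtain e0 where e0: "e0 > 0" "cball c e0 \<subseteq> T" using T c open_contains_cball by blast
    \<comment> \<open>Makes \<open>L * e\<close> at most 1/2; the added 1 covers
      \<open>L = 0\<close>.\<close>
    define e where "e = min e0 (1 / (2 * L + 1))"
    have e: "e > 0" "L * e \<le> 1/2" using e0 L by (auto simp: e_def min_def field_simps)
    have "F 0 s = 0" if s: "s \<in> ball c e" for s
    proof (cases "s = c")
      case False
      have "\<bar>F 0 s\<bar> \<le> C * (1/2) ^ n" if n: "n > 0" for n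
      proof -
        have "\<exists>t. (if s < c then s < t \<and> t < c else c < t \<and> t < s) \<and>
          F 0 s = (\<Sum>m<n. F m c / fact m * (s - c) ^ m) + F n t / fact n * (s - c) ^ n"
          by (rule Taylor[OF n refl, where a = "c - e0" and b = "c + e0"])
            (use e0 s e False in \<open>auto intro!: deriv simp: e_def dist_real_def\<close>)
        then obtain t where t: "if s < c then s < t \<and> t < c else c < t \<and> t < s"
          and eq: "F 0 s = F n t / fact n * (s - c) ^ n" using Fc by auto
        have "t \<in> T" using t s e0 by (auto simp: e_def dist_real_def split: if_splits)
        have "C \<ge> 0" using bound[OF t0, of 0] by simp
        then have CL: "C * L ^ n \<ge> 0" using L by simp
        have "\<bar>F 0 s\<bar> = \<bar>F n t\<bar> / fact n * \<bar>s - c\<bar> ^ n" unfolding eq by (simp add: abs_mult power_abs)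
        also have "\<dots> \<le> (C * L ^ n) * \<bar>s - c\<bar> ^ n"
          using bound[OF \<open>t \<in> T\<close>, of n] by (intro mult_right_mono) (auto simp: field_simps)
        also have "\<dots> \<le> (C * L ^ n) * e ^ n"
          using s CL by (intro mult_left_mono power_mono) (auto simp: dist_real_def)
        also have "\<dots> = C * (L * e) ^ n" by (simp add: power_mult_distrib)
        also have "\<dots> \<le> C * (1/2) ^ n"
          using e L bound[OF c, of 0] by (intro mult_left_mono power_mono) auto
        finally show ?thesis .
      qed
      moreover have "(\<lambda>n. C * (1/2) ^ n) \<longlonglongrightarrow> C * 0" by (intro tendsto_mult tendsto_const LIMSEQ_power_zero) auto
      ultimately have "\<bar>F 0 s\<bar> \<le> C * 0"
        by (intro tendsto_lowerbound[where f = "\<lambda>n. C * (1/2) ^ n" and F = sequentially])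
          (auto simp: eventually_sequentially intro!: exI[of _ 1])
      then show ?thesis by simp
    qed (use Fc in simp)
    moreover have "s \<in> T" if "s \<in> ball c e" for s
      using e0 that by (auto simp: e_def dist_real_def)
    ultimately show ?thesis using e by blast
  qed
  \<comment> \<open>Taylor's formula only controls \<open>F 0\<close>; differentiating the zero
    function on the ball recovers the vanishing of all \<open>F n\<close>, which is needed for
    openness.\<close>
  have all: "\<forall>n. \<forall>s\<in>ball c e. F n s = 0" if "\<forall>s\<in>ball c e. s \<in> T \<and> F 0 s = 0" for c e
  proof
    fix n show "\<forall>s\<in>ball c e. F n s = 0"
    proof (induction n)
      case (Suc n)
      show ?case
      proof
        fix s assume s: "s \<in> ball c e"
        then have "(F n has_real_derivative F (Suc n) s) (at s)" using that deriv by blast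
        moreover have "(F n has_real_derivative 0) (at s)"
          using s Suc by (intro has_field_derivative_transform_within_open[OF DERIV_const[of 0] open_ball s]) auto
        ultimately show "F (Suc n) s = 0" by (rule DERIV_unique)
      qed
    qed (use that in blast)
  qed
  define A where "A = {t\<in>T. \<forall>n. F n t = 0}"
  define B where "B = {t\<in>T. \<exists>n. F n t \<noteq> 0}"
  have "open A"
  proof (rule openI)
    fix c assume "c \<in> A"
    then obtain e where "e > 0" "\<forall>s\<in>ball c e. s \<in> T \<and> F 0 s = 0" using loc unfolding A_def by blast
    then show "\<exists>e>0. ball c e \<subseteq> A" using all unfolding A_def by blast
  qed
  moreover have "open B"
  proof -
    have "continuous_on T (F n)" for n
      using deriv by (meson DERIV_isCont continuous_at_imp_continuous_on)
    then have "open {t\<in>T. F n t \<in> - {0}}" for n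
      using continuous_open_preimage[of T "F n" "- {0}", OF _ T(1) open_Compl[OF closed_singleton]] by (simp add: vimage_def Int_def conj_commute)
    moreover have "B = (\<Union>n. {t\<in>T. F n t \<in> - {0}})" unfolding B_def by auto
    ultimately show ?thesis by auto
  qed
  moreover have "T \<subseteq> A \<union> B" "A \<inter> B \<inter> T = {}" "t0 \<in> A" using t0 zero unfolding A_def B_def by auto
  ultimately have "B \<inter> T = {}" using connectedD[OF T(2), of A B] t0 by blast
  then show ?thesis using t unfolding B_def by blast
qed

subsection \<open>The connection and its curvature\<close>

lemma Omega1_nth:
  "Omega1 \<Gamma> z $ 1 = vector [-2/3 * A1 \<Gamma> z, 2 * A0 \<Gamma> z, 0, 0, 0, 0]"
  "Omega1 \<Gamma> z $ 2 = vector [0, 0, 0, -1/2, 0, 0]"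
  "Omega1 \<Gamma> z $ 3 = vector [-2 * A3 \<Gamma> z, -2/3 * A2 \<Gamma> z, 4/3 * A1 \<Gamma> z, 0, 1, 0]"
  "Omega1 \<Gamma> z $ 4 = vector [a41 \<Gamma> z, a42 \<Gamma> z, a43 \<Gamma> z, -1/3 * A1 \<Gamma> z, -3 * A0 \<Gamma> z, 0]"
  "Omega1 \<Gamma> z $ 5 = vector [0, 0, 0, 0, 0, -1]"
  "Omega1 \<Gamma> z $ 6 = vector [a61 \<Gamma> z, a62 \<Gamma> z, a63 \<Gamma> z, a64 \<Gamma> z, a65 \<Gamma> z, -1/3 * A1 \<Gamma> z]"
  unfolding Omega1_def by (simp_all only: vector_6)

lemma Omega2_nth:
  "Omega2 \<Gamma> z $ 1 = vector [-4/3 * A2 \<Gamma> z, 2/3 * A1 \<Gamma> z, 2 * A0 \<Gamma> z, 1, 0, 0]"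
  "Omega2 \<Gamma> z $ 2 = vector [0, 0, 0, 0, -1/2, 0]"
  "Omega2 \<Gamma> z $ 3 = vector [0, -2 * A3 \<Gamma> z, 2/3 * A2 \<Gamma> z, 0, 0, 0]"
  "Omega2 \<Gamma> z $ 4 = vector [0, 0, 0, 0, 0, -1]"
  "Omega2 \<Gamma> z $ 5 = vector [b51 \<Gamma> z, b52 \<Gamma> z, b53 \<Gamma> z, 3 * A3 \<Gamma> z, 1/3 * A2 \<Gamma> z, 0]"
  "Omega2 \<Gamma> z $ 6 = vector [b61 \<Gamma> z, b62 \<Gamma> z, b63 \<Gamma> z, b64 \<Gamma> z, b65 \<Gamma> z, 1/3 * A2 \<Gamma> z]"
  unfolding Omega2_def by (simp_all only: vector_6)

lemmas Omega_nth = Omega1_nth Omega2_nth vector_6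

lemma Vrow_nth:
  "Vrow \<Gamma> z $ 1 = 2 * dy (L2 \<Gamma>) z + 4 * A2 \<Gamma> z * L2 \<Gamma> z + 8 * A3 \<Gamma> z * L1 \<Gamma> z"
  "Vrow \<Gamma> z $ 2 = -2 * dy (L1 \<Gamma>) z - 2 * dx (L2 \<Gamma>) z - 4/3 * A1 \<Gamma> z * L2 \<Gamma> z + 4/3 * A2 \<Gamma> z * L1 \<Gamma> z"
  "Vrow \<Gamma> z $ 3 = 2 * dx (L1 \<Gamma>) z - 8 * A0 \<Gamma> z * L2 \<Gamma> z - 4 * A1 \<Gamma> z * L1 \<Gamma> z"
  "Vrow \<Gamma> z $ 4 = -5 * L2 \<Gamma> z"
  "Vrow \<Gamma> z $ 5 = -5 * L1 \<Gamma> z"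
  "Vrow \<Gamma> z $ 6 = 0"
  unfolding Vrow_def by (simp_all only: vector_6)

lemma Omega_12: "Omega 1 = Omega1" "Omega 2 = Omega2"
  by (simp_all add: Omega_def)

lemma pd_cdivide:
  "f differentiable (at z) \<Longrightarrow> pd a (\<lambda>u. f u / c) z = pd a f z / c"
  using pd_cmult[of f z a "inverse c"] by (simp add: divide_inverse mult.commute)

text \<open>All estimates below need constants uniform on the domain, so the coefficients are
  considered on a small neighbourhood \<open>S\<close> instead of all of \<open>U\<close>.\<close>

locale analytic_chart =
  fixes \<Gamma> :: connection and S :: "(real^2) set"
  assumes open_S: "open S"
    and analytic_A0: "analytic_bounded_on S (A0 \<Gamma>)" and analytic_A1: "analytic_bounded_on S (A1 \<Gamma>)"
    and analytic_A2: "analytic_bounded_on S (A2 \<Gamma>)" and analytic_A3: "analytic_bounded_on S (A3 \<Gamma>)"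
begin

lemmas analytic_A = analytic_A0 analytic_A1 analytic_A2 analytic_A3
lemmas smooth_A = analytic_A[THEN analytic_bounded_on_smooth]
lemmas an_intros = analytic_bounded_on_const analytic_bounded_on_add[OF open_S]
  analytic_bounded_on_diff[OF open_S] analytic_bounded_on_minus[OF open_S] analytic_bounded_on_mult[OF open_S]
  analytic_bounded_on_power[OF open_S] analytic_bounded_on_pd
lemmas sm_intros = smooth_on_const smooth_on_add[OF open_S]
  smooth_on_diff[OF open_S] smooth_on_minus[OF open_S] smooth_on_mult[OF open_S]
  smooth_on_power[OF open_S] smooth_on_pd smooth_on_sum[OF open_S]

lemma analytic_L: "analytic_bounded_on S (L1 \<Gamma>)" "analytic_bounded_on S (L2 \<Gamma>)"
  unfolding L1_def[abs_def] L2_def[abs_def] by (intro an_intros analytic_A)+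

lemma analytic_coefficients:
  "analytic_bounded_on S (a41 \<Gamma>)" "analytic_bounded_on S (a42 \<Gamma>)" "analytic_bounded_on S (a43 \<Gamma>)"
  "analytic_bounded_on S (a61 \<Gamma>)" "analytic_bounded_on S (a62 \<Gamma>)" "analytic_bounded_on S (a63 \<Gamma>)"
  "analytic_bounded_on S (a64 \<Gamma>)" "analytic_bounded_on S (a65 \<Gamma>)"
  "analytic_bounded_on S (b51 \<Gamma>)" "analytic_bounded_on S (b52 \<Gamma>)" "analytic_bounded_on S (b53 \<Gamma>)"
  "analytic_bounded_on S (b61 \<Gamma>)" "analytic_bounded_on S (b62 \<Gamma>)" "analytic_bounded_on S (b63 \<Gamma>)"
  "analytic_bounded_on S (b64 \<Gamma>)" "analytic_bounded_on S (b65 \<Gamma>)"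
  unfolding a41_def[abs_def] a42_def[abs_def] a43_def[abs_def] a61_def[abs_def] a62_def[abs_def]
    a63_def[abs_def] a64_def[abs_def] a65_def[abs_def] b51_def[abs_def] b52_def[abs_def] b53_def[abs_def]
    b61_def[abs_def] b62_def[abs_def] b63_def[abs_def] b64_def[abs_def] b65_def[abs_def]
  by (intro an_intros analytic_A)+

lemma analytic_Vrow: "analytic_bounded_on S (\<lambda>u. Vrow \<Gamma> u $ j)"
proof -
  have "\<forall>j. analytic_bounded_on S (\<lambda>u. Vrow \<Gamma> u $ j)"
    unfolding forall_6 Vrow_nth by (intro conjI an_intros analytic_A analytic_L)
  then show ?thesis by blast
qed

lemma analytic_Omega: "analytic_bounded_on S (\<lambda>u. Omega a \<Gamma> u $ i $ j)"
proof -
  have "\<forall>i j. analytic_bounded_on S (\<lambda>u. Omega1 \<Gamma> u $ i $ j)"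
    unfolding forall_6 Omega_nth by (intro conjI an_intros analytic_A analytic_coefficients)
  moreover have "\<forall>i j. analytic_bounded_on S (\<lambda>u. Omega2 \<Gamma> u $ i $ j)"
    unfolding forall_6 Omega_nth by (intro conjI an_intros analytic_A analytic_coefficients)
  ultimately show ?thesis by (simp add: Omega_def)
qed

lemmas smooth_Omega = analytic_Omega[THEN analytic_bounded_on_smooth]
lemmas smooth_Vrow = analytic_Vrow[THEN analytic_bounded_on_smooth]
lemmas smooth_L = analytic_L[THEN analytic_bounded_on_smooth]

lemma smooth_divide_const: "smooth_on S f \<Longrightarrow> smooth_on S (\<lambda>u. f u / c)"
  unfolding divide_inverse by (intro sm_intros)

text \<open>Meant as rewrite rules for polynomial differential expressions. The last two bring mixed
  derivatives up to order three into the form with every \<open>pd 1\<close> outside every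
  \<open>pd 2\<close>, so that equal terms become syntactically equal.\<close>

lemma pd_S:
  assumes "z \<in> S"
  shows "smooth_on S f \<Longrightarrow> smooth_on S g \<Longrightarrow> pd a (\<lambda>u. f u + g u) z = pd a f z + pd a g z"
    and "smooth_on S f \<Longrightarrow> smooth_on S g \<Longrightarrow> pd a (\<lambda>u. f u - g u) z = pd a f z - pd a g z"
    and "smooth_on S f \<Longrightarrow> smooth_on S g \<Longrightarrow> pd a (\<lambda>u. f u * g u) z = pd a f z * g z + f z * pd a g z"
    and "smooth_on S f \<Longrightarrow> pd a (\<lambda>u. - f u) z = - pd a f z"
    and "smooth_on S f \<Longrightarrow> pd a (\<lambda>u. f u / c) z = pd a f z / c"
    and "smooth_on S f \<Longrightarrow> pd 2 (pd 1 f) z = pd 1 (pd 2 f) z"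
    and "smooth_on S f \<Longrightarrow> pd b (pd 2 (pd 1 f)) z = pd b (pd 1 (pd 2 f)) z"
  by (auto intro: pd_add pd_diff pd_mult pd_minus pd_cdivide smooth_pd_commute open_S assms
      pd_cong[OF open_S assms] smooth_on_differentiable[OF open_S _ assms])

text \<open>In the prolongation, the integrability conditions of rows 1 to 5 were solved for the
  remaining derivatives and became entries of \<open>Omega\<close>, so they hold identically. Row 6
  has no unknown left to absorb its condition, and \<open>Vrow\<close> is what remains. The check is
  by expansion in \<open>A0\<close>, ..., \<open>A3\<close>.\<close>

lemma curvature:
  assumes z: "z \<in> S"
  shows "pd 1 (\<lambda>u. Omega2 \<Gamma> u $ i $ j) z - pd 2 (\<lambda>u. Omega1 \<Gamma> u $ i $ j) z
     + (\<Sum>k\<in>UNIV. Omega1 \<Gamma> z $ i $ k * Omega2 \<Gamma> z $ k $ j) - (\<Sum>k\<in>UNIV. Omega2 \<Gamma> z $ i $ k * Omega1 \<Gamma> z $ k $ j)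
     = (if i = 6 then Vrow \<Gamma> z $ j else 0)" (is "?F i j = ?G i j")
proof -
  note rules = pd_S[OF z] smooth_A smooth_on_const smooth_on_add[OF open_S]
    smooth_on_diff[OF open_S] smooth_on_minus[OF open_S] smooth_on_mult[OF open_S] smooth_on_pd smooth_L smooth_divide_const
  note defs = a41_def[abs_def] a42_def[abs_def] a43_def[abs_def] a61_def[abs_def] a62_def[abs_def]
    a63_def[abs_def] a64_def[abs_def] a65_def[abs_def] b51_def[abs_def] b52_def[abs_def] b53_def[abs_def]
    b61_def[abs_def] b62_def[abs_def] b63_def[abs_def] b64_def[abs_def] b65_def[abs_def]
    L1_def[abs_def] L2_def[abs_def] power2_eq_square
  have r: "\<forall>j. ?F 1 j = ?G 1 j" "\<forall>j. ?F 2 j = ?G 2 j" "\<forall>j. ?F 3 j = ?G 3 j" "\<forall>j. ?F 4 j = ?G 4 j"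
     "\<forall>j. ?F 5 j = ?G 5 j"
    unfolding forall_6 sum_6 Omega_nth Vrow_nth
    by (simp_all add: rules) (simp_all add: rules defs, simp_all add: field_simps)
  \<comment> \<open>Row 6 has entries with second derivatives of the \<open>A0\<close>, ...,
    \<open>A3\<close>, so third derivatives occur here, matching the derivatives of
    \<open>L1\<close> and \<open>L2\<close> in \<open>Vrow\<close>.\<close>
  have r6: "\<forall>j. ?F 6 j = ?G 6 j"
    unfolding forall_6 sum_6 Omega_nth Vrow_nth
    by (simp add: rules defs, simp add: field_simps)
  have "\<forall>i j. ?F i j = ?G i j"
    unfolding forall_6[of "\<lambda>i. \<forall>j. ?F i j = ?G i j"] by (intro conjI r r6)
  then show ?thesis by blast
qed


section \<open>The covariant derivative of row vectors\<close>

definition smooth_vec :: "(real^2 \<Rightarrow> real^6) \<Rightarrow> bool" where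
  "smooth_vec X \<longleftrightarrow> (\<forall>j. smooth_on S (\<lambda>u. X u $ j))"

lemma covD_nth:
  "covD \<Gamma> a X z $ j = pd a (\<lambda>u. X u $ j) z - (\<Sum>i\<in>UNIV. X z $ i * Omega a \<Gamma> z $ i $ j)"
  by (simp add: covD_def vector_matrix_mult_def mult.commute)

lemma smooth_covD: "smooth_vec X \<Longrightarrow> smooth_vec (covD \<Gamma> a X)"
  unfolding smooth_vec_def covD_nth by (intro allI sm_intros smooth_Omega) auto

lemma smooth_covD_iter: "smooth_vec X \<Longrightarrow> smooth_vec (covD_iter \<Gamma> as X)"
  unfolding covD_iter_def by (induction as) (simp_all add: smooth_covD)

lemma smooth_vec_Vrow: "smooth_vec (Vrow \<Gamma>)"
  unfolding smooth_vec_def using smooth_Vrow by blast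

lemma covD_iter_Cons: "covD_iter \<Gamma> (a # as) X = covD \<Gamma> a (covD_iter \<Gamma> as X)"
  by (simp add: covD_iter_def)

lemma covD_iter_append: "covD_iter \<Gamma> (as @ bs) X = covD_iter \<Gamma> as (covD_iter \<Gamma> bs X)"
  by (simp add: covD_iter_def)

lemma covD_cong:
  assumes "\<And>u. u \<in> S \<Longrightarrow> X u = Y u" "z \<in> S"
  shows "covD \<Gamma> a X z = covD \<Gamma> a Y z"
proof -
  have "pd a (\<lambda>u. X u $ j) z = pd a (\<lambda>u. Y u $ j) z" for j
    using assms by (intro pd_cong[OF open_S]) auto
  then show ?thesis using assms by (simp add: covD_def)
qed

lemma covD_diff:
  assumes "smooth_vec X" "smooth_vec Y" "z \<in> S"
  shows "covD \<Gamma> a (\<lambda>u. X u - Y u) z = covD \<Gamma> a X z - covD \<Gamma> a Y z"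
  using assms pd_S(2)[OF assms(3)]
  by (simp add: vec_eq_iff covD_nth smooth_vec_def sum_subtractf left_diff_distrib)

lemma covD_scale:
  assumes "smooth_on S f" "smooth_vec X" "z \<in> S"
  shows "covD \<Gamma> a (\<lambda>u. f u *\<^sub>R X u) z = pd a f z *\<^sub>R X z + f z *\<^sub>R covD \<Gamma> a X z"
  using assms pd_S(3)[OF assms(3)]
  by (simp add: vec_eq_iff covD_nth smooth_vec_def sum_distrib_left right_diff_distrib mult.assoc)

lemma covD_covD_nth:
  assumes X: "smooth_vec X" and z: "z \<in> S"
  shows "covD \<Gamma> a (covD \<Gamma> b X) z $ j = pd a (pd b (\<lambda>u. X u $ j)) z
    - (\<Sum>i\<in>UNIV. pd a (\<lambda>u. X u $ i) z * Omega b \<Gamma> z $ i $ j) - (\<Sum>i\<in>UNIV. X z $ i * pd a (\<lambda>u. Omega b \<Gamma> u $ i $ j) z)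
    - (\<Sum>i\<in>UNIV. pd b (\<lambda>u. X u $ i) z * Omega a \<Gamma> z $ i $ j)
    + (\<Sum>i\<in>UNIV. X z $ i * (\<Sum>k\<in>UNIV. Omega b \<Gamma> z $ i $ k * Omega a \<Gamma> z $ k $ j))"
proof -
  have sX: "smooth_on S (\<lambda>u. X u $ i)" for i using X by (simp add: smooth_vec_def)
  have "pd a (\<lambda>u. covD \<Gamma> b X u $ j) z = pd a (pd b (\<lambda>u. X u $ j)) z - pd a (\<lambda>u. \<Sum>i\<in>UNIV. X u $ i * Omega b \<Gamma> u $ i $ j) z"
    unfolding covD_nth by (intro pd_S(2)[OF z] sm_intros sX smooth_Omega)
  also have "pd a (\<lambda>u. \<Sum>i\<in>UNIV. X u $ i * Omega b \<Gamma> u $ i $ j) z = (\<Sum>i\<in>UNIV. pd a (\<lambda>u. X u $ i * Omega b \<Gamma> u $ i $ j) z)"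
    by (intro pd_sum smooth_on_differentiable[OF open_S _ z] sm_intros sX smooth_Omega)
  also have "\<dots> = (\<Sum>i\<in>UNIV. pd a (\<lambda>u. X u $ i) z * Omega b \<Gamma> z $ i $ j + X z $ i * pd a (\<lambda>u. Omega b \<Gamma> u $ i $ j) z)"
    by (intro sum.cong refl pd_S(3)[OF z] sX smooth_Omega)
  finally have 1: "pd a (\<lambda>u. covD \<Gamma> b X u $ j) z = pd a (pd b (\<lambda>u. X u $ j)) z
    - (\<Sum>i\<in>UNIV. pd a (\<lambda>u. X u $ i) z * Omega b \<Gamma> z $ i $ j) - (\<Sum>i\<in>UNIV. X z $ i * pd a (\<lambda>u. Omega b \<Gamma> u $ i $ j) z)"
    by (simp add: sum.distrib)
  have "(\<Sum>k\<in>UNIV. covD \<Gamma> b X z $ k * Omega a \<Gamma> z $ k $ j) = (\<Sum>k\<in>UNIV. pd b (\<lambda>u. X u $ k) z * Omega a \<Gamma> z $ k $ j)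
     - (\<Sum>k\<in>UNIV. \<Sum>i\<in>UNIV. X z $ i * Omega b \<Gamma> z $ i $ k * Omega a \<Gamma> z $ k $ j)"
    unfolding covD_nth by (simp add: left_diff_distrib sum_subtractf sum_distrib_right)
  also have "(\<Sum>k\<in>UNIV. \<Sum>i\<in>UNIV. X z $ i * Omega b \<Gamma> z $ i $ k * Omega a \<Gamma> z $ k $ j)
     = (\<Sum>i\<in>UNIV. X z $ i * (\<Sum>k\<in>UNIV. Omega b \<Gamma> z $ i $ k * Omega a \<Gamma> z $ k $ j))"
    by (subst sum.swap) (simp add: sum_distrib_left mult.assoc)
  finally show ?thesis by (subst covD_nth) (simp add: 1)
qed

text \<open>The commutator is minus the row vector times the curvature matrix. As only the last row
  of that matrix is nonzero, the result is a multiple of \<open>Vrow\<close>, with no derivative of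
  \<open>X\<close> in the coefficient.\<close>

lemma covD_commute:
  assumes X: "smooth_vec X" and z: "z \<in> S"
  shows "covD \<Gamma> 1 (covD \<Gamma> 2 X) z - covD \<Gamma> 2 (covD \<Gamma> 1 X) z = - (X z $ 6) *\<^sub>R Vrow \<Gamma> z"
proof -
  have sX: "smooth_on S (\<lambda>u. X u $ i)" for i using X by (simp add: smooth_vec_def)
  have "(covD \<Gamma> 1 (covD \<Gamma> 2 X) z - covD \<Gamma> 2 (covD \<Gamma> 1 X) z) $ j
    = - (\<Sum>i\<in>UNIV. X z $ i * (pd 1 (\<lambda>u. Omega2 \<Gamma> u $ i $ j) z - pd 2 (\<lambda>u. Omega1 \<Gamma> u $ i $ j) z
     + (\<Sum>k\<in>UNIV. Omega1 \<Gamma> z $ i $ k * Omega2 \<Gamma> z $ k $ j) - (\<Sum>k\<in>UNIV. Omega2 \<Gamma> z $ i $ k * Omega1 \<Gamma> z $ k $ j)))" for j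
    unfolding vector_minus_component covD_covD_nth[OF X z] Omega_12 smooth_pd_commute[OF open_S sX z, of 2 1]
    by (simp add: algebra_simps sum.distrib sum_subtractf)
  also have "\<dots> j = - (\<Sum>i\<in>UNIV. X z $ i * (if i = 6 then Vrow \<Gamma> z $ j else 0))" for j
    unfolding curvature[OF z] ..
  also have "\<dots> j = (- (X z $ 6) *\<^sub>R Vrow \<Gamma> z) $ j" for j
    by (simp add: if_distrib sum.delta cong: if_cong)
  finally show ?thesis by (simp add: vec_eq_iff)
qed

text \<open>The derivative on rows is dual to the connection on columns, hence the product rule. A
  derivative of \<open>\<Psi>\<close> is required in the one direction \<open>a\<close> only,
  because a transported vector is at first known to be parallel only along certain lines.\<close>

lemma covD_pairing:
  assumes X: "smooth_vec X" and z: "z \<in> S"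
    and \<Psi>: "((\<lambda>t. \<Psi> (z + t *\<^sub>R axis a 1)) has_vector_derivative - (Omega a \<Gamma> z *v \<Psi> z)) (at 0)"
  shows "((\<lambda>t. X (z + t *\<^sub>R axis a 1) \<bullet> \<Psi> (z + t *\<^sub>R axis a 1)) has_real_derivative covD \<Gamma> a X z \<bullet> \<Psi> z) (at 0)"
proof -
  have 1: "((\<lambda>t. X (z + t *\<^sub>R axis a 1) $ i) has_real_derivative pd a (\<lambda>u. X u $ i) z) (at 0)" for i
    using X z by (intro pd_line[of "\<lambda>u. X u $ i"] smooth_on_differentiable[OF open_S]) (auto simp: smooth_vec_def)
  have 2: "((\<lambda>t. \<Psi> (z + t *\<^sub>R axis a 1) $ i) has_real_derivative - (Omega a \<Gamma> z *v \<Psi> z) $ i) (at 0)" for i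
    using bounded_linear.has_vector_derivative[OF bounded_linear_vec_nth \<Psi>, of i]
    by (simp add: has_real_derivative_iff_has_vector_derivative)
  have "((\<lambda>t. X (z + t *\<^sub>R axis a 1) \<bullet> \<Psi> (z + t *\<^sub>R axis a 1)) has_real_derivative
    (\<Sum>i\<in>UNIV. pd a (\<lambda>u. X u $ i) z * \<Psi> z $ i + (- (Omega a \<Gamma> z *v \<Psi> z) $ i) * X z $ i)) (at 0)"
    unfolding inner_vec_def inner_real_def
    by (rule DERIV_sum) (use DERIV_mult[OF 1 2] in simp)
  moreover have "(\<Sum>i\<in>UNIV. pd a (\<lambda>u. X u $ i) z * \<Psi> z $ i + (- (Omega a \<Gamma> z *v \<Psi> z) $ i) * X z $ i)
    = (\<chi> i. pd a (\<lambda>u. X u $ i) z) \<bullet> \<Psi> z - X z \<bullet> (Omega a \<Gamma> z *v \<Psi> z)"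
    by (simp add: inner_vec_def sum_subtractf mult.commute)
  moreover have "\<dots> = covD \<Gamma> a X z \<bullet> \<Psi> z"
    by (simp add: covD_def inner_diff_left dot_lmul_matrix)
  ultimately show ?thesis by simp
qed

end

subsection \<open>Bounds on iterated covariant derivatives\<close>

lemma analytic_bounded_on_uniform:
  assumes "finite I" "\<And>i. i \<in> I \<Longrightarrow> analytic_bounded_on S (f i)"
  shows "\<exists>C\<ge>0. \<exists>M\<ge>0. \<forall>M'\<ge>M. \<forall>i\<in>I. \<forall>z\<in>S. \<forall>as. \<bar>foldr pd as (f i) z\<bar> \<le> C * fact (length as) * M' ^ length as"
  using assms
proof (induction I)
  case empty
  then show ?case by (intro exI[of _ 0]) auto
next
  case (insert i I)
  then obtain C M where C: "C \<ge> 0" "M \<ge> 0" "\<And>M' i z as. M' \<ge> M \<Longrightarrow> i \<in> I \<Longrightarrow> z \<in> S \<Longrightarrow>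
      \<bar>foldr pd as (f i) z\<bar> \<le> C * fact (length as) * M' ^ length as" by (metis insertCI)
  obtain D N where D: "D \<ge> 0" "N \<ge> 0" "\<And>M' z as. N \<le> M' \<Longrightarrow> z \<in> S \<Longrightarrow>
      \<bar>foldr pd as (f i) z\<bar> \<le> D * fact (length as) * M' ^ length as"
    using analytic_bounded_onE[OF insert.prems[OF insertI1]] by blast
  have "\<bar>foldr pd as (f j) z\<bar> \<le> (C + D) * fact (length as) * M' ^ length as"
    if "M' \<ge> max M N" "j \<in> insert i I" "z \<in> S" for M' j z as
  proof -
    have "fact (length as) * M' ^ length as \<ge> 0" using that C by simp
    then have "C * fact (length as) * M' ^ length as \<le> (C + D) * fact (length as) * M' ^ length as"
      "D * fact (length as) * M' ^ length as \<le> (C + D) * fact (length as) * M' ^ length as"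
      using C D by (simp_all add: mult.assoc distrib_right)
    moreover have "\<bar>foldr pd as (f j) z\<bar> \<le> C * fact (length as) * M' ^ length as \<or>
      \<bar>foldr pd as (f j) z\<bar> \<le> D * fact (length as) * M' ^ length as"
      using that C(3)[of M' j z as] D(3)[of M' z as] by auto
    ultimately show ?thesis by linarith
  qed
  then show ?case using C D by (intro exI[of _ "C + D"] conjI exI[of _ "max M N"]) auto
qed

context analytic_chart
begin

text \<open>The partial derivative raises the exponent from \<open>\<alpha>\<close> to
  \<open>\<alpha> + 1\<close> with factor \<open>\<alpha> * M\<close>; multiplication by an entry of
  \<open>Omega\<close>, of exponent 1, raises it likewise with factor \<open>K\<close>. The 6 counts
  the terms of the matrix product.\<close>

lemma covD_bound:
  assumes X: "smooth_vec X" and D: "D \<ge> 0" and z: "z \<in> S"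
    and bX: "\<And>j bs u. u \<in> S \<Longrightarrow> \<bar>foldr pd bs (\<lambda>u. X u $ j) u\<bar> \<le> D * pochhammer \<alpha> (length bs) * M ^ length bs"
    and bO: "\<And>i j bs u. u \<in> S \<Longrightarrow> \<bar>foldr pd bs (\<lambda>u. Omega a \<Gamma> u $ i $ j) u\<bar> \<le> K * fact (length bs) * M ^ length bs"
  shows "\<bar>foldr pd bs (\<lambda>u. covD \<Gamma> a X u $ j) z\<bar> \<le> D * (\<alpha> * M + 6 * K) * pochhammer (\<alpha> + 1) (length bs) * M ^ length bs"
proof -
  have sX: "smooth_on S (\<lambda>u. X u $ i)" for i using X by (simp add: smooth_vec_def)
  let ?P = "pochhammer (\<alpha> + 1) (length bs) * M ^ length bs"
  have "foldr pd bs (\<lambda>u. covD \<Gamma> a X u $ j) z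
    = foldr pd bs (\<lambda>u. pd a (\<lambda>u. X u $ j) u + - (\<Sum>i\<in>UNIV. X u $ i * Omega a \<Gamma> u $ i $ j)) z"
    unfolding covD_nth by simp
  also have "\<dots> = foldr pd bs (pd a (\<lambda>u. X u $ j)) z + foldr pd bs (\<lambda>u. - (\<Sum>i\<in>UNIV. X u $ i * Omega a \<Gamma> u $ i $ j)) z"
    by (intro foldr_pd_add[OF open_S _ _ z] sm_intros sX smooth_Omega)
  also have "foldr pd bs (\<lambda>u. - (\<Sum>i\<in>UNIV. X u $ i * Omega a \<Gamma> u $ i $ j)) z = - foldr pd bs (\<lambda>u. \<Sum>i\<in>UNIV. X u $ i * Omega a \<Gamma> u $ i $ j) z"
    by (intro foldr_pd_minus[OF open_S _ z] sm_intros sX smooth_Omega)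
  also have "foldr pd bs (\<lambda>u. \<Sum>i\<in>UNIV. X u $ i * Omega a \<Gamma> u $ i $ j) z = (\<Sum>i\<in>UNIV. foldr pd bs (\<lambda>u. X u $ i * Omega a \<Gamma> u $ i $ j) z)"
    by (intro foldr_pd_sum[OF open_S _ _ z] sm_intros sX smooth_Omega) auto
  finally have "\<bar>foldr pd bs (\<lambda>u. covD \<Gamma> a X u $ j) z\<bar> \<le>
    \<bar>foldr pd bs (pd a (\<lambda>u. X u $ j)) z\<bar> + \<bar>\<Sum>i\<in>UNIV. foldr pd bs (\<lambda>u. X u $ i * Omega a \<Gamma> u $ i $ j) z\<bar>"
    by linarith
  also have "\<bar>foldr pd bs (pd a (\<lambda>u. X u $ j)) z\<bar> \<le> D * \<alpha> * M * ?P"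
    using bX[OF z, of "bs @ [a]" j] by (simp add: pochhammer_rec mult_ac)
  also have "\<bar>\<Sum>i\<in>UNIV. foldr pd bs (\<lambda>u. X u $ i * Omega a \<Gamma> u $ i $ j) z\<bar> \<le> (\<Sum>i\<in>(UNIV::6 set). D * K * ?P)"
  proof (rule order_trans[OF sum_abs], rule sum_mono)
    fix i
    have "\<bar>foldr pd bs (\<lambda>u. X u $ i * Omega a \<Gamma> u $ i $ j) z\<bar> \<le> D * K * pochhammer (\<alpha> + 1) (length bs) * M ^ length bs"
      by (rule foldr_pd_mult_bound[OF open_S z sX smooth_Omega bX])
        (use bO in \<open>auto simp: pochhammer_fact[symmetric]\<close>)
    then show "\<bar>foldr pd bs (\<lambda>u. X u $ i * Omega a \<Gamma> u $ i $ j) z\<bar> \<le> D * K * ?P" by (simp add: mult.assoc)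
  qed
  finally show ?thesis by (simp add: algebra_simps)
qed

text \<open>Bounds on values alone do not pass to the next covariant derivative. The induction
  therefore controls all partial derivatives of the k-th covariant derivative, with exponent 1 + k,
  and only at the end specialises to no partial derivative.\<close>

lemma covD_iter_bound:
  assumes X: "\<And>j. analytic_bounded_on S (\<lambda>u. X u $ j)"
  shows "\<exists>C\<ge>0. \<exists>L\<ge>0. \<forall>z\<in>S. \<forall>as j. \<bar>covD_iter \<Gamma> as X z $ j\<bar> \<le> C * fact (length as) * L ^ length as"
proof -
  obtain C M where C: "C \<ge> 0" "M \<ge> 0" "\<And>M' j z as. M' \<ge> M \<Longrightarrow> z \<in> S \<Longrightarrow>
      \<bar>foldr pd as (\<lambda>u. X u $ j) z\<bar> \<le> C * fact (length as) * M' ^ length as"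
    using analytic_bounded_on_uniform[of "UNIV :: 6 set" S "\<lambda>j u. X u $ j"] X by auto
  obtain K N where K: "K \<ge> 0" "N \<ge> 0" "\<And>M' a i j z as. M' \<ge> N \<Longrightarrow> z \<in> S \<Longrightarrow>
      \<bar>foldr pd as (\<lambda>u. Omega a \<Gamma> u $ i $ j) z\<bar> \<le> K * fact (length as) * M' ^ length as"
    using analytic_bounded_on_uniform[of "UNIV :: (2 \<times> 6 \<times> 6) set" S "\<lambda>(a, i, j) u. Omega a \<Gamma> u $ i $ j"] analytic_Omega
    by auto
  define Q where "Q = max M N"
  have Q: "Q \<ge> 0" using C by (auto simp: Q_def)
  \<comment> \<open>The step from order k to k + 1 costs the factor (1 + k) Q + 6 K, which is at
    most (1 + k) L; the factors 1 + k multiply up to the factorial.\<close>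
  define L where "L = Q + 6 * K"
  have L: "L \<ge> 0" using Q K by (simp add: L_def)
  have sX: "smooth_vec X" using X by (auto simp: smooth_vec_def intro: analytic_bounded_on_smooth)
  have main: "\<bar>foldr pd bs (\<lambda>u. covD_iter \<Gamma> as X u $ j) z\<bar> \<le>
     (C * fact (length as) * L ^ length as) * pochhammer (1 + real (length as)) (length bs) * Q ^ length bs"
    if "z \<in> S" for z as bs j
    using that
  proof (induction as arbitrary: bs j z)
    case Nil
    then show ?case using C(3)[of Q z bs j] by (simp add: Q_def covD_iter_def pochhammer_fact[symmetric])
  next
    case (Cons a as)
    let ?k = "length as"
    have "\<bar>foldr pd bs (\<lambda>u. covD \<Gamma> a (covD_iter \<Gamma> as X) u $ j) z\<bar> \<le>
      (C * fact ?k * L ^ ?k) * ((1 + real ?k) * Q + 6 * K) * pochhammer ((1 + real ?k) + 1) (length bs) * Q ^ length bs"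
      by (rule covD_bound[OF smooth_covD_iter[OF sX] _ Cons.prems Cons.IH K(3)])
        (use C L in \<open>auto simp: Q_def\<close>)
    also have "\<dots> \<le> (C * fact ?k * L ^ ?k) * ((1 + real ?k) * L) * pochhammer ((1 + real ?k) + 1) (length bs) * Q ^ length bs"
    proof (intro mult_right_mono mult_left_mono)
      have "1 * (6 * K) \<le> (1 + real ?k) * (6 * K)" using K by (intro mult_right_mono) auto
      then show "(1 + real ?k) * Q + 6 * K \<le> (1 + real ?k) * L" by (simp add: L_def algebra_simps)
    qed (use C L Q in \<open>auto intro!: pochhammer_nonneg\<close>)
    finally show ?case by (simp add: covD_iter_Cons algebra_simps)
  qed
  have "\<bar>covD_iter \<Gamma> as X z $ j\<bar> \<le> C * fact (length as) * L ^ length as" if "z \<in> S" for z as j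
    using main[OF that, of "[]" as j] by simp
  then show ?thesis using C L by blast
qed

text \<open>The n-th derivative of the pairing along the line is the pairing with the n-th covariant
  derivative in direction \<open>a\<close>. The factorial bounds thus come from \<open>X\<close>
  alone, and of \<open>\<Psi>\<close> only boundedness and the transport equation are
  required.\<close>

lemma pairing_vanishes_on_line:
  assumes X: "\<And>j. analytic_bounded_on S (\<lambda>u. X u $ j)"
    and T: "open T" "connected T" "t0 \<in> T" and TS: "\<And>t. t \<in> T \<Longrightarrow> z0 + t *\<^sub>R axis a 1 \<in> S"
    and \<Psi>: "\<And>t. t \<in> T \<Longrightarrow> ((\<lambda>s. \<Psi> (z0 + s *\<^sub>R axis a 1)) has_vector_derivative
       - (Omega a \<Gamma> (z0 + t *\<^sub>R axis a 1) *v \<Psi> (z0 + t *\<^sub>R axis a 1))) (at t)"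
    and B: "\<And>t. t \<in> T \<Longrightarrow> norm (\<Psi> (z0 + t *\<^sub>R axis a 1)) \<le> B"
    and zero: "\<And>n. covD_iter \<Gamma> (replicate n a) X (z0 + t0 *\<^sub>R axis a 1) \<bullet> \<Psi> (z0 + t0 *\<^sub>R axis a 1) = 0"
    and t: "t \<in> T"
  shows "X (z0 + t *\<^sub>R axis a 1) \<bullet> \<Psi> (z0 + t *\<^sub>R axis a 1) = 0"
proof -
  define F where "F n t = covD_iter \<Gamma> (replicate n a) X (z0 + t *\<^sub>R axis a 1) \<bullet> \<Psi> (z0 + t *\<^sub>R axis a 1)" for n t
  have sX: "smooth_vec X" using X by (auto simp: smooth_vec_def intro: analytic_bounded_on_smooth)
  obtain C L where CL: "C \<ge> 0" "L \<ge> 0" "\<And>z as j. z \<in> S \<Longrightarrow> \<bar>covD_iter \<Gamma> as X z $ j\<bar> \<le> C * fact (length as) * L ^ length as"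
    using covD_iter_bound[OF X] by blast
  have "F 0 t = 0"
  proof (rule derivative_sequence_vanishes[where F = F, OF T, where C = "6 * C * B" and L = L])
    fix n s assume s: "s \<in> T"
    let ?z = "z0 + s *\<^sub>R axis a 1"
    have "((\<lambda>r. (\<lambda>s. \<Psi> (z0 + s *\<^sub>R axis a 1)) (s + r)) has_vector_derivative - (Omega a \<Gamma> ?z *v \<Psi> ?z)) (at 0)"
      using vector_diff_chain_at[of "\<lambda>r. s + r" 1 0 "\<lambda>s. \<Psi> (z0 + s *\<^sub>R axis a 1)"] \<Psi>[OF s]
      by (simp add: o_def has_vector_derivative_add_const[of "\<lambda>r. r"] add.commute[of s] has_vector_derivative_id)
    then have "((\<lambda>r. \<Psi> (?z + r *\<^sub>R axis a 1)) has_vector_derivative - (Omega a \<Gamma> ?z *v \<Psi> ?z)) (at 0)"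
      by (simp add: scaleR_add_left add.assoc)
    from covD_pairing[OF smooth_covD_iter[OF sX] TS[OF s] this, of "replicate n a"]
    have "((\<lambda>r. F n (s + r)) has_real_derivative F (Suc n) s) (at 0)"
      by (simp add: F_def covD_iter_Cons scaleR_add_left add.assoc)
    then show "(F n has_real_derivative F (Suc n) s) (at s)"
      using DERIV_shift[of "F n" "F (Suc n) s" 0 s] by (simp add: add.commute)
    have "norm (covD_iter \<Gamma> (replicate n a) X ?z) \<le> (\<Sum>j\<in>UNIV. \<bar>covD_iter \<Gamma> (replicate n a) X ?z $ j\<bar>)"
      by (rule norm_le_l1_cart)
    also have "\<dots> \<le> (\<Sum>j\<in>(UNIV :: 6 set). C * fact n * L ^ n)"
      using CL(3)[OF TS[OF s], of "replicate n a"] by (intro sum_mono) simp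
    finally have "norm (covD_iter \<Gamma> (replicate n a) X ?z) \<le> 6 * (C * fact n * L ^ n)" by simp
    then have "norm (covD_iter \<Gamma> (replicate n a) X ?z) * norm (\<Psi> ?z) \<le> 6 * (C * fact n * L ^ n) * B"
      using B[OF s] CL by (intro mult_mono) auto
    then show "\<bar>F n s\<bar> \<le> 6 * C * B * fact n * L ^ n"
      using Cauchy_Schwarz_ineq2[of "covD_iter \<Gamma> (replicate n a) X ?z" "\<Psi> ?z"] by (simp add: F_def mult_ac)
  qed (use zero CL t in \<open>auto simp: F_def\<close>)
  then show ?thesis by (simp add: F_def covD_iter_def)
qed

lemma analytic_covD:
  assumes "\<And>j. analytic_bounded_on S (\<lambda>u. X u $ j)"
  shows "analytic_bounded_on S (\<lambda>u. covD \<Gamma> a X u $ j)"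
  unfolding covD_nth sum_6 by (intro an_intros assms analytic_Omega)

lemma analytic_covD_iter:
  assumes "\<And>j. analytic_bounded_on S (\<lambda>u. X u $ j)"
  shows "analytic_bounded_on S (\<lambda>u. covD_iter \<Gamma> as X u $ j)"
  using assms by (induction as arbitrary: j) (simp_all add: covD_iter_def analytic_covD)

subsection \<open>Symmetrised derivatives\<close>

lemma covD_iter_cong:
  assumes "\<And>u. u \<in> S \<Longrightarrow> X u = Y u" "z \<in> S"
  shows "covD_iter \<Gamma> as X z = covD_iter \<Gamma> as Y z"
  using assms(2)
proof (induction as arbitrary: z)
  case (Cons a as)
  then show ?case unfolding covD_iter_Cons by (intro covD_cong) auto
qed (simp add: covD_iter_def assms(1))

lemma smooth_vec_scale: "smooth_on S f \<Longrightarrow> smooth_vec X \<Longrightarrow> smooth_vec (\<lambda>u. f u *\<^sub>R X u)"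
  by (simp add: smooth_vec_def smooth_on_mult[OF open_S])

lemma covD_iter_diff:
  assumes "smooth_vec X" "smooth_vec Y" "z \<in> S"
  shows "covD_iter \<Gamma> as (\<lambda>u. X u - Y u) z = covD_iter \<Gamma> as X z - covD_iter \<Gamma> as Y z"
  using assms(3)
proof (induction as arbitrary: z)
  case (Cons a as)
  have "covD \<Gamma> a (covD_iter \<Gamma> as (\<lambda>u. X u - Y u)) z = covD \<Gamma> a (\<lambda>u. covD_iter \<Gamma> as X u - covD_iter \<Gamma> as Y u) z"
    using Cons by (intro covD_cong) auto
  also have "\<dots> = covD \<Gamma> a (covD_iter \<Gamma> as X) z - covD \<Gamma> a (covD_iter \<Gamma> as Y) z"
    by (intro covD_diff smooth_covD_iter assms Cons.prems)
  finally show ?case by (simp add: covD_iter_Cons)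
qed (simp add: covD_iter_def)

text \<open>By the product rule the derivatives of \<open>f\<close> times \<open>X\<close> are
  combinations of derivatives of \<open>X\<close> of no higher order. Peeling off the innermost
  derivative keeps the shape of the claim, with \<open>X\<close> or \<open>f\<close>
  differentiated.\<close>

lemma covD_iter_scale_annihilated:
  assumes "smooth_on S f" "smooth_vec X" and z: "z \<in> S"
    and "\<And>cs. length cs \<le> length as \<Longrightarrow> covD_iter \<Gamma> cs X z \<bullet> w = 0"
  shows "covD_iter \<Gamma> as (\<lambda>u. f u *\<^sub>R X u) z \<bullet> w = 0"
  using assms(1,2,4)
proof (induction as arbitrary: f X rule: rev_induct)
  case Nil
  then show ?case using Nil(3)[of "[]"] by (simp add: covD_iter_def)
next
  case (snoc a as)
  \<comment> \<open>The sign writes the product rule as a difference, to which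
    \<open>covD_iter_diff\<close> applies.\<close>
  have sf: "smooth_on S (\<lambda>u. - pd a f u)" by (intro sm_intros snoc.prems)
  have "covD_iter \<Gamma> (as @ [a]) (\<lambda>u. f u *\<^sub>R X u) z = covD_iter \<Gamma> as (covD \<Gamma> a (\<lambda>u. f u *\<^sub>R X u)) z"
    by (simp add: covD_iter_def)
  also have "\<dots> = covD_iter \<Gamma> as (\<lambda>u. f u *\<^sub>R covD \<Gamma> a X u - (- pd a f u) *\<^sub>R X u) z"
    by (rule covD_iter_cong[OF _ z]) (simp add: covD_scale[OF snoc.prems(1,2)])
  also have "\<dots> = covD_iter \<Gamma> as (\<lambda>u. f u *\<^sub>R covD \<Gamma> a X u) z - covD_iter \<Gamma> as (\<lambda>u. (- pd a f u) *\<^sub>R X u) z"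
    by (intro covD_iter_diff z smooth_vec_scale smooth_covD snoc.prems sf)
  moreover have "covD_iter \<Gamma> as (\<lambda>u. f u *\<^sub>R covD \<Gamma> a X u) z \<bullet> w = 0"
  proof (rule snoc.IH[OF snoc.prems(1) smooth_covD[OF snoc.prems(2)]])
    fix cs :: "2 list" assume "length cs \<le> length as"
    then show "covD_iter \<Gamma> cs (covD \<Gamma> a X) z \<bullet> w = 0"
      using snoc.prems(3)[of "cs @ [a]"] by (simp add: covD_iter_def)
  qed
  moreover have "covD_iter \<Gamma> as (\<lambda>u. (- pd a f u) *\<^sub>R X u) z \<bullet> w = 0"
    by (rule snoc.IH[OF sf snoc.prems(2)]) (use snoc.prems(3) in simp)
  ultimately show ?case by (simp add: inner_diff_left)
qed

text \<open>Exchanging two neighbouring indices produces derivatives along the prefix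
  \<open>as\<close> of a multiple of \<open>Vrow\<close>. Their order drops by at least two, so
  \<open>w\<close> annihilates them.\<close>

lemma covD_iter_swap_annihilated:
  assumes z: "z \<in> S" and w: "\<And>cs. length cs \<le> length as \<Longrightarrow> covD_iter \<Gamma> cs (Vrow \<Gamma>) z \<bullet> w = 0"
  shows "covD_iter \<Gamma> (as @ [2, 1] @ bs) (Vrow \<Gamma>) z \<bullet> w = covD_iter \<Gamma> (as @ [1, 2] @ bs) (Vrow \<Gamma>) z \<bullet> w"
proof -
  let ?Y = "covD_iter \<Gamma> bs (Vrow \<Gamma>)"
  have Y: "smooth_vec ?Y" by (intro smooth_covD_iter smooth_vec_Vrow)
  then have sf: "smooth_on S (\<lambda>u. - (?Y u $ 6))" by (auto simp: smooth_vec_def intro: sm_intros)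
  have "covD_iter \<Gamma> (as @ [1, 2] @ bs) (Vrow \<Gamma>) z - covD_iter \<Gamma> (as @ [2, 1] @ bs) (Vrow \<Gamma>) z
    = covD_iter \<Gamma> as (\<lambda>u. covD \<Gamma> 1 (covD \<Gamma> 2 ?Y) u - covD \<Gamma> 2 (covD \<Gamma> 1 ?Y) u) z"
    by (subst covD_iter_diff) (intro smooth_covD Y z, intro smooth_covD Y, rule z, simp add: covD_iter_def)
  also have "\<dots> = covD_iter \<Gamma> as (\<lambda>u. (- (?Y u $ 6)) *\<^sub>R Vrow \<Gamma> u) z"
    by (rule covD_iter_cong[OF covD_commute[OF Y] z])
  finally have "(covD_iter \<Gamma> (as @ [1, 2] @ bs) (Vrow \<Gamma>) z - covD_iter \<Gamma> (as @ [2, 1] @ bs) (Vrow \<Gamma>) z) \<bullet> w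
    = covD_iter \<Gamma> as (\<lambda>u. (- (?Y u $ 6)) *\<^sub>R Vrow \<Gamma> u) z \<bullet> w" by (rule arg_cong)
  also have "\<dots> = 0" by (rule covD_iter_scale_annihilated[OF sf smooth_vec_Vrow z w])
  finally show ?thesis unfolding inner_diff_left by linarith
qed

text \<open>Sorting the indices by neighbour exchanges, each of which costs only lower-order terms
  killed by \<open>w\<close>. The untouched prefix \<open>pre\<close> is carried along because the
  recursion sorts the tail first, inside the outer derivatives.\<close>

lemma covD_iter_normal_form:
  assumes z: "z \<in> S" and w: "\<And>cs. length cs < length pre + length as \<Longrightarrow> covD_iter \<Gamma> cs (Vrow \<Gamma>) z \<bullet> w = 0"
  shows "covD_iter \<Gamma> (pre @ as) (Vrow \<Gamma>) z \<bullet> w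
    = covD_iter \<Gamma> (pre @ replicate (count_list as 1) 1 @ replicate (count_list as 2) 2) (Vrow \<Gamma>) z \<bullet> w"
  using w
proof (induction as arbitrary: pre)
  case (Cons a as)
  have 1: "covD_iter \<Gamma> (pre @ a # as) (Vrow \<Gamma>) z \<bullet> w
    = covD_iter \<Gamma> (pre @ a # replicate (count_list as 1) 1 @ replicate (count_list as 2) 2) (Vrow \<Gamma>) z \<bullet> w"
    using Cons.IH[of "pre @ [a]"] Cons.prems by simp
  show ?case
  proof (cases "a = 1")
    case True
    then show ?thesis using 1 by simp
  next
    case False
    then have a: "a = 2" using exhaust_2 by metis
    \<comment> \<open>Insertion step of the sort: a 2 is carried past a block of 1s.\<close>
    have move: "covD_iter \<Gamma> (pre' @ 2 # replicate n 1 @ cs) (Vrow \<Gamma>) z \<bullet> w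
      = covD_iter \<Gamma> (pre' @ replicate n 1 @ 2 # cs) (Vrow \<Gamma>) z \<bullet> w"
      if "length pre' + n \<le> length pre + length as" for pre' n cs
      using that
    proof (induction n arbitrary: pre')
      case (Suc n)
      have "covD_iter \<Gamma> (pre' @ [2, 1] @ replicate n 1 @ cs) (Vrow \<Gamma>) z \<bullet> w
        = covD_iter \<Gamma> (pre' @ [1, 2] @ replicate n 1 @ cs) (Vrow \<Gamma>) z \<bullet> w"
        by (rule covD_iter_swap_annihilated[OF z]) (use Suc.prems Cons.prems in auto)
      then show ?case using Suc.IH[of "pre' @ [1]"] Suc.prems by simp
    qed simp
    have "count_list as 1 \<le> length as" by (rule count_le_length)
    then show ?thesis using 1 move[of pre "count_list as 1" "replicate (count_list as 2) 2"] a by simp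
  qed
qed simp

text \<open>All permutations of the indices have the same sorted form, so the average in the
  symmetrisation is over equal numbers.\<close>

lemma covD_sym_pairing:
  assumes z: "z \<in> S" and w: "\<And>cs. length cs < length as \<Longrightarrow> covD_iter \<Gamma> cs (Vrow \<Gamma>) z \<bullet> w = 0"
  shows "covD_sym \<Gamma> as (Vrow \<Gamma>) z \<bullet> w = covD_iter \<Gamma> as (Vrow \<Gamma>) z \<bullet> w"
proof -
  have "covD_iter \<Gamma> (permute_list \<sigma> as) (Vrow \<Gamma>) z \<bullet> w = covD_iter \<Gamma> as (Vrow \<Gamma>) z \<bullet> w"
    if "\<sigma> permutes {..<length as}" for \<sigma>
  proof -
    have "count_list (permute_list \<sigma> as) a = count_list as a" for a
      using mset_permute_list[OF that] by (metis count_mset)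
    then show ?thesis
      using covD_iter_normal_form[OF z, of "[]" "permute_list \<sigma> as"] covD_iter_normal_form[OF z, of "[]" as] w by simp
  qed
  then have "covD_sym \<Gamma> as (Vrow \<Gamma>) z \<bullet> w = 1 / fact (length as) *
     (\<Sum>\<sigma> | \<sigma> permutes {..<length as}. covD_iter \<Gamma> as (Vrow \<Gamma>) z \<bullet> w)"
    by (simp add: covD_sym_def inner_sum_left)
  also have "\<dots> = covD_iter \<Gamma> as (Vrow \<Gamma>) z \<bullet> w"
    using card_permutations[of "{..<length as}" "length as"] by simp
  finally show ?thesis .
qed

text \<open>Strong induction on the order: the vanishing at lower orders, which makes the order of
  indices immaterial, is exactly the induction hypothesis.\<close>

lemma covD_iter_annihilated_iff:
  assumes z: "z \<in> S"
  shows "(\<forall>k\<le>n. \<forall>m\<le>k. covD_sym \<Gamma> (replicate (k - m) 1 @ replicate m 2) (Vrow \<Gamma>) z \<bullet> w = 0)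
    \<longleftrightarrow> (\<forall>as. length as \<le> n \<longrightarrow> covD_iter \<Gamma> as (Vrow \<Gamma>) z \<bullet> w = 0)" (is "?L \<longleftrightarrow> ?R")
proof
  assume L: ?L
  have "covD_iter \<Gamma> as (Vrow \<Gamma>) z \<bullet> w = 0" if "length as \<le> n" for as
    using that
  proof (induction "length as" arbitrary: as rule: less_induct)
    case less
    then have IH: "covD_iter \<Gamma> cs (Vrow \<Gamma>) z \<bullet> w = 0" if "length cs < length as" for cs using that by simp
    let ?nf = "replicate (count_list as 1) 1 @ replicate (count_list as 2) (2::2)"
    have len: "count_list as 1 + count_list as 2 = length as"
    proof (induction as)
      case (Cons a as)
      then show ?case using exhaust_2[of a] by auto
    qed simp
    have "covD_iter \<Gamma> as (Vrow \<Gamma>) z \<bullet> w = covD_iter \<Gamma> ?nf (Vrow \<Gamma>) z \<bullet> w"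
      using covD_iter_normal_form[OF z, of "[]" as w] IH by simp
    also have "\<dots> = covD_sym \<Gamma> ?nf (Vrow \<Gamma>) z \<bullet> w"
      using covD_sym_pairing[OF z, of ?nf w] IH len by simp
    also have "\<dots> = 0"
      using L[rule_format, of "length as" "count_list as 2"] less.prems len by (metis add_diff_cancel_right' le_add2)
    finally show ?case .
  qed
  then show ?R by blast
next
  assume R: ?R
  show ?L
  proof (intro allI impI)
    fix k m assume km: "k \<le> n" "m \<le> k"
    let ?as = "replicate (k - m) 1 @ replicate m (2::2)"
    have "covD_sym \<Gamma> ?as (Vrow \<Gamma>) z \<bullet> w = covD_iter \<Gamma> ?as (Vrow \<Gamma>) z \<bullet> w"
      by (rule covD_sym_pairing[OF z]) (use R km in auto)
    then show "covD_sym \<Gamma> ?as (Vrow \<Gamma>) z \<bullet> w = 0" using R km by simp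
  qed
qed

end

section \<open>The kernel of the 21-row matrix\<close>

lemma vector_nth_of_nat:
  fixes l :: "'a::zero list"
  assumes "k < length l" "\<And>j. 0 < j \<Longrightarrow> j < length l \<Longrightarrow> (of_nat j :: 'n) \<noteq> 0"
  shows "(vector l :: ('a, 'n::{finite,comm_ring_1}) vec) $ of_nat (Suc k) = l ! k"
proof -
  \<comment> \<open>\<open>vector\<close> counts upwards in the finite index type. The assumption on
    \<open>of_nat j\<close> says that the count does not wrap around within the list, so no entry
    overwrites another.\<close>
  have "foldr (\<lambda>x f n. (f (n + 1))(n := x)) l (\<lambda>n x. 0) n (n + of_nat k) = l ! k" for n :: 'n
    using assms
  proof (induction l arbitrary: n k)
    case (Cons x l)
    show ?case
    proof (cases k)
      case (Suc k')
      have "(of_nat k :: 'n) \<noteq> 0" using Cons.prems Suc by blast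
      then have "n + of_nat k \<noteq> n" by simp
      then show ?thesis using Cons.IH[of k' "n + 1"] Cons.prems Suc by (simp add: add.assoc)
    qed simp
  qed simp
  from this[of 1] show ?thesis by (simp add: vector_def)
qed

lemma exhaust_21: "\<exists>k<21. (i :: 21) = of_nat (Suc k)"
proof (induct i)
  case (of_int z)
  show ?case
  proof (cases "z = 0")
    case True
    \<comment> \<open>In the index type the number 0 equals 21, the last position.\<close>
    then show ?thesis by (intro exI[of _ 20]) simp
  next
    case False
    then show ?thesis using of_int by (intro exI[of _ "nat (z - 1)"]) (auto simp: of_nat_nat)
  qed
qed

lemma M_max_mult_eq_0:
  "M_max \<Gamma> z *v w = 0 \<longleftrightarrow>
    (\<forall>k\<le>5. \<forall>m\<le>k. covD_sym \<Gamma> (replicate (k - m) 1 @ replicate m 2) (Vrow \<Gamma>) z \<bullet> w = 0)"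
proof -
  \<comment> \<open>There are k + 1 rows of order k, and 1 + 2 + ... + 6 = 21.\<close>
  have len: "length (sym_rows 5 \<Gamma> z) = 21" by (simp add: sym_rows_def eval_nat_numeral)
  have ne: "(of_nat j :: 21) \<noteq> 0" if "0 < j" "j < 21" for j
  proof -
    have "j \<in> {1,2,3,4,5,6,7,8,9,10,11,12,13,14,15,16,17,18,19,20}" using that by (simp only: insert_iff empty_iff) presburger
    then show ?thesis by (elim insertE) simp_all
  qed
  have nth: "M_max \<Gamma> z $ of_nat (Suc k) = sym_rows 5 \<Gamma> z ! k" if "k < 21" for k
    unfolding M_max_def by (rule vector_nth_of_nat) (use that len ne in auto)
  have "M_max \<Gamma> z *v w = 0 \<longleftrightarrow> (\<forall>i. M_max \<Gamma> z $ i \<bullet> w = 0)"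
    by (simp add: vec_eq_iff matrix_vector_mult_def inner_vec_def)
  also have "\<dots> \<longleftrightarrow> (\<forall>k<21. sym_rows 5 \<Gamma> z ! k \<bullet> w = 0)"
  proof
    assume L: "\<forall>i. M_max \<Gamma> z $ i \<bullet> w = 0"
    show "\<forall>k<21. sym_rows 5 \<Gamma> z ! k \<bullet> w = 0" using L nth by metis
  next
    assume R: "\<forall>k<21. sym_rows 5 \<Gamma> z ! k \<bullet> w = 0"
    show "\<forall>i. M_max \<Gamma> z $ i \<bullet> w = 0"
    proof
      fix i :: 21
      obtain k where k: "k < 21" "i = of_nat (Suc k)" using exhaust_21 by blast
      show "M_max \<Gamma> z $ i \<bullet> w = 0" unfolding k(2) nth[OF k(1)] using R k(1) by blast
    qed
  qed
  also have "\<dots> \<longleftrightarrow> (\<forall>r\<in>set (sym_rows 5 \<Gamma> z). r \<bullet> w = 0)"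
    by (simp add: all_set_conv_all_nth len)
  also have "\<dots> \<longleftrightarrow> (\<forall>k\<le>5. \<forall>m\<le>k. covD_sym \<Gamma> (replicate (k - m) 1 @ replicate m 2) (Vrow \<Gamma>) z \<bullet> w = 0)"
    unfolding sym_rows_def
    by (simp only: set_concat set_map set_upt image_image atLeast0LessThan lessThan_Suc_atMost) blast
  finally show ?thesis .
qed

subsection \<open>Points where all ranks are locally constant\<close>

text \<open>The dual functionals of the independent family give the lower bound at \<open>q\<close>;
  a small perturbation costs half of it. The quantitative form is kept because it bounds the
  coefficients of combinations uniformly near \<open>q\<close>, which mere independence at each
  point would not.\<close>

lemma independent_stable:
  fixes s :: "'i \<Rightarrow> real^2 \<Rightarrow> real^6"
  assumes fin: "finite B" and inj: "inj_on (\<lambda>b. s b q) B" and ind: "independent ((\<lambda>b. s b q) ` B)"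
    and cont: "\<And>b. b \<in> B \<Longrightarrow> isCont (s b) q"
  shows "\<exists>c>0. \<forall>\<^sub>F z in nhds q. \<forall>f. c * (\<Sum>b\<in>B. \<bar>f b\<bar>) \<le> norm (\<Sum>b\<in>B. f b *\<^sub>R s b z)"
proof -
  have "\<exists>K\<ge>0. \<forall>f. \<bar>f b\<bar> \<le> K * norm (\<Sum>b\<in>B. f b *\<^sub>R s b q)" if b: "b \<in> B" for b
  proof -
    obtain g :: "real^6 \<Rightarrow> real" where g: "linear g" and gs: "\<And>x. x \<in> (\<lambda>b. s b q) ` B \<Longrightarrow> g x = (if x = s b q then 1 else 0)"
      using linear_independent_extend[OF ind, of "\<lambda>x. if x = s b q then 1 else (0::real)"] by auto
    interpret linear g by (rule g)
    obtain K where K: "K \<ge> 0" "\<And>x. norm (g x) \<le> K * norm x"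
      using linear_bounded_pos[OF g] by (metis less_imp_le)
    have "f b = g (\<Sum>b\<in>B. f b *\<^sub>R s b q)" for f
    proof -
      have "g (\<Sum>b\<in>B. f b *\<^sub>R s b q) = (\<Sum>b'\<in>B. f b' * g (s b' q))" by (simp add: sum scale)
      also have "\<dots> = (\<Sum>b'\<in>B. if b' = b then f b' else 0)"
        using inj b gs by (intro sum.cong refl) (auto simp: inj_on_def)
      also have "\<dots> = f b" using fin b by simp
      finally show ?thesis by simp
    qed
    then have "\<bar>f b\<bar> \<le> K * norm (\<Sum>b\<in>B. f b *\<^sub>R s b q)" for f using K(2) by (metis real_norm_def)
    then show ?thesis using K(1) by blast
  qed
  then obtain K where K: "\<And>b. b \<in> B \<Longrightarrow> K b \<ge> 0"
    "\<And>b f. b \<in> B \<Longrightarrow> \<bar>f b\<bar> \<le> K b * norm (\<Sum>b\<in>B. f b *\<^sub>R s b q)" by metis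
  define L where "L = (\<Sum>b\<in>B. K b) + 1"
  have L: "L > 0" using sum_nonneg[of B K] K(1) by (simp add: L_def add_nonneg_pos)
  have low: "(\<Sum>b\<in>B. \<bar>f b\<bar>) \<le> L * norm (\<Sum>b\<in>B. f b *\<^sub>R s b q)" for f
  proof -
    have "(\<Sum>b\<in>B. \<bar>f b\<bar>) \<le> (\<Sum>b\<in>B. K b * norm (\<Sum>b\<in>B. f b *\<^sub>R s b q))" using K(2) by (intro sum_mono)
    also have "\<dots> \<le> L * norm (\<Sum>b\<in>B. f b *\<^sub>R s b q)" by (simp add: L_def sum_distrib_right[symmetric] distrib_right)
    finally show ?thesis .
  qed
  \<comment> \<open>At \<open>q\<close> the bound holds with \<open>2 * c\<close>; the perturbation
    takes away at most one \<open>c\<close>.\<close>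
  define c where "c = 1 / (2 * L)"
  have c: "c > 0" using L by (simp add: c_def)
  have "\<forall>\<^sub>F z in nhds q. norm (s b z - s b q) < c" if "b \<in> B" for b
    using cont[OF that] c unfolding continuous_at tendsto_iff eventually_nhds_conv_at dist_norm
    by auto
  then have "\<forall>\<^sub>F z in nhds q. \<forall>b\<in>B. norm (s b z - s b q) < c"
    using fin by (simp add: eventually_ball_finite)
  then have "\<forall>\<^sub>F z in nhds q. \<forall>f. c * (\<Sum>b\<in>B. \<bar>f b\<bar>) \<le> norm (\<Sum>b\<in>B. f b *\<^sub>R s b z)"
  proof (rule eventually_mono, intro allI)
    fix z f assume z: "\<forall>b\<in>B. norm (s b z - s b q) < c"
    have "norm (\<Sum>b\<in>B. f b *\<^sub>R (s b z - s b q)) \<le> (\<Sum>b\<in>B. \<bar>f b\<bar> * c)"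
      by (rule sum_norm_le) (use z in \<open>simp add: mult_left_mono less_imp_le\<close>)
    then have 1: "norm (\<Sum>b\<in>B. f b *\<^sub>R (s b z - s b q)) \<le> c * (\<Sum>b\<in>B. \<bar>f b\<bar>)"
      by (simp add: sum_distrib_left mult.commute)
    have "(\<Sum>b\<in>B. f b *\<^sub>R s b q) = (\<Sum>b\<in>B. f b *\<^sub>R s b z) - (\<Sum>b\<in>B. f b *\<^sub>R (s b z - s b q))"
      by (simp add: sum_subtractf scaleR_diff_right)
    then have "norm (\<Sum>b\<in>B. f b *\<^sub>R s b q) \<le> norm (\<Sum>b\<in>B. f b *\<^sub>R s b z) + c * (\<Sum>b\<in>B. \<bar>f b\<bar>)"
      using 1 norm_triangle_ineq4[of "\<Sum>b\<in>B. f b *\<^sub>R s b z" "\<Sum>b\<in>B. f b *\<^sub>R (s b z - s b q)"] by simp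
    moreover have "2 * c * (\<Sum>b\<in>B. \<bar>f b\<bar>) \<le> norm (\<Sum>b\<in>B. f b *\<^sub>R s b q)"
      using low[of f] L by (simp add: c_def field_simps)
    ultimately show "c * (\<Sum>b\<in>B. \<bar>f b\<bar>) \<le> norm (\<Sum>b\<in>B. f b *\<^sub>R s b z)" by linarith
  qed
  then show ?thesis using c by blast
qed

lemma bounded_below_imp_independent:
  fixes s :: "'i \<Rightarrow> 'a::real_normed_vector"
  assumes fin: "finite B" and c: "c > 0" and low: "\<And>f. c * (\<Sum>b\<in>B. \<bar>f b\<bar>) \<le> norm (\<Sum>b\<in>B. f b *\<^sub>R s b)"
  shows "inj_on s B" "independent (s ` B)"
proof -
  have zero: "f b = 0" if "(\<Sum>b\<in>B. f b *\<^sub>R s b) = 0" "b \<in> B" for f b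
  proof -
    have "c * (\<Sum>b\<in>B. \<bar>f b\<bar>) \<le> 0" using low[of f] that(1) by simp
    then have "(\<Sum>b\<in>B. \<bar>f b\<bar>) \<le> 0" using c by (simp add: mult_le_0_iff)
    then have "\<bar>f b\<bar> \<le> 0" using member_le_sum[OF that(2), of "\<lambda>b. \<bar>f b\<bar>"] fin by simp
    then show ?thesis by simp
  qed
  show inj: "inj_on s B"
  proof (rule inj_onI, rule ccontr)
    fix b b' assume bb: "b \<in> B" "b' \<in> B" "s b = s b'" "b \<noteq> b'"
    let ?f = "\<lambda>x. (if x = b then 1 else 0) - (if x = b' then 1 else (0::real))"
    have "(\<Sum>x\<in>B. ?f x *\<^sub>R s x) = (\<Sum>x\<in>B. if x = b then s x else 0) - (\<Sum>x\<in>B. if x = b' then s x else 0)"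
      unfolding sum_subtractf[symmetric] by (intro sum.cong) (auto simp: scaleR_diff_left)
    also have "\<dots> = 0" using fin bb by simp
    finally have "?f b = 0" using bb(1) by (rule zero)
    then show False using bb(4) by simp
  qed
  show "independent (s ` B)"
  proof
    assume "dependent (s ` B)"
    then obtain u where u: "\<exists>v\<in>s ` B. u v \<noteq> 0" "(\<Sum>v\<in>s ` B. u v *\<^sub>R v) = 0"
      using dependent_finite[of "s ` B"] fin by auto
    have "(\<Sum>b\<in>B. u (s b) *\<^sub>R s b) = 0" using u(2) inj by (simp add: sum.reindex)
    then show False using u(1) zero[of "\<lambda>b. u (s b)"] by blast
  qed
qed

text \<open>The component orthogonal to the span is itself an admissible \<open>w\<close>, hence
  zero. This allows span membership to be tested against one fixed \<open>w\<close> at a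
  time.\<close>

lemma in_span_if_annihilated:
  fixes x :: "'a::euclidean_space"
  assumes "\<And>w. (\<And>y. y \<in> E \<Longrightarrow> y \<bullet> w = 0) \<Longrightarrow> x \<bullet> w = 0"
  shows "x \<in> span E"
proof -
  obtain y z where y: "y \<in> span E" and z: "\<And>w. w \<in> span E \<Longrightarrow> orthogonal z w" and x: "x = y + z"
    using orthogonal_subspace_decomp_exists[of E x] by metis
  have "x \<bullet> z = 0"
    by (rule assms) (use z in \<open>auto simp: orthogonal_def inner_commute span_base\<close>)
  moreover have "y \<bullet> z = 0" using z[OF y] by (simp add: orthogonal_def inner_commute)
  ultimately have "z \<bullet> z = 0" by (simp add: x inner_add_left)
  then show ?thesis using y x by simp
qed

context analytic_chart
begin

text \<open>The strict inequality makes \<open>jet 0 z\<close> empty, so that the dimension count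
  starts at 0 and \<open>jet 6 z\<close> holds the orders up to 5.\<close>

definition jet :: "nat \<Rightarrow> real^2 \<Rightarrow> (real^6) set" where
  "jet k z = (\<lambda>as. covD_iter \<Gamma> as (Vrow \<Gamma>) z) ` {as. length as < k}"

lemma finite_lists: "finite {as :: 2 list. length as < k}"
proof -
  have "{as :: 2 list. length as < k} \<subseteq> {as. set as \<subseteq> UNIV \<and> length as \<le> k}" by auto
  then show ?thesis by (rule finite_subset) (rule finite_lists_length_le[OF finite])
qed

lemma jet_mono: "k \<le> n \<Longrightarrow> jet k z \<subseteq> jet n z"
  unfolding jet_def by (intro image_mono) auto

lemma smooth_vec_isCont: "smooth_vec X \<Longrightarrow> z \<in> S \<Longrightarrow> isCont X z"
proof -
  assume X: "smooth_vec X" and z: "z \<in> S"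
  have "isCont (\<lambda>u. X u $ j) z" for j
    using X z smooth_on_continuous open_S unfolding smooth_vec_def by (metis continuous_on_eq_continuous_at)
  then have "isCont (\<lambda>u. \<chi> j. X u $ j) z"
    unfolding isCont_def by (intro vec_tendstoI) simp
  then show "isCont X z" by simp
qed

lemma smooth_vec_jet: "smooth_vec (covD_iter \<Gamma> as (Vrow \<Gamma>))"
  by (intro smooth_covD_iter smooth_vec_Vrow)

text \<open>The basis is recorded by its index lists and not by its vectors, so that the same lists
  provide a frame at nearby points.\<close>

lemma jet_basis:
  assumes z: "z \<in> S"
  obtains B c where "B \<subseteq> {as. length as < k}" "finite B" "card B = dim (jet k z)" "c > 0"
    "\<forall>\<^sub>F u in nhds z. \<forall>f. c * (\<Sum>b\<in>B. \<bar>f b\<bar>) \<le> norm (\<Sum>b\<in>B. f b *\<^sub>R covD_iter \<Gamma> b (Vrow \<Gamma>) u)"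
proof -
  obtain BB where BB: "BB \<subseteq> jet k z" "independent BB" "card BB = dim (jet k z)"
    using basis_exists[of "jet k z"] by metis
  then obtain B where B: "B \<subseteq> {as. length as < k}" "inj_on (\<lambda>as. covD_iter \<Gamma> as (Vrow \<Gamma>) z) B"
    "BB = (\<lambda>as. covD_iter \<Gamma> as (Vrow \<Gamma>) z) ` B"
    unfolding jet_def by (auto simp: subset_image_inj)
  have fin: "finite B" using B(1) finite_lists finite_subset by blast
  obtain c where "c > 0"
    "\<forall>\<^sub>F u in nhds z. \<forall>f. c * (\<Sum>b\<in>B. \<bar>f b\<bar>) \<le> norm (\<Sum>b\<in>B. f b *\<^sub>R covD_iter \<Gamma> b (Vrow \<Gamma>) u)"
    using independent_stable[where s = "\<lambda>b. covD_iter \<Gamma> b (Vrow \<Gamma>)", OF fin B(2)] BB(2) B(3)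
      smooth_vec_isCont[OF smooth_vec_jet z] by blast
  moreover have "card B = dim (jet k z)" using BB(3) B by (simp add: card_image)
  ultimately show ?thesis using that B(1) fin by blast
qed

lemma jet_independent_subset:
  assumes "B \<subseteq> {as. length as < k}" "finite B" "c > 0"
    and low: "\<And>f. c * (\<Sum>b\<in>B. \<bar>f b\<bar>) \<le> norm (\<Sum>b\<in>B. f b *\<^sub>R covD_iter \<Gamma> b (Vrow \<Gamma>) u)"
  shows "card B \<le> dim (jet k u)"
    and "dim (jet k u) = card B \<Longrightarrow> x \<in> span (jet k u) \<Longrightarrow> \<exists>f. x = (\<Sum>b\<in>B. f b *\<^sub>R covD_iter \<Gamma> b (Vrow \<Gamma>) u)"
proof -
  let ?s = "\<lambda>b. covD_iter \<Gamma> b (Vrow \<Gamma>) u"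
  note ind = bounded_below_imp_independent[OF assms(2,3), of ?s, OF low]
  have sub: "?s ` B \<subseteq> jet k u" unfolding jet_def using assms(1) by blast
  have card: "card (?s ` B) = card B" using ind(1) by (rule card_image)
  show "card B \<le> dim (jet k u)"
    using independent_card_le_dim[OF sub ind(2)] card by simp
  assume dim: "dim (jet k u) = card B" and x: "x \<in> span (jet k u)"
  have "jet k u \<subseteq> span (?s ` B)"
    by (rule card_ge_dim_independent[OF sub ind(2)]) (simp add: card dim)
  then have "x \<in> span (?s ` B)" using x span_minimal subspace_span by blast
  then obtain g where "x = (\<Sum>v\<in>?s ` B. g v *\<^sub>R v)" using assms(2) by (auto simp: span_finite)
  then have "x = (\<Sum>b\<in>B. g (?s b) *\<^sub>R ?s b)" using ind(1) by (simp add: sum.reindex)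
  then show "\<exists>f. x = (\<Sum>b\<in>B. f b *\<^sub>R ?s b)" by (intro exI[of _ "\<lambda>b. g (?s b)"])
qed

text \<open>Before the limit, the expression depends linearly on the value of \<open>Y\<close> at
  the single point \<open>z + t *\<^sub>R axis a 1\<close>. It can therefore be expanded in a frame
  at that point without differentiating the coefficients.\<close>

lemma covD_pairing_limit:
  assumes Y: "smooth_vec Y" and z: "z \<in> S" and w: "Y z \<bullet> w = 0"
  shows "((\<lambda>t. Y (z + t *\<^sub>R axis a 1) \<bullet> w / t - Y (z + t *\<^sub>R axis a 1) \<bullet> (Omega a \<Gamma> z *v w)) \<longlongrightarrow> covD \<Gamma> a Y z \<bullet> w) (at 0)"
proof -
  have "((\<lambda>t. Y (z + t *\<^sub>R axis a 1) $ i) has_real_derivative pd a (\<lambda>u. Y u $ i) z) (at 0)" for i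
    using Y z by (intro pd_line[of "\<lambda>u. Y u $ i"] smooth_on_differentiable[OF open_S]) (auto simp: smooth_vec_def)
  then have "((\<lambda>t. Y (z + t *\<^sub>R axis a 1) \<bullet> w) has_real_derivative (\<Sum>i\<in>UNIV. pd a (\<lambda>u. Y u $ i) z * w $ i)) (at 0)"
    unfolding inner_vec_def inner_real_def by (intro DERIV_sum DERIV_cmult_right)
  then have 1: "((\<lambda>t. Y (z + t *\<^sub>R axis a 1) \<bullet> w / t) \<longlongrightarrow> (\<chi> i. pd a (\<lambda>u. Y u $ i) z) \<bullet> w) (at 0)"
    using w by (simp add: has_field_derivative_iff inner_vec_def)
  have "((\<lambda>t. z + t *\<^sub>R axis a (1::real)) \<longlongrightarrow> z + 0 *\<^sub>R axis a 1) (at 0)" by (intro tendsto_intros)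
  then have "((\<lambda>t. Y (z + t *\<^sub>R axis a 1)) \<longlongrightarrow> Y z) (at 0)"
    using isCont_tendsto_compose[OF smooth_vec_isCont[OF Y z]] by simp
  then have 2: "((\<lambda>t. Y (z + t *\<^sub>R axis a 1) \<bullet> (Omega a \<Gamma> z *v w)) \<longlongrightarrow> Y z \<bullet> (Omega a \<Gamma> z *v w)) (at 0)"
    by (intro tendsto_intros)
  have "covD \<Gamma> a Y z \<bullet> w = (\<chi> i. pd a (\<lambda>u. Y u $ i) z) \<bullet> w - Y z \<bullet> (Omega a \<Gamma> z *v w)"
    by (simp add: covD_def inner_diff_left dot_lmul_matrix)
  then show ?thesis using tendsto_diff[OF 1 2] by simp
qed

text \<open>The coefficients of \<open>X\<close> in a local frame need only be bounded, not differentiable.\<close>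

lemma covD_in_span_jet:
  assumes O: "open O'" "O' \<subseteq> S" "z \<in> O'"
    and dim: "\<And>u. u \<in> O' \<Longrightarrow> dim (jet k u) = dim (jet k z)"
    and X: "smooth_vec X" and Xin: "\<And>u. u \<in> O' \<Longrightarrow> X u \<in> span (jet k u)"
  shows "covD \<Gamma> a X z \<in> span (jet (Suc k) z)"
proof (rule in_span_if_annihilated)
  fix w assume w: "\<And>y. y \<in> jet (Suc k) z \<Longrightarrow> y \<bullet> w = 0"
  have z: "z \<in> S" using O by blast
  obtain B c where B: "B \<subseteq> {as. length as < k}" "finite B" "card B = dim (jet k z)" and c: "c > 0"
    and ev: "\<forall>\<^sub>F u in nhds z. \<forall>f. c * (\<Sum>b\<in>B. \<bar>f b\<bar>) \<le> norm (\<Sum>b\<in>B. f b *\<^sub>R covD_iter \<Gamma> b (Vrow \<Gamma>) u)"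
    by (rule jet_basis[OF z])
  let ?s = "\<lambda>b. covD_iter \<Gamma> b (Vrow \<Gamma>)"
  define v where "v = Omega a \<Gamma> z *v w"
  define pt where "pt t = z + t *\<^sub>R axis a (1::real)" for t
  define h where "h b t = ?s b (pt t) \<bullet> w / t - ?s b (pt t) \<bullet> v" for b t
  have w': "y \<bullet> w = 0" if "y \<in> span (jet k z)" for y
  proof -
    have "span (jet k z) \<subseteq> {y. w \<bullet> y = 0}"
      using w jet_mono[of k "Suc k" z] by (intro span_minimal subspace_hyperplane) (auto simp: inner_commute)
    then show ?thesis using that by (auto simp: inner_commute)
  qed
  \<comment> \<open>For a frame element of order below \<open>k\<close> the limit is the pairing
    with a derivative of order below \<open>Suc k\<close>, which \<open>w\<close>
    annihilates.\<close>
  have h0: "(h b \<longlongrightarrow> 0) (at 0)" if b: "b \<in> B" for b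
  proof -
    have "length b < k" using b B(1) by auto
    then have "?s b z \<in> jet (Suc k) z" "?s (a # b) z \<in> jet (Suc k) z" unfolding jet_def by auto
    then have "?s b z \<bullet> w = 0" "covD \<Gamma> a (?s b) z \<bullet> w = 0" using w by (auto simp: covD_iter_Cons)
    then show ?thesis
      using covD_pairing_limit[OF smooth_vec_jet z, of b w a] unfolding h_def[abs_def] pt_def v_def by simp
  qed
  have pt: "(pt \<longlongrightarrow> z) (at 0)"
    using tendsto_add[OF tendsto_const tendsto_scaleR[OF tendsto_ident_at tendsto_const], of z "axis a 1" 0] unfolding pt_def by simp
  have Xlim: "((\<lambda>t. X (pt t) \<bullet> w / t - X (pt t) \<bullet> v) \<longlongrightarrow> covD \<Gamma> a X z \<bullet> w) (at 0)"
    unfolding pt_def v_def by (rule covD_pairing_limit[OF X z w'[OF Xin[OF O(3)]]])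
  \<comment> \<open>The majorant: frame coefficients at \<open>pt t\<close> are bounded by
    \<open>norm (X (pt t)) / c\<close>, and each \<open>h b\<close> tends to 0.\<close>
  have "((\<lambda>t. norm (X (pt t)) / c * (\<Sum>b\<in>B. \<bar>h b t\<bar>)) \<longlongrightarrow> norm (X z) / c * (\<Sum>b\<in>B. \<bar>0\<bar>)) (at 0)"
    using c by (intro tendsto_intros isCont_tendsto_compose[OF smooth_vec_isCont[OF X z] pt] h0) auto
  then have maj: "((\<lambda>t. norm (X (pt t)) / c * (\<Sum>b\<in>B. \<bar>h b t\<bar>)) \<longlongrightarrow> 0) (at 0)" by simp
  have "\<forall>\<^sub>F u in nhds z. u \<in> O' \<and> (\<forall>f. c * (\<Sum>b\<in>B. \<bar>f b\<bar>) \<le> norm (\<Sum>b\<in>B. f b *\<^sub>R ?s b u))"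
    using ev eventually_nhds_in_open[OF O(1,3)] by (rule eventually_conj[rotated])
  then have "\<forall>\<^sub>F t in at 0. pt t \<in> O' \<and> (\<forall>f. c * (\<Sum>b\<in>B. \<bar>f b\<bar>) \<le> norm (\<Sum>b\<in>B. f b *\<^sub>R ?s b (pt t)))"
    using pt by (rule eventually_compose_filterlim)
  then have "\<forall>\<^sub>F t in at 0. norm (X (pt t) \<bullet> w / t - X (pt t) \<bullet> v) \<le> norm (X (pt t)) / c * (\<Sum>b\<in>B. \<bar>h b t\<bar>)"
  proof (rule eventually_mono)
    fix t assume t: "pt t \<in> O' \<and> (\<forall>f. c * (\<Sum>b\<in>B. \<bar>f b\<bar>) \<le> norm (\<Sum>b\<in>B. f b *\<^sub>R ?s b (pt t)))"
    then have "\<exists>f. X (pt t) = (\<Sum>b\<in>B. f b *\<^sub>R ?s b (pt t))"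
      by (intro jet_independent_subset(2)[OF B(1,2) c]) (use dim[of "pt t"] B(3) Xin in auto)
    then obtain f where f: "X (pt t) = (\<Sum>b\<in>B. f b *\<^sub>R ?s b (pt t))" by blast
    have "c * (\<Sum>b\<in>B. \<bar>f b\<bar>) \<le> norm (X (pt t))" using t f by auto
    then have fb: "(\<Sum>b\<in>B. \<bar>f b\<bar>) \<le> norm (X (pt t)) / c" using c by (simp add: field_simps)
    have "\<bar>f b\<bar> \<le> norm (X (pt t)) / c" if "b \<in> B" for b
      using member_le_sum[OF that, of "\<lambda>b. \<bar>f b\<bar>"] B(2) fb by simp
    then have "norm (\<Sum>b\<in>B. f b * h b t) \<le> (\<Sum>b\<in>B. norm (X (pt t)) / c * \<bar>h b t\<bar>)"
      by (intro sum_norm_le) (simp add: abs_mult mult_right_mono del: times_divide_eq_left)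
    moreover have "X (pt t) \<bullet> w / t - X (pt t) \<bullet> v = (\<Sum>b\<in>B. f b * h b t)"
      unfolding f h_def by (simp add: inner_sum_left sum_divide_distrib sum_subtractf right_diff_distrib)
    ultimately show "norm (X (pt t) \<bullet> w / t - X (pt t) \<bullet> v) \<le> norm (X (pt t)) / c * (\<Sum>b\<in>B. \<bar>h b t\<bar>)"
      by (simp add: sum_distrib_left)
  qed
  then have "((\<lambda>t. X (pt t) \<bullet> w / t - X (pt t) \<bullet> v) \<longlongrightarrow> 0) (at 0)"
    using maj by (rule Lim_null_comparison)
  then show "covD \<Gamma> a X z \<bullet> w = 0" using Xlim tendsto_unique[OF at_neq_bot] by blast
qed

lemma dim_jet_lower_semicontinuous:
  assumes "z \<in> S"
  shows "\<forall>\<^sub>F u in nhds z. dim (jet k z) \<le> dim (jet k u)"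
proof -
  obtain B c where B: "B \<subseteq> {as. length as < k}" "finite B" "card B = dim (jet k z)" "c > 0"
    and ev: "\<forall>\<^sub>F u in nhds z. \<forall>f. c * (\<Sum>b\<in>B. \<bar>f b\<bar>) \<le> norm (\<Sum>b\<in>B. f b *\<^sub>R covD_iter \<Gamma> b (Vrow \<Gamma>) u)"
    by (rule jet_basis[OF assms])
  from ev show ?thesis
    by (rule eventually_mono) (rule jet_independent_subset(1)[OF B(1,2,4), unfolded B(3)], blast)
qed

text \<open>The ranks are integers that can only jump up nearby, so a point where their total is
  largest has all of them locally constant. Once two consecutive spans agree on a neighbourhood,
  differentiation cannot leave them.\<close>

lemma exists_flat_point:
  assumes O: "open O'" "O' \<subseteq> S" "O' \<noteq> {}"
    and ker: "\<And>u. u \<in> O' \<Longrightarrow> \<exists>w. w \<noteq> 0 \<and> (\<forall>as. length as \<le> 5 \<longrightarrow> covD_iter \<Gamma> as (Vrow \<Gamma>) u \<bullet> w = 0)"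
  shows "\<exists>q\<in>O'. \<forall>w. (\<forall>as. length as \<le> 5 \<longrightarrow> covD_iter \<Gamma> as (Vrow \<Gamma>) q \<bullet> w = 0) \<longrightarrow>
    (\<forall>as. covD_iter \<Gamma> as (Vrow \<Gamma>) q \<bullet> w = 0)"
proof -
  \<comment> \<open>One integer for all seven dimensions: at a maximum of the sum, no summand can
    increase nearby without another one decreasing, which semicontinuity forbids. The bound is 7
    times 6.\<close>
  define r where "r u = (\<Sum>k\<le>6. dim (jet k u))" for u
  have r: "r u \<le> 42" for u
  proof -
    have "r u \<le> (\<Sum>k\<le>(6::nat). 6)"
      unfolding r_def using dim_subset_UNIV[where 'a = "real^6"] by (intro sum_mono) simp
    then show ?thesis by simp
  qed
  obtain q where q: "q \<in> O'" and max: "\<And>u. u \<in> O' \<Longrightarrow> r u \<le> r q"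
  proof -
    obtain u0 where "u0 \<in> O'" using O(3) by blast
    moreover have "\<forall>u. u \<in> O' \<longrightarrow> r u < 43"
    proof (intro allI impI)
      fix u show "r u < 43" using r[of u] by linarith
    qed
    ultimately show ?thesis using Lattices_Big.ex_has_greatest_nat[of "\<lambda>u. u \<in> O'" u0 r 43] that by blast
  qed
  have qS: "q \<in> S" using q O by blast
  have "\<forall>\<^sub>F u in nhds q. \<forall>k\<in>{..6}. dim (jet k q) \<le> dim (jet k u)"
    using dim_jet_lower_semicontinuous[OF qS] by (simp add: eventually_ball_finite)
  then obtain Q where Q: "open Q" "q \<in> Q" "\<And>u k. u \<in> Q \<Longrightarrow> k \<le> 6 \<Longrightarrow> dim (jet k q) \<le> dim (jet k u)"
    unfolding eventually_nhds by auto
  define N where "N = Q \<inter> O'"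
  have N: "open N" "q \<in> N" "N \<subseteq> S" "N \<subseteq> O'" using Q O q by (auto simp: N_def)
  have const: "dim (jet k u) = dim (jet k q)" if u: "u \<in> N" and k: "k \<le> 6" for u k
  proof (rule ccontr)
    assume "dim (jet k u) \<noteq> dim (jet k q)"
    then have "dim (jet k q) < dim (jet k u)" using Q(3)[of u k] u k by (auto simp: N_def)
    then have "r q < r u" unfolding r_def
      using Q(3)[of u] u k by (intro sum_strict_mono_ex1) (auto simp: N_def)
    then show False using max[of u] u N by auto
  qed
  have "dim (jet 6 q) \<le> 5"
  proof -
    obtain w where w: "w \<noteq> 0" "\<And>as. length as \<le> 5 \<Longrightarrow> covD_iter \<Gamma> as (Vrow \<Gamma>) q \<bullet> w = 0"
      using ker[OF q] by blast
    then have "jet 6 q \<subseteq> {x. w \<bullet> x = 0}" unfolding jet_def by (auto simp: inner_commute)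
    then have "dim (jet 6 q) \<le> dim {x. w \<bullet> x = 0}" by (rule dim_subset)
    then show ?thesis using dim_hyperplane[OF w(1)] by simp
  qed
  \<comment> \<open>Six strict increases from dimension 0 would reach 6.\<close>
  have "\<exists>k<6. dim (jet (Suc k) q) = dim (jet k q)"
  proof (rule ccontr)
    assume "\<not> ?thesis"
    moreover have "dim (jet k q) \<le> dim (jet (Suc k) q)" for k by (intro dim_subset jet_mono) simp
    ultimately have inc: "dim (jet k q) < dim (jet (Suc k) q)" if "k < 6" for k
      using that by (metis le_neq_implies_less)
    have "k \<le> dim (jet k q)" if "k \<le> 6" for k
      using that
    proof (induction k)
      case (Suc k)
      then show ?case using inc[of k] by simp
    qed simp
    then show False using \<open>dim (jet 6 q) \<le> 5\<close> by force
  qed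
  then obtain k where k: "k < 6" "dim (jet (Suc k) q) = dim (jet k q)" by blast
  have eq: "span (jet (Suc k) u) = span (jet k u)" if "u \<in> N" for u
    using dim_eq_span[OF jet_mono[of k "Suc k" u]] const[OF that, of "Suc k"] const[OF that, of k] k by simp
  have in_span: "covD_iter \<Gamma> as (Vrow \<Gamma>) u \<in> span (jet k u)" if "u \<in> N" for as u
    using that
  proof (induction as arbitrary: u)
    case Nil
    show ?case
    proof -
      have "covD_iter \<Gamma> [] (Vrow \<Gamma>) u \<in> jet (Suc k) u" unfolding jet_def by (intro imageI) simp
      then show ?thesis using eq[OF Nil] span_base by blast
    qed
  next
    case (Cons a as)
    have "covD \<Gamma> a (covD_iter \<Gamma> as (Vrow \<Gamma>)) u \<in> span (jet (Suc k) u)"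
      by (rule covD_in_span_jet[OF N(1,3) Cons.prems _ smooth_vec_jet Cons.IH])
        (use const Cons.prems k in auto)
    then show ?case using eq[OF Cons.prems] by (simp add: covD_iter_Cons)
  qed
  have "covD_iter \<Gamma> as (Vrow \<Gamma>) q \<bullet> w = 0"
    if w: "\<forall>as. length as \<le> 5 \<longrightarrow> covD_iter \<Gamma> as (Vrow \<Gamma>) q \<bullet> w = 0" for w as
  proof -
    have "span (jet k q) \<subseteq> {y. w \<bullet> y = 0}"
      using w k(1) by (intro span_minimal subspace_hyperplane) (auto simp: jet_def inner_commute)
    then show ?thesis using in_span[OF N(2), of as] by (auto simp: inner_commute)
  qed
  then show ?thesis using q by blast
qed

end

subsection \<open>Parallel sections\<close>

lemma bounded_bilinear_matrix_vector_mult: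
  "bounded_bilinear ((*v) :: real^'n^'m \<Rightarrow> real^'n \<Rightarrow> real^'m)"
proof -
  have "bilinear ((*v) :: real^'n^'m \<Rightarrow> real^'n \<Rightarrow> real^'m)"
    unfolding bilinear_def
    by (auto intro!: linearI simp: matrix_vector_mult_add_rdistrib matrix_vector_right_distrib
        matrix_vector_mult_scaleR scaleR_matrix_vector_assoc)
  then show ?thesis by (simp add: bilinear_conv_bounded_bilinear)
qed

lemma matrix_vector_mult_uminus: "A *v (- x) = - (A *v x)" for A :: "real^'n^'m"
  by (simp add: matrix_vector_mult_def sum_negf vec_eq_iff)

lemmas continuous_on_mv = bounded_bilinear.continuous_on[OF bounded_bilinear_matrix_vector_mult]
lemmas has_vector_derivative_mv = bounded_bilinear.has_vector_derivative[OF bounded_bilinear_matrix_vector_mult]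

lemma has_vector_derivative_cart:
  fixes f :: "real \<Rightarrow> 'a::real_normed_vector ^ 'n"
  assumes "\<And>i. ((\<lambda>t. f t $ i) has_vector_derivative f' $ i) (at x)"
  shows "(f has_vector_derivative f') (at x)"
proof -
  have "((\<lambda>y. (\<chi> i. (f y $ i - f x $ i - (y - x) *\<^sub>R f' $ i) /\<^sub>R norm (y - x))) \<longlongrightarrow> (\<chi> i. 0)) (at x)"
    using assms unfolding has_vector_derivative_def has_derivative_def by (intro tendsto_vec_lambda) auto
  moreover have "(\<chi> i. (f y $ i - f x $ i - (y - x) *\<^sub>R f' $ i) /\<^sub>R norm (y - x)) = (f y - f x - (y - x) *\<^sub>R f') /\<^sub>R norm (y - x)" for y
    by (simp add: vec_eq_iff)
  moreover have "(\<chi> i. 0) = (0 :: 'a ^ 'n)" by (simp add: vec_eq_iff)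
  ultimately show ?thesis unfolding has_vector_derivative_def has_derivative_def
    by (simp add: bounded_linear_scaleR_left)
qed

lemma norm_derivative_bound:
  fixes f :: "real \<Rightarrow> 'a::real_normed_vector"
  assumes "\<And>t. t \<in> T \<Longrightarrow> (f has_vector_derivative f' t) (at t)" "\<And>t. t \<in> T \<Longrightarrow> norm (f' t) \<le> B"
    and "convex T" "x \<in> T" "y \<in> T"
  shows "norm (f x - f y) \<le> B * \<bar>x - y\<bar>"
proof -
  have "norm (f x - f y) \<le> B * norm (x - y)"
  proof (rule differentiable_bound[OF assms(3) _ _ assms(4,5)])
    fix t assume t: "t \<in> T"
    show "(f has_derivative (\<lambda>h. h *\<^sub>R f' t)) (at t within T)"
      using assms(1)[OF t] by (simp add: has_vector_derivative_def has_derivative_at_withinI)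
    show "onorm (\<lambda>h. h *\<^sub>R f' t) \<le> B"
      using assms(2)[OF t] by (intro onorm_bound) (auto simp: mult.commute[of B] intro: mult_left_mono order_trans[OF norm_ge_zero])
  qed
  then show ?thesis by simp
qed

lemma segment_in_interval:
  fixes x q :: real
  assumes "x \<in> {l..h}" "q \<in> {l..h}" "0 \<le> \<tau>" "\<tau> \<le> 1"
  shows "q + \<tau> * (x - q) \<in> {l..h}"
proof -
  have "(1 - \<tau>) *\<^sub>R q + \<tau> *\<^sub>R x \<in> {l..h}" using assms by (intro convexD) auto
  then show ?thesis by (simp add: algebra_simps)
qed

lemma segment_in_open_interval:
  fixes x q :: real
  assumes "x \<in> {l<..<h}" "q \<in> {l<..<h}" "0 \<le> \<tau>" "\<tau> \<le> 1"
  shows "q + \<tau> * (x - q) \<in> {l<..<h}"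
proof -
  have "(1 - \<tau>) *\<^sub>R q + \<tau> *\<^sub>R x \<in> {l<..<h}" using assms by (intro convexD) auto
  then show ?thesis by (simp add: algebra_simps)
qed

text \<open>Integrals from \<open>q\<close> to \<open>x\<close> are rescaled to the unit interval.
  This needs no distinction between \<open>x < q\<close> and \<open>q < x\<close>, and the domain of
  integration is independent of the point.\<close>

lemma unit_integral_FTC:
  fixes k :: "real \<Rightarrow> 'a::banach"
  assumes T: "convex T" "x \<in> T" "q \<in> T"
    and \<kappa>: "\<And>x. x \<in> T \<Longrightarrow> (\<kappa> has_vector_derivative k x) (at x within T)"
  shows "(x - q) *\<^sub>R integral {0..1} (\<lambda>\<tau>. k (q + \<tau> * (x - q))) = \<kappa> x - \<kappa> q"
proof -
  have seg: "q + \<tau> * (x - q) \<in> T" if "\<tau> \<in> {0..1}" for \<tau>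
    using convexD_alt[OF T(1,3,2), of \<tau>] that by (simp add: algebra_simps)
  have "((\<lambda>\<tau>. (x - q) *\<^sub>R k (q + \<tau> * (x - q))) has_integral ((\<kappa> \<circ> (\<lambda>\<tau>. q + \<tau> * (x - q))) 1 - (\<kappa> \<circ> (\<lambda>\<tau>. q + \<tau> * (x - q))) 0)) {0..1}"
  proof (rule fundamental_theorem_of_calculus)
    fix \<tau> :: real assume \<tau>: "\<tau> \<in> {0..1}"
    show "(\<kappa> \<circ> (\<lambda>\<tau>. q + \<tau> * (x - q)) has_vector_derivative (x - q) *\<^sub>R k (q + \<tau> * (x - q))) (at \<tau> within {0..1})"
    proof (rule vector_diff_chain_within)
      show "((\<lambda>\<tau>. q + \<tau> * (x - q)) has_vector_derivative x - q) (at \<tau> within {0..1})"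
        by (auto intro!: derivative_eq_intros)
      show "(\<kappa> has_vector_derivative k (q + \<tau> * (x - q))) (at (q + \<tau> * (x - q)) within (\<lambda>\<tau>. q + \<tau> * (x - q)) ` {0..1})"
        by (rule has_vector_derivative_within_subset[OF \<kappa>[OF seg[OF \<tau>]]]) (use seg in auto)
    qed
  qed simp
  from integral_unique[OF this] show ?thesis by (simp add: o_def)
qed

lemma unit_integral_derivative:
  fixes k :: "real \<Rightarrow> 'a::banach"
  assumes k: "continuous_on {l..h} k" and q: "q \<in> {l..h}" and x: "x \<in> {l<..<h}"
  shows "((\<lambda>x. (x - q) *\<^sub>R integral {0..1} (\<lambda>\<tau>. k (q + \<tau> * (x - q)))) has_vector_derivative k x) (at x)"
proof -
  obtain \<kappa> where \<kappa>: "\<And>x. x \<in> {l..h} \<Longrightarrow> (\<kappa> has_vector_derivative k x) (at x within {l..h})"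
    using antiderivative_continuous[OF k] by blast
  have "x \<in> interior {l..h}" using x by simp
  then have "at x within {l..h} = at x" by (rule at_within_interior)
  moreover have "(\<kappa> has_vector_derivative k x) (at x within {l..h})" using x by (intro \<kappa>) simp
  ultimately have "(\<kappa> has_vector_derivative k x) (at x)" by (rule subst)
  then have "((\<lambda>x. \<kappa> x - \<kappa> q) has_vector_derivative k x) (at x)"
    by (auto intro!: derivative_eq_intros)
  then show ?thesis
  proof (rule has_vector_derivative_transform_within_open[where S = "{l<..<h}"])
    fix y assume "y \<in> {l<..<h}"
    then show "\<kappa> y - \<kappa> q = (y - q) *\<^sub>R integral {0..1} (\<lambda>\<tau>. k (q + \<tau> * (y - q)))"
      by (intro unit_integral_FTC[where T = "{l..h}", symmetric] q \<kappa>) auto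
  qed (use x in auto)
qed

abbreviation pt :: "real \<Rightarrow> real \<Rightarrow> real^2" where "pt x y \<equiv> vector [x, y]"

lemma pt_eta: "pt (z $ 1) (z $ 2) = z"
  by (simp add: vec_eq_iff forall_2)

lemma continuous_on_pt:
  assumes "continuous_on A f" "continuous_on A g"
  shows "continuous_on A (\<lambda>x. pt (f x) (g x))"
proof -
  have "pt (f x) (g x) = (\<chi> i. if i = 1 then f x else g x)" for x
    by (simp add: vec_eq_iff forall_2)
  moreover have "continuous_on A (\<lambda>x. if i = 1 then f x else g x)" for i :: 2
    using assms by (cases "i = 1") simp_all
  ultimately show ?thesis by (simp add: continuous_on_vec_lambda)
qed

lemma pt_in_box:
  "pt x y \<in> cbox lo hi \<longleftrightarrow> x \<in> {lo $ 1..hi $ 1} \<and> y \<in> {lo $ 2..hi $ 2}"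
  "pt x y \<in> box lo hi \<longleftrightarrow> x \<in> {lo $ 1<..<hi $ 1} \<and> y \<in> {lo $ 2<..<hi $ 2}"
  by (auto simp: mem_box_cart forall_2)

text \<open>A fixed point of \<open>G\<close> is parallel along the horizontal line through \<open>q\<close> and along all vertical lines.\<close>

lemma transport_fixed_point:
  fixes M1 M2 :: "real^2 \<Rightarrow> real^6^6" and q lo hi :: "real^2" and w :: "real^6"
  assumes M: "continuous_on (cbox lo hi) M1" "continuous_on (cbox lo hi) M2"
    and b: "\<And>z v. z \<in> cbox lo hi \<Longrightarrow> norm (M1 z *v v) \<le> K * norm v"
      "\<And>z v. z \<in> cbox lo hi \<Longrightarrow> norm (M2 z *v v) \<le> K * norm v"
    and K: "K \<ge> 0" and d: "hi $ 1 - lo $ 1 \<le> d" "hi $ 2 - lo $ 2 \<le> d" "d * K \<le> 1/4"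
    and q: "q \<in> cbox lo hi"
  defines "G \<equiv> (\<lambda>\<Phi> z. w - (z $ 1 - q $ 1) *\<^sub>R integral {0..1} (\<lambda>\<tau>. M1 (pt (q $ 1 + \<tau> * (z $ 1 - q $ 1)) (q $ 2)) *v \<Phi> (pt (q $ 1 + \<tau> * (z $ 1 - q $ 1)) (q $ 2)))
      - (z $ 2 - q $ 2) *\<^sub>R integral {0..1} (\<lambda>\<tau>. M2 (pt (z $ 1) (q $ 2 + \<tau> * (z $ 2 - q $ 2))) *v \<Phi> (pt (z $ 1) (q $ 2 + \<tau> * (z $ 2 - q $ 2)))))"
  shows "\<exists>\<Phi>. continuous_on (cbox lo hi) \<Phi> \<and> (\<forall>z\<in>cbox lo hi. \<Phi> z = G \<Phi> z \<and> norm (\<Phi> z) \<le> 2 * norm w)"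
proof -
  let ?Q = "cbox lo hi"
  let ?h1 = "\<lambda>z \<tau>. pt (q $ 1 + \<tau> * (z $ 1 - q $ 1)) (q $ 2)"
  let ?h2 = "\<lambda>z \<tau>. pt (z $ 1) (q $ 2 + \<tau> * (z $ 2 - q $ 2))"
  have h1: "?h1 z \<tau> \<in> ?Q" and h2: "?h2 z \<tau> \<in> ?Q" if "z \<in> ?Q" "\<tau> \<in> {0..1}" for z \<tau>
    using that q segment_in_interval[of "z $ 1" "lo $ 1" "hi $ 1" "q $ 1" \<tau>]
      segment_in_interval[of "z $ 2" "lo $ 2" "hi $ 2" "q $ 2" \<tau>]
    by (auto simp: pt_in_box mem_box_cart forall_2)
  have ch1: "continuous_on (?Q \<times> {0..1}) (\<lambda>u. ?h1 (fst u) (snd u))"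
    and ch2: "continuous_on (?Q \<times> {0..1}) (\<lambda>u. ?h2 (fst u) (snd u))"
    by (intro continuous_on_pt continuous_intros)+
  have c1: "continuous_on (?Q \<times> {0..1}) (\<lambda>u. M1 (?h1 (fst u) (snd u)) *v \<Phi> (?h1 (fst u) (snd u)))"
    and c2: "continuous_on (?Q \<times> {0..1}) (\<lambda>u. M2 (?h2 (fst u) (snd u)) *v \<Phi> (?h2 (fst u) (snd u)))"
    if "continuous_on ?Q \<Phi>" for \<Phi> :: "real^2 \<Rightarrow> real^6"
    by (intro continuous_on_mv continuous_on_compose2[OF M(1) ch1] continuous_on_compose2[OF that ch1]
        continuous_on_compose2[OF M(2) ch2] continuous_on_compose2[OF that ch2]; use h1 h2 in force)+
  have s1: "continuous_on {0..1} (\<lambda>\<tau>. M1 (?h1 z \<tau>) *v \<Phi> (?h1 z \<tau>))"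
    and s2: "continuous_on {0..1} (\<lambda>\<tau>. M2 (?h2 z \<tau>) *v \<Phi> (?h2 z \<tau>))"
    if "continuous_on ?Q \<Phi>" "z \<in> ?Q" for \<Phi> :: "real^2 \<Rightarrow> real^6" and z
  proof -
    have cp: "continuous_on {0..1} (\<lambda>\<tau>. (z, \<tau> :: real))" by (intro continuous_intros)
    show "continuous_on {0..1} (\<lambda>\<tau>. M1 (?h1 z \<tau>) *v \<Phi> (?h1 z \<tau>))"
      using continuous_on_compose2[OF c1[OF that(1)] cp] that(2) by auto
    show "continuous_on {0..1} (\<lambda>\<tau>. M2 (?h2 z \<tau>) *v \<Phi> (?h2 z \<tau>))"
      using continuous_on_compose2[OF c2[OF that(1)] cp] that(2) by auto
  qed
  have Gc: "continuous_on ?Q (G \<Phi>)" if "continuous_on ?Q \<Phi>" for \<Phi>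
  proof -
    have "continuous_on ?Q (\<lambda>z. integral (cbox 0 1) (\<lambda>\<tau>. M1 (?h1 z \<tau>) *v \<Phi> (?h1 z \<tau>)))"
      "continuous_on ?Q (\<lambda>z. integral (cbox 0 1) (\<lambda>\<tau>. M2 (?h2 z \<tau>) *v \<Phi> (?h2 z \<tau>)))"
      using c1[OF that] c2[OF that] by (intro integral_continuous_on_param; simp add: case_prod_unfold)+
    then show ?thesis unfolding G_def by (intro continuous_intros) (simp_all add: cbox_interval)
  qed
  have small: "\<bar>z $ i - q $ i\<bar> \<le> d" if "z \<in> ?Q" for z and i :: 2
    using that q d exhaust_2[of i] by (auto simp: mem_box_cart forall_2)
  have d0: "d \<ge> 0" using small[OF q, of 1] by simp
  \<comment> \<open>Each of the two integrals contributes a quarter, by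
    \<open>d * K \<le> 1/4\<close>; together they give the contraction factor 1/2.\<close>
  have half: "norm (u *\<^sub>R integral {0..1} f) \<le> E / 4"
    if "\<bar>u\<bar> \<le> d" "continuous_on {0..1} f" "\<And>\<tau>. \<tau> \<in> {0..1} \<Longrightarrow> norm (f \<tau>) \<le> K * E" "E \<ge> 0"
    for u E and f :: "real \<Rightarrow> real^6"
  proof -
    have "norm (integral {0..1} f) \<le> K * E"
      using integral_bound[of 0 1 f "K * E"] that by simp
    then have "norm (u *\<^sub>R integral {0..1} f) \<le> d * (K * E)"
      using that(1) d0 by (simp add: mult_mono)
    also have "\<dots> \<le> E / 4" using mult_right_mono[OF d(3) that(4)] by simp
    finally show ?thesis .
  qed
  have lip: "norm (G \<Phi> z - G \<Phi>' z) \<le> E / 2"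
    if c: "continuous_on ?Q \<Phi>" "continuous_on ?Q \<Phi>'" and z: "z \<in> ?Q"
      and E: "\<And>u. u \<in> ?Q \<Longrightarrow> norm (\<Phi> u - \<Phi>' u) \<le> E" for \<Phi> \<Phi>' z E
  proof -
    have E0: "E \<ge> 0" using E[OF z] norm_ge_zero order_trans by blast
    let ?f1 = "\<lambda>\<tau>. M1 (?h1 z \<tau>) *v (\<Phi> (?h1 z \<tau>) - \<Phi>' (?h1 z \<tau>))"
    let ?f2 = "\<lambda>\<tau>. M2 (?h2 z \<tau>) *v (\<Phi> (?h2 z \<tau>) - \<Phi>' (?h2 z \<tau>))"
    have cd: "continuous_on ?Q (\<lambda>u. \<Phi> u - \<Phi>' u)" using c by (intro continuous_intros)
    have i1: "integral {0..1} ?f1 = integral {0..1} (\<lambda>\<tau>. M1 (?h1 z \<tau>) *v \<Phi> (?h1 z \<tau>)) - integral {0..1} (\<lambda>\<tau>. M1 (?h1 z \<tau>) *v \<Phi>' (?h1 z \<tau>))"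
      by (subst integral_diff[symmetric])
        (use s1[OF c(1) z] s1[OF c(2) z] in \<open>auto intro: integrable_continuous_real simp: matrix_vector_mult_diff_distrib\<close>)
    have i2: "integral {0..1} ?f2 = integral {0..1} (\<lambda>\<tau>. M2 (?h2 z \<tau>) *v \<Phi> (?h2 z \<tau>)) - integral {0..1} (\<lambda>\<tau>. M2 (?h2 z \<tau>) *v \<Phi>' (?h2 z \<tau>))"
      by (subst integral_diff[symmetric])
        (use s2[OF c(1) z] s2[OF c(2) z] in \<open>auto intro: integrable_continuous_real simp: matrix_vector_mult_diff_distrib\<close>)
    have "G \<Phi> z - G \<Phi>' z = - ((z $ 1 - q $ 1) *\<^sub>R integral {0..1} ?f1) - (z $ 2 - q $ 2) *\<^sub>R integral {0..1} ?f2"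
      unfolding G_def i1 i2 by (simp add: algebra_simps)
    also have "norm \<dots> \<le> E / 4 + E / 4"
    proof (rule norm_triangle_le_diff, unfold norm_minus_cancel, rule add_mono)
      show "norm ((z $ 1 - q $ 1) *\<^sub>R integral {0..1} ?f1) \<le> E / 4"
        by (rule half[OF small[OF z] s1[OF cd z] _ E0])
          (rule order_trans[OF b(1)[OF h1[OF z]] mult_left_mono[OF E[OF h1[OF z]] K]])
      show "norm ((z $ 2 - q $ 2) *\<^sub>R integral {0..1} ?f2) \<le> E / 4"
        by (rule half[OF small[OF z] s2[OF cd z] _ E0])
          (rule order_trans[OF b(2)[OF h2[OF z]] mult_left_mono[OF E[OF h2[OF z]] K]])
    qed
    finally show ?thesis by simp
  qed
  have lohi: "\<And>i. i \<in> Basis \<Longrightarrow> lo \<bullet> i \<le> hi \<bullet> i" using q order_trans unfolding mem_box by blast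
  \<comment> \<open>The fixed point theorem is applied in the complete space of bounded continuous
    functions on the whole plane; \<open>clamp\<close> extends a function on the box by its values
    at the nearest points.\<close>
  have "\<exists>g :: (real^2) \<Rightarrow>\<^sub>C (real^6). \<forall>x. g x = G (apply_bcontfun f) (clamp lo hi x)" for f :: "(real^2) \<Rightarrow>\<^sub>C (real^6)"
    using continuous_on_cbox_bcontfunE[OF Gc[OF continuous_on_apply_bcontfun[of _ f]]] by metis
  then obtain T :: "((real^2) \<Rightarrow>\<^sub>C (real^6)) \<Rightarrow> ((real^2) \<Rightarrow>\<^sub>C (real^6))"
    where T: "\<And>f x. T f x = G (apply_bcontfun f) (clamp lo hi x)" by metis
  have "\<exists>!f. T f = f"
  proof (rule banach_fix_type[of "1/2"])
    show "\<forall>f g. dist (T f) (T g) \<le> 1/2 * dist f g"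
    proof (intro allI dist_bound)
      fix f g x
      have "norm (G (apply_bcontfun f) (clamp lo hi x) - G (apply_bcontfun g) (clamp lo hi x)) \<le> dist f g / 2"
        using dist_bounded[of f _ g]
        by (intro lip continuous_on_apply_bcontfun clamp_in_interval lohi) (auto simp: dist_norm)
      then show "dist (T f x) (T g x) \<le> 1/2 * dist f g" by (simp add: T dist_norm)
    qed
  qed auto
  then obtain \<Phi> where \<Phi>: "T \<Phi> = \<Phi>" by blast
  have fp: "\<Phi> z = G (apply_bcontfun \<Phi>) z" if "z \<in> ?Q" for z
    using T[of \<Phi> z] that unfolding \<Phi> by simp
  have "norm (\<Phi> z) \<le> 2 * norm w" if z: "z \<in> ?Q" for z
  proof -
    \<comment> \<open>Comparison with the zero function, which \<open>G\<close> sends to the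
      constant \<open>w\<close>: the supremum \<open>m\<close> satisfies m <= |w| + m/2.\<close>
    have G0: "G (\<lambda>_. 0) u = w" for u unfolding G_def by simp
    define m where "m = (SUP u\<in>?Q. norm (\<Phi> u))"
    have bdd: "bdd_above ((\<lambda>u. norm (\<Phi> u)) ` ?Q)"
      using norm_bounded[of \<Phi>] by (intro bdd_aboveI2) blast
    have le: "norm (\<Phi> u) \<le> m" if "u \<in> ?Q" for u unfolding m_def using that bdd by (rule cSUP_upper)
    have "norm (\<Phi> u) \<le> norm w + m / 2" if u: "u \<in> ?Q" for u
    proof -
      have "norm (G (apply_bcontfun \<Phi>) u - G (\<lambda>_. 0) u) \<le> m / 2"
        by (rule lip) (use u le in auto)
      then show ?thesis using norm_triangle_sub[of "\<Phi> u" w] fp[OF u] G0[of u] by simp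
    qed
    then have "m \<le> norm w + m / 2" unfolding m_def using z by (intro cSUP_least) auto
    then show ?thesis using le[OF z] by simp
  qed
  then show ?thesis using fp continuous_on_apply_bcontfun[of ?Q \<Phi>] by blast
qed


text \<open>\<open>\<Theta>\<close> transports \<open>\<Phi>\<close> horizontally from the line \<open>x = q $ 1\<close>; by flatness \<open>\<Phi> - \<Theta>\<close> satisfies a
  homogeneous integral equation, so it vanishes on a small box. This avoids differentiating a
  solution of an ODE with respect to a parameter.\<close>

lemma transport_is_parallel:
  fixes M1 M2 dM1 dM2 :: "real^2 \<Rightarrow> real^6^6" and \<Phi> :: "real^2 \<Rightarrow> real^6" and q lo hi :: "real^2"
  assumes M: "continuous_on (cbox lo hi) M1" "continuous_on (cbox lo hi) M2"
    and dM: "continuous_on (box lo hi) dM1" "continuous_on (box lo hi) dM2"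
    and D2: "\<And>x y. pt x y \<in> box lo hi \<Longrightarrow> ((\<lambda>s. M2 (pt s y)) has_vector_derivative dM2 (pt x y)) (at x)"
    and D1: "\<And>x y. pt x y \<in> box lo hi \<Longrightarrow> ((\<lambda>t. M1 (pt x t)) has_vector_derivative dM1 (pt x y)) (at y)"
    and b: "\<And>z v. z \<in> cbox lo hi \<Longrightarrow> norm (M1 z *v v) \<le> K * norm v"
      "\<And>z v. z \<in> cbox lo hi \<Longrightarrow> norm (M2 z *v v) \<le> K * norm v"
      "\<And>z v. z \<in> box lo hi \<Longrightarrow> norm (dM2 z *v v) \<le> K * norm v"
    and K: "K \<ge> 0" and d: "hi $ 1 - lo $ 1 \<le> d" "hi $ 2 - lo $ 2 \<le> d" "d * K \<le> 1/4" "d \<le> 1"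
    and q: "q \<in> box lo hi" and \<Phi>c: "continuous_on (cbox lo hi) \<Phi>"
    and vert: "\<And>x y. pt x y \<in> box lo hi \<Longrightarrow> ((\<lambda>t. \<Phi> (pt x t)) has_vector_derivative - (M2 (pt x y) *v \<Phi> (pt x y))) (at y)"
    and hor: "\<And>x. x \<in> {lo $ 1<..<hi $ 1} \<Longrightarrow> \<Phi> (pt x (q $ 2)) = \<Phi> q -
        (x - q $ 1) *\<^sub>R integral {0..1} (\<lambda>\<tau>. M1 (pt (q $ 1 + \<tau> * (x - q $ 1)) (q $ 2)) *v \<Phi> (pt (q $ 1 + \<tau> * (x - q $ 1)) (q $ 2)))"
    and flat: "\<And>z. z \<in> box lo hi \<Longrightarrow>
        dM2 z *v \<Phi> z - dM1 z *v \<Phi> z + M1 z *v (M2 z *v \<Phi> z) - M2 z *v (M1 z *v \<Phi> z) = 0"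
    and xy: "pt x y \<in> box lo hi"
  shows "((\<lambda>s. \<Phi> (pt s y)) has_vector_derivative - (M1 (pt x y) *v \<Phi> (pt x y))) (at x)"
proof -
  define I1 where "I1 = {lo $ 1<..<hi $ 1}"
  define I2 where "I2 = {lo $ 2<..<hi $ 2}"
  define x0 where "x0 = q $ 1"
  define y0 where "y0 = q $ 2"
  define g where "g x \<tau> = x0 + \<tau> * (x - x0)" for x \<tau> :: real
  have B: "pt s t \<in> box lo hi \<longleftrightarrow> s \<in> I1 \<and> t \<in> I2" for s t
    by (simp add: pt_in_box I1_def I2_def)
  have Q: "pt s t \<in> cbox lo hi" if "s \<in> I1" "t \<in> I2" for s t
    using that B box_subset_cbox by blast
  have x0: "x0 \<in> I1" and y0: "y0 \<in> I2" and qpt: "q = pt x0 y0"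
    using q B[of x0 y0] by (simp_all add: x0_def y0_def pt_eta)
  have I: "open I1" "convex I1" "open I2" "convex I2" by (simp_all add: I1_def I2_def)
  have g: "g s \<tau> \<in> I1" if "s \<in> I1" "\<tau> \<in> {0..1}" for s \<tau>
    using segment_in_open_interval[of s "lo $ 1" "hi $ 1" x0 \<tau>] that x0 by (simp add: I1_def g_def)
  define k1 where "k1 s t = M1 (pt s t) *v \<Phi> (pt s t)" for s t
  define \<Theta> where "\<Theta> s t = \<Phi> (pt x0 t) - (s - x0) *\<^sub>R integral {0..1} (\<lambda>\<tau>. k1 (g s \<tau>) t)" for s t
  \<comment> \<open>The vertical derivative of \<open>k1\<close>, by the vertical transport
    equation. Flatness gives it the second form \<open>H'\<close>, without a derivative of
    \<open>M1\<close>.\<close>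
  define H where "H s t = dM1 (pt s t) *v \<Phi> (pt s t) - M1 (pt s t) *v (M2 (pt s t) *v \<Phi> (pt s t))" for s t
  have H': "H s t = dM2 (pt s t) *v \<Phi> (pt s t) - M2 (pt s t) *v (M1 (pt s t) *v \<Phi> (pt s t))"
    if "s \<in> I1" "t \<in> I2" for s t
    using flat[of "pt s t"] that B unfolding H_def by (simp add: algebra_simps)
  have cB: "continuous_on (box lo hi) M1" "continuous_on (box lo hi) M2" "continuous_on (box lo hi) \<Phi>"
    using M \<Phi>c box_subset_cbox by (auto intro: continuous_on_subset)
  have chor: "continuous_on I1 (\<lambda>s. pt s t)" for t by (intro continuous_on_pt continuous_intros)
  have ctau: "continuous_on {0..1} (\<lambda>\<tau>. g s \<tau>)" for s unfolding g_def by (intro continuous_intros)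
  have comp: "continuous_on I1 (\<lambda>s. F (pt s t))" if "continuous_on (box lo hi) F" "t \<in> I2"
    for F :: "real^2 \<Rightarrow> 'a::topological_space" and t
    by (rule continuous_on_compose2[OF that(1) chor]) (use that B in auto)
  have \<Theta>x: "((\<lambda>s. \<Theta> s t) has_vector_derivative - k1 s t) (at s)" if "s \<in> I1" "t \<in> I2" for s t
  proof -
    have "continuous_on {lo $ 1..hi $ 1} (\<lambda>s. k1 s t)"
      unfolding k1_def using that(2)
      by (intro continuous_on_mv continuous_on_compose2[OF M(1)] continuous_on_compose2[OF \<Phi>c] continuous_on_pt continuous_intros)
        (auto simp: pt_in_box I2_def)
    from unit_integral_derivative[OF this, of x0 s]
    have "((\<lambda>s. (s - x0) *\<^sub>R integral {0..1} (\<lambda>\<tau>. k1 (g s \<tau>) t)) has_vector_derivative k1 s t) (at s)"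
      using that(1) x0 by (simp add: I1_def g_def)
    from has_vector_derivative_diff[OF has_vector_derivative_const this] show ?thesis
      unfolding \<Theta>_def by simp
  qed
  have k1y: "((\<lambda>t. k1 s t) has_vector_derivative H s t) (at t)" if "s \<in> I1" "t \<in> I2" for s t
    using has_vector_derivative_mv[OF D1 vert, of s t] that B
    unfolding k1_def[abs_def] H_def by (simp add: matrix_vector_mult_uminus algebra_simps)
  have contH: "continuous_on (box lo hi) (\<lambda>z. H (z $ 1) (z $ 2))"
    unfolding H_def pt_eta by (intro continuous_on_mv continuous_on_diff dM cB)
  have contHs: "continuous_on I1 (\<lambda>s. H s t)" if "t \<in> I2" for t
    using comp[OF contH that] by simp
  have \<Theta>y: "((\<lambda>t. \<Theta> s t) has_vector_derivative - (M2 (pt x0 t) *v \<Phi> (pt x0 t)) - (s - x0) *\<^sub>R integral {0..1} (\<lambda>\<tau>. H (g s \<tau>) t)) (at t)"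
    if s: "s \<in> I1" and t: "t \<in> I2" for s t
  proof -
    have "((\<lambda>t. integral (cbox 0 1) (\<lambda>\<tau>. k1 (g s \<tau>) t)) has_vector_derivative integral (cbox 0 1) (\<lambda>\<tau>. H (g s \<tau>) t)) (at t within I2)"
    proof (rule leibniz_rule_vector_derivative[where f = "\<lambda>t \<tau>. k1 (g s \<tau>) t" and fx = "\<lambda>t \<tau>. H (g s \<tau>) t"])
      fix t \<tau> assume *: "t \<in> I2" "\<tau> \<in> cbox 0 (1::real)"
      show "((\<lambda>t. k1 (g s \<tau>) t) has_vector_derivative H (g s \<tau>) t) (at t within I2)"
        by (rule has_vector_derivative_at_within[OF k1y]) (use * g[OF s] in auto)
    next
      fix t assume t: "t \<in> I2"
      have "continuous_on I1 (\<lambda>s. k1 s t)"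
        unfolding k1_def by (intro continuous_on_mv comp cB t)
      then have "continuous_on {0..1} (\<lambda>\<tau>. k1 (g s \<tau>) t)"
        by (rule continuous_on_compose2[OF _ ctau]) (use g[OF s] in auto)
      then show "(\<lambda>\<tau>. k1 (g s \<tau>) t) integrable_on cbox 0 1" by (simp add: integrable_continuous_real)
    next
      have "continuous_on (I2 \<times> cbox 0 1) (\<lambda>u. pt (g s (snd u)) (fst u))"
        unfolding g_def by (intro continuous_on_pt continuous_intros)
      from continuous_on_compose2[OF contH this]
      show "continuous_on (I2 \<times> cbox 0 1) (\<lambda>(t, \<tau>). H (g s \<tau>) t)"
        using g[OF s] B by (force simp: case_prod_unfold)
    qed (use t I in auto)
    then have "((\<lambda>t. integral {0..1} (\<lambda>\<tau>. k1 (g s \<tau>) t)) has_vector_derivative integral {0..1} (\<lambda>\<tau>. H (g s \<tau>) t)) (at t)"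
      using at_within_open[OF t I(3)] by (simp add: cbox_interval)
    then have "((\<lambda>t. (s - x0) *\<^sub>R integral {0..1} (\<lambda>\<tau>. k1 (g s \<tau>) t)) has_vector_derivative (s - x0) *\<^sub>R integral {0..1} (\<lambda>\<tau>. H (g s \<tau>) t)) (at t)"
      by (rule bounded_linear.has_vector_derivative[OF bounded_linear_scaleR_right])
    from has_vector_derivative_diff[OF vert this] show ?thesis
      unfolding \<Theta>_def using x0 t B by simp
  qed
  define Z where "Z s t = \<Phi> (pt s t) - \<Theta> s t" for s t
  have \<Theta>0: "\<Theta> x0 t = \<Phi> (pt x0 t)" for t by (simp add: \<Theta>_def)
  have Zc: "continuous_on I1 (\<lambda>s. Z s t)" and \<Theta>c: "continuous_on I1 (\<lambda>s. \<Theta> s t)" if t: "t \<in> I2" for t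
  proof -
    have "isCont (\<lambda>s. \<Theta> s t) s" if "s \<in> I1" for s
      using \<Theta>x[OF that t] by (rule has_vector_derivative_continuous)
    then show "continuous_on I1 (\<lambda>s. \<Theta> s t)" by (simp add: continuous_at_imp_continuous_on)
    then show "continuous_on I1 (\<lambda>s. Z s t)"
      unfolding Z_def by (intro continuous_on_diff comp cB t)
  qed
  have Zy: "((\<lambda>t. Z s t) has_vector_derivative - (M2 (pt s t) *v Z s t) + (s - x0) *\<^sub>R integral {0..1} (\<lambda>\<tau>. dM2 (pt (g s \<tau>) t) *v Z (g s \<tau>) t)) (at t)"
    if s: "s \<in> I1" and t: "t \<in> I2" for s t
  proof -
    \<comment> \<open>The horizontal derivative of \<open>M2\<close> applied to
      \<open>\<Theta>\<close>. Integrating it moves the term at \<open>x0\<close> to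
      \<open>s\<close>, and subtracting it from \<open>H\<close> leaves only \<open>dM2\<close>
      applied to \<open>Z\<close>, which makes the equation for \<open>Z\<close>
      homogeneous.\<close>
    define k where "k s = M2 (pt s t) *v (- k1 s t) + dM2 (pt s t) *v \<Theta> s t" for s
    have "(s - x0) *\<^sub>R integral {0..1} (\<lambda>\<tau>. k (x0 + \<tau> * (s - x0))) = M2 (pt s t) *v \<Theta> s t - M2 (pt x0 t) *v \<Theta> x0 t"
    proof (rule unit_integral_FTC[OF I(2) s x0])
      fix s assume s: "s \<in> I1"
      show "((\<lambda>s. M2 (pt s t) *v \<Theta> s t) has_vector_derivative k s) (at s within I1)"
        unfolding k_def
        by (rule has_vector_derivative_at_within[OF has_vector_derivative_mv[OF D2 \<Theta>x]]) (use s t B in auto)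
    qed
    then have ftc: "M2 (pt x0 t) *v \<Phi> (pt x0 t) = M2 (pt s t) *v \<Theta> s t - (s - x0) *\<^sub>R integral {0..1} (\<lambda>\<tau>. k (g s \<tau>))"
      by (simp add: \<Theta>0 g_def algebra_simps)
    have ck: "continuous_on I1 k"
      unfolding k_def k1_def by (intro continuous_on_add continuous_on_mv continuous_on_minus comp cB dM \<Theta>c t)
    have int: "(\<lambda>\<tau>. F (g s \<tau>)) integrable_on {0..1}" if "continuous_on I1 F" for F :: "real \<Rightarrow> real^6"
      by (intro integrable_continuous_real continuous_on_compose2[OF that ctau]) (use g[OF s] in auto)
    have "integral {0..1} (\<lambda>\<tau>. H (g s \<tau>) t) - integral {0..1} (\<lambda>\<tau>. k (g s \<tau>)) = integral {0..1} (\<lambda>\<tau>. H (g s \<tau>) t - k (g s \<tau>))"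
      by (intro integral_diff[symmetric] int contHs ck t)
    also have "\<dots> = integral {0..1} (\<lambda>\<tau>. dM2 (pt (g s \<tau>) t) *v Z (g s \<tau>) t)"
    proof (rule integral_cong)
      fix \<tau> :: real assume "\<tau> \<in> {0..1}"
      then have "g s \<tau> \<in> I1" by (rule g[OF s])
      then show "H (g s \<tau>) t - k (g s \<tau>) = dM2 (pt (g s \<tau>) t) *v Z (g s \<tau>) t"
        using H'[OF _ t, of "g s \<tau>"] by (simp add: k_def k1_def Z_def matrix_vector_mult_diff_distrib matrix_vector_mult_uminus)
    qed
    finally have eq: "integral {0..1} (\<lambda>\<tau>. H (g s \<tau>) t) = integral {0..1} (\<lambda>\<tau>. k (g s \<tau>)) + integral {0..1} (\<lambda>\<tau>. dM2 (pt (g s \<tau>) t) *v Z (g s \<tau>) t)"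
      by (simp add: algebra_simps)
    have "((\<lambda>t. Z s t) has_vector_derivative - (M2 (pt s t) *v \<Phi> (pt s t)) - (- (M2 (pt x0 t) *v \<Phi> (pt x0 t)) - (s - x0) *\<^sub>R integral {0..1} (\<lambda>\<tau>. H (g s \<tau>) t))) (at t)"
      unfolding Z_def by (rule has_vector_derivative_diff[OF vert \<Theta>y[OF s t]]) (use s t B in auto)
    moreover have "- (M2 (pt s t) *v \<Phi> (pt s t)) - (- (M2 (pt x0 t) *v \<Phi> (pt x0 t)) - (s - x0) *\<^sub>R integral {0..1} (\<lambda>\<tau>. H (g s \<tau>) t))
      = - (M2 (pt s t) *v Z s t) + (s - x0) *\<^sub>R integral {0..1} (\<lambda>\<tau>. dM2 (pt (g s \<tau>) t) *v Z (g s \<tau>) t)"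
      unfolding ftc eq Z_def by (simp add: matrix_vector_mult_diff_distrib algebra_simps)
    ultimately show ?thesis by simp
  qed
  have Z0: "Z s y0 = 0" if "s \<in> I1" for s
    using hor[of s] that qpt unfolding Z_def \<Theta>_def k1_def g_def by (simp add: I1_def x0_def[symmetric] y0_def[symmetric])
  have small: "\<bar>s - x0\<bar> \<le> d" "\<bar>t - y0\<bar> \<le> d" if "s \<in> I1" "t \<in> I2" for s t
    using that x0 y0 d by (auto simp: I1_def I2_def)
  have d0: "d \<ge> 0" using small[OF x0 y0] by simp
  obtain C where C: "\<And>z. z \<in> cbox lo hi \<Longrightarrow> norm (\<Phi> z) \<le> C"
    using compact_imp_bounded[OF compact_continuous_image[OF \<Phi>c compact_cbox]] by (auto simp: bounded_iff)
  have C0: "C \<ge> 0" using C[OF Q[OF x0 y0]] norm_ge_zero order_trans by blast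
  have norm_int: "norm ((s - x0) *\<^sub>R integral {0..1} (\<lambda>\<tau>. F (g s \<tau>))) \<le> d * E"
    if "s \<in> I1" "continuous_on I1 F" "\<And>u. u \<in> I1 \<Longrightarrow> norm (F u) \<le> E" for s E and F :: "real \<Rightarrow> real^6"
  proof -
    have "norm (integral {0..1} (\<lambda>\<tau>. F (g s \<tau>))) \<le> E * (1 - 0)"
      by (rule integral_bound) (use g[OF that(1)] that in \<open>auto intro!: continuous_on_compose2[OF that(2) ctau]\<close>)
    then show ?thesis using small(1)[OF that(1) y0] d0 by (simp add: mult_mono)
  qed
  have Zbound: "norm (Z s t) \<le> C + (C + d * (K * C))" if "s \<in> I1" "t \<in> I2" for s t
  proof -
    have "norm ((s - x0) *\<^sub>R integral {0..1} (\<lambda>\<tau>. k1 (g s \<tau>) t)) \<le> d * (K * C)"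
    proof (rule norm_int[OF that(1), of "\<lambda>u. k1 u t"])
      show "continuous_on I1 (\<lambda>u. k1 u t)" unfolding k1_def by (intro continuous_on_mv comp cB that)
      fix u assume "u \<in> I1"
      then have u: "pt u t \<in> cbox lo hi" using Q that by blast
      show "norm (k1 u t) \<le> K * C"
        unfolding k1_def by (rule order_trans[OF b(1)[OF u] mult_left_mono[OF C[OF u] K]])
    qed
    then have "norm (\<Theta> s t) \<le> C + d * (K * C)"
      unfolding \<Theta>_def using C[OF Q[OF x0 that(2)]] by (intro norm_triangle_le_diff add_mono)
    then show ?thesis unfolding Z_def using C[OF Q[OF that]] by (intro norm_triangle_le_diff add_mono)
  qed
  define m where "m = (SUP u\<in>I1 \<times> I2. norm (Z (fst u) (snd u)))"
  have bdd: "bdd_above ((\<lambda>u. norm (Z (fst u) (snd u))) ` (I1 \<times> I2))"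
    using Zbound by (intro bdd_aboveI2[where M = "C + (C + d * (K * C))"]) auto
  have le: "norm (Z s t) \<le> m" if "s \<in> I1" "t \<in> I2" for s t
    unfolding m_def using cSUP_upper[OF _ bdd, of "(s, t)"] that by simp
  have m0: "m \<ge> 0" using le[OF x0 y0] norm_ge_zero order_trans by blast
  have "norm (Z s t) \<le> m / 2" if s: "s \<in> I1" and t: "t \<in> I2" for s t
  proof -
    have "norm (Z s t - Z s y0) \<le> (K * m + d * (K * m)) * \<bar>t - y0\<bar>"
    proof (rule norm_derivative_bound[OF Zy[OF s] _ I(4) t y0])
      fix t assume t: "t \<in> I2"
      have "norm (- (M2 (pt s t) *v Z s t)) \<le> K * m"
        using order_trans[OF b(2)[OF Q[OF s t]] mult_left_mono[OF le[OF s t] K]] by simp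
      moreover have "norm ((s - x0) *\<^sub>R integral {0..1} (\<lambda>\<tau>. dM2 (pt (g s \<tau>) t) *v Z (g s \<tau>) t)) \<le> d * (K * m)"
      proof (rule norm_int[OF s, of "\<lambda>u. dM2 (pt u t) *v Z u t"])
        show "continuous_on I1 (\<lambda>u. dM2 (pt u t) *v Z u t)" by (intro continuous_on_mv comp dM Zc t)
        fix u assume u: "u \<in> I1"
        then have "pt u t \<in> box lo hi" using B t by blast
        then show "norm (dM2 (pt u t) *v Z u t) \<le> K * m"
          by (rule order_trans[OF b(3) mult_left_mono[OF le[OF u t] K]])
      qed
      ultimately show "norm (- (M2 (pt s t) *v Z s t) + (s - x0) *\<^sub>R integral {0..1} (\<lambda>\<tau>. dM2 (pt (g s \<tau>) t) *v Z (g s \<tau>) t)) \<le> K * m + d * (K * m)"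
        by (intro norm_triangle_le add_mono)
    qed
    \<comment> \<open>By \<open>d \<le> 1\<close> the rate of change of \<open>Z\<close> is at most
      2 K m, over a vertical distance at most \<open>d\<close>; with \<open>d * K \<le> 1/4\<close>
      this is half of \<open>m\<close>.\<close>
    also have "\<dots> \<le> (K * m + 1 * (K * m)) * d"
      using small(2)[OF s t] d(4) K m0 d0 by (intro mult_mono add_mono) auto
    also have "\<dots> = 2 * (d * K) * m" by (simp add: algebra_simps)
    also have "\<dots> \<le> 2 * (1/4) * m" using d(3) m0 by (intro mult_right_mono) auto
    finally show ?thesis using Z0[OF s] by simp
  qed
  then have "m \<le> m / 2" unfolding m_def using x0 y0 by (intro cSUP_least) auto
  then have "m = 0" using m0 by simp
  then have "\<Phi> (pt s t) = \<Theta> s t" if "s \<in> I1" "t \<in> I2" for s t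
    using le[OF that] unfolding Z_def by simp
  then have eq: "\<Theta> s y = \<Phi> (pt s y)" if "s \<in> I1" for s using that xy B by simp
  have "((\<lambda>s. \<Theta> s y) has_vector_derivative - k1 x y) (at x)" using \<Theta>x xy B by blast
  then have "((\<lambda>s. \<Phi> (pt s y)) has_vector_derivative - k1 x y) (at x)"
    by (rule has_vector_derivative_transform_within_open[OF _ I(1)]) (use xy B eq in auto)
  then show ?thesis by (simp add: k1_def)
qed

section \<open>From derivatives along coordinate lines to derivatives in the plane\<close>

lemma line_pt: "z + t *\<^sub>R axis 1 1 = pt (z $ 1 + t) (z $ 2)" "z + t *\<^sub>R axis 2 1 = pt (z $ 1) (z $ 2 + t)"
  for t :: real
  by (simp_all add: vec_eq_iff forall_2 axis_def)

lemma has_vector_derivative_shift_0: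
  "((\<lambda>t. f (x + t)) has_vector_derivative D) (at 0) \<longleftrightarrow> (f has_vector_derivative D) (at (x::real))"
proof
  assume "(f has_vector_derivative D) (at x)"
  moreover have "((\<lambda>t. x + t) has_vector_derivative 1) (at 0)" by (auto intro!: derivative_eq_intros)
  ultimately show "((\<lambda>t. f (x + t)) has_vector_derivative D) (at 0)"
    using vector_diff_chain_at[of "\<lambda>t. x + t" 1 0 f D] by (simp add: o_def)
next
  assume "((\<lambda>t. f (x + t)) has_vector_derivative D) (at 0)"
  moreover have "((\<lambda>s. s - x) has_vector_derivative 1) (at x)" by (auto intro!: derivative_eq_intros)
  ultimately show "(f has_vector_derivative D) (at x)"
    using vector_diff_chain_at[of "\<lambda>s. s - x" 1 x "\<lambda>t. f (x + t)" D] by (simp add: o_def)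
qed

text \<open>Transport controls a section only along coordinate lines; continuity of a partial
  derivative upgrades this to total differentiability.\<close>

lemma differentiable_if_continuous_partials:
  fixes f :: "real^2 \<Rightarrow> real"
  assumes O: "open O'" and z: "z \<in> O'"
    and d1: "\<And>u. u \<in> O' \<Longrightarrow> ((\<lambda>t. f (u + t *\<^sub>R axis 1 1)) has_real_derivative f1 u) (at 0)"
    and d2: "\<And>u. u \<in> O' \<Longrightarrow> ((\<lambda>t. f (u + t *\<^sub>R axis 2 1)) has_real_derivative f2 u) (at 0)"
    and c2: "continuous_on O' f2"
  shows "f differentiable (at z)"
proof -
  obtain r where r: "r > 0" "ball z r \<subseteq> O'" using O z openE by blast
  define X where "X = ball (z $ 1) (r / 2)"
  define Y where "Y = ball (z $ 2) (r / 2)"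
  have XY: "pt x y \<in> O'" if "x \<in> X" "y \<in> Y" for x y
  proof -
    have "norm (pt x y - z) \<le> (\<Sum>i\<in>UNIV. \<bar>(pt x y - z) $ i\<bar>)" by (rule norm_le_l1_cart)
    also have "\<dots> < r" using that by (simp add: sum_2 X_def Y_def dist_real_def abs_minus_commute)
    finally show ?thesis using r(2) by (auto simp: dist_norm norm_minus_commute)
  qed
  have zX: "z $ 1 \<in> X" "z $ 2 \<in> Y" using r by (auto simp: X_def Y_def)
  have D1: "((\<lambda>x. f (pt x y)) has_real_derivative f1 (pt x y)) (at x)" if "x \<in> X" "y \<in> Y" for x y
    using d1[OF XY[OF that]] DERIV_shift[of "\<lambda>x. f (pt x y)" "f1 (pt x y)" 0 x]
    by (simp add: line_pt add.commute[of x])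
  have D2: "((\<lambda>y. f (pt x y)) has_real_derivative f2 (pt x y)) (at y)" if "x \<in> X" "y \<in> Y" for x y
    using d2[OF XY[OF that]] DERIV_shift[of "\<lambda>y. f (pt x y)" "f2 (pt x y)" 0 y]
    by (simp add: line_pt add.commute[of y])
  have c: "continuous_on (X \<times> Y) (\<lambda>(x, y). blinfun_mult_right (f2 (pt x y)))"
    unfolding case_prod_unfold
    by (intro bounded_linear.continuous_on[OF bounded_linear_blinfun_mult_right] continuous_on_compose2[OF c2]
        continuous_on_pt continuous_intros) (auto intro: XY)
  have "((\<lambda>(x, y). f (pt x y)) has_derivative (\<lambda>(tx, ty). f1 (pt (z $ 1) (z $ 2)) * tx + blinfun_mult_right (f2 (pt (z $ 1) (z $ 2))) ty))
      (at (z $ 1, z $ 2) within X \<times> Y)"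
  proof (rule has_derivative_partialsI)
    show "((\<lambda>x. f (pt x (z $ 2))) has_derivative (*) (f1 (pt (z $ 1) (z $ 2)))) (at (z $ 1) within X)"
      using D1[OF zX] by (simp add: has_field_derivative_def has_derivative_at_withinI)
    show "((\<lambda>y. f (pt x y)) has_derivative blinfun_apply (blinfun_mult_right (f2 (pt x y)))) (at y within Y)"
      if "x \<in> X" "y \<in> Y" for x y
      using D2[OF that] by (simp add: has_field_derivative_def has_derivative_at_withinI)
    show "continuous (at (z $ 1, z $ 2) within X \<times> Y) (\<lambda>(x, y). blinfun_mult_right (f2 (pt x y)))"
      using c zX by (simp add: continuous_on_eq_continuous_within)
  qed (use zX in \<open>auto simp: Y_def\<close>)
  moreover have "at (z $ 1, z $ 2) within X \<times> Y = at (z $ 1, z $ 2)"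
    using zX by (intro at_within_open open_Times) (auto simp: X_def Y_def)
  ultimately have P: "((\<lambda>(x, y). f (pt x y)) has_derivative (\<lambda>(tx, ty). f1 (pt (z $ 1) (z $ 2)) * tx + blinfun_mult_right (f2 (pt (z $ 1) (z $ 2))) ty))
      (at (z $ 1, z $ 2))" by simp
  have "((\<lambda>u. (u $ 1, u $ 2)) has_derivative (\<lambda>u. (u $ 1, u $ 2))) (at z)"
    by (intro bounded_linear_imp_has_derivative bounded_linear_Pair bounded_linear_vec_nth)
  from has_derivative_compose[OF this P] show ?thesis
    by (auto simp: differentiable_def pt_eta)
qed

section \<open>Existence and regularity of parallel sections\<close>

context analytic_chart
begin

text \<open>Continuity and derivatives along coordinate lines are what transport delivers;
  smoothness is then a consequence of the equation.\<close>

definition parallel_on :: "(real^2) set \<Rightarrow> (real^2 \<Rightarrow> real^6) \<Rightarrow> bool" where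
  "parallel_on N \<Phi> \<longleftrightarrow> continuous_on N \<Phi> \<and> (\<forall>z\<in>N. \<forall>a.
     ((\<lambda>t. \<Phi> (z + t *\<^sub>R axis a 1)) has_vector_derivative - (Omega a \<Gamma> z *v \<Phi> z)) (at 0))"

definition dOmega :: "2 \<Rightarrow> 2 \<Rightarrow> real^2 \<Rightarrow> real^6^6" where
  "dOmega a b z = (\<chi> i j. pd a (\<lambda>u. Omega b \<Gamma> u $ i $ j) z)"

lemma Omega_has_vector_derivative:
  assumes "z \<in> S"
  shows "((\<lambda>t. Omega b \<Gamma> (z + t *\<^sub>R axis a 1)) has_vector_derivative dOmega a b z) (at 0)"
proof (intro has_vector_derivative_cart)
  fix i j
  have "(\<lambda>u. Omega b \<Gamma> u $ i $ j) differentiable (at z)"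
    by (intro smooth_on_differentiable[OF open_S _ assms] smooth_Omega)
  from pd_line[OF this, of a]
  show "((\<lambda>t. Omega b \<Gamma> (z + t *\<^sub>R axis a 1) $ i $ j) has_vector_derivative dOmega a b z $ i $ j) (at 0)"
    by (simp add: dOmega_def has_real_derivative_iff_has_vector_derivative)
qed

lemma continuous_on_cart: "(\<And>i. continuous_on A (\<lambda>z. f z $ i)) \<Longrightarrow> continuous_on A f"
  for f :: "'b::topological_space \<Rightarrow> 'c::topological_space ^ 'n"
  using continuous_on_vec_lambda[of A "\<lambda>i z. f z $ i"] by simp

lemma continuous_on_Omega: "continuous_on S (Omega a \<Gamma>)"
  by (intro continuous_on_cart smooth_on_continuous smooth_Omega)

lemma continuous_on_dOmega: "continuous_on S (dOmega a b)"
  unfolding dOmega_def by (intro continuous_on_vec_lambda smooth_on_continuous sm_intros smooth_Omega)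

text \<open>The condition on \<open>v\<close> kills the only nonzero row of the curvature
  matrix.\<close>

lemma curvature_mult:
  assumes "z \<in> S" "Vrow \<Gamma> z \<bullet> v = 0"
  shows "dOmega 1 2 z *v v - dOmega 2 1 z *v v + Omega 1 \<Gamma> z *v (Omega 2 \<Gamma> z *v v) - Omega 2 \<Gamma> z *v (Omega 1 \<Gamma> z *v v) = 0"
proof -
  define R where "R = dOmega 1 2 z - dOmega 2 1 z + Omega 1 \<Gamma> z ** Omega 2 \<Gamma> z - Omega 2 \<Gamma> z ** Omega 1 \<Gamma> z"
  have R: "R $ i $ j = (if i = 6 then Vrow \<Gamma> z $ j else 0)" for i j
    using curvature[OF assms(1), of i j] by (simp add: R_def dOmega_def matrix_matrix_mult_def Omega_12)
  have "(R *v v) $ i = 0" for i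
    using assms(2) by (cases "i = 6") (simp_all add: matrix_vector_mult_def R inner_vec_def)
  then have "R *v v = 0" by (simp add: vec_eq_iff)
  then show ?thesis
    by (simp add: R_def matrix_vector_mult_diff_rdistrib matrix_vector_mult_add_rdistrib matrix_vector_mul_assoc)
qed

text \<open>The conditions on \<open>K\<close> and \<open>d\<close> do not involve \<open>q\<close>,
  so the box can be fixed before \<open>q\<close> is chosen. The constant 4 arises because the
  section is bounded by \<open>2 * norm w\<close>, hence changes at rate at most
  \<open>2 * K * norm w\<close> in each of two coordinate directions.\<close>

lemma parallel_section_exists:
  fixes q lo hi :: "real^2" and w :: "real^6"
  assumes QS: "cbox lo hi \<subseteq> S"
    and b: "\<And>a z v. z \<in> cbox lo hi \<Longrightarrow> norm (Omega a \<Gamma> z *v v) \<le> K * norm v"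
      "\<And>z v. z \<in> cbox lo hi \<Longrightarrow> norm (dOmega 1 2 z *v v) \<le> K * norm v"
    and K: "K \<ge> 0" and d: "hi $ 1 - lo $ 1 \<le> d" "hi $ 2 - lo $ 2 \<le> d" "d * K \<le> 1/4" "d \<le> 1"
    and q: "q \<in> box lo hi" and w: "\<And>as. covD_iter \<Gamma> as (Vrow \<Gamma>) q \<bullet> w = 0"
  shows "\<exists>\<Phi>. parallel_on (box lo hi) \<Phi> \<and> (\<forall>z\<in>box lo hi. norm (\<Phi> z - w) \<le> 4 * K * norm w * dist z q)"
proof -
  let ?Q = "cbox lo hi"
  let ?M1 = "Omega 1 \<Gamma>" let ?M2 = "Omega 2 \<Gamma>"
  have BQ: "box lo hi \<subseteq> ?Q" by (rule box_subset_cbox)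
  have BS: "z \<in> S" if "z \<in> box lo hi" for z using that BQ QS by blast
  have qQ: "q \<in> ?Q" using q BQ by blast
  have cM: "continuous_on ?Q (Omega a \<Gamma>)" for a by (rule continuous_on_subset[OF continuous_on_Omega QS])
  have cdM: "continuous_on (box lo hi) (dOmega a b)" for a b
    by (rule continuous_on_subset[OF continuous_on_dOmega]) (use BS in blast)
  obtain \<Phi> where \<Phi>c: "continuous_on ?Q \<Phi>" and
    fp: "\<And>z. z \<in> ?Q \<Longrightarrow> \<Phi> z = w - (z $ 1 - q $ 1) *\<^sub>R integral {0..1} (\<lambda>\<tau>. ?M1 (pt (q $ 1 + \<tau> * (z $ 1 - q $ 1)) (q $ 2)) *v \<Phi> (pt (q $ 1 + \<tau> * (z $ 1 - q $ 1)) (q $ 2)))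
      - (z $ 2 - q $ 2) *\<^sub>R integral {0..1} (\<lambda>\<tau>. ?M2 (pt (z $ 1) (q $ 2 + \<tau> * (z $ 2 - q $ 2))) *v \<Phi> (pt (z $ 1) (q $ 2 + \<tau> * (z $ 2 - q $ 2))))"
    and \<Phi>b: "\<And>z. z \<in> ?Q \<Longrightarrow> norm (\<Phi> z) \<le> 2 * norm w"
    using transport_fixed_point[where w = w, OF cM[of 1] cM[of 2] b(1)[of _ 1] b(1)[of _ 2] K d(1-3) qQ] by blast
  define I1 where "I1 = {lo $ 1<..<hi $ 1}"
  define I2 where "I2 = {lo $ 2<..<hi $ 2}"
  have B: "pt s t \<in> box lo hi \<longleftrightarrow> s \<in> I1 \<and> t \<in> I2" for s t
    by (simp add: pt_in_box I1_def I2_def)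
  have qI: "q $ 1 \<in> I1" "q $ 2 \<in> I2" using q B[of "q $ 1" "q $ 2"] by (simp_all add: pt_eta)
  have Q: "pt s t \<in> ?Q" if "s \<in> I1" "t \<in> I2" for s t using that B BQ by blast
  have \<Phi>q: "\<Phi> q = w" using fp[OF qQ] by simp
  have hor: "\<Phi> (pt x (q $ 2)) = w - (x - q $ 1) *\<^sub>R integral {0..1} (\<lambda>\<tau>. ?M1 (pt (q $ 1 + \<tau> * (x - q $ 1)) (q $ 2)) *v \<Phi> (pt (q $ 1 + \<tau> * (x - q $ 1)) (q $ 2)))"
    if "x \<in> I1" for x
    using fp[OF Q[OF that qI(2)]] by simp
  have horD: "((\<lambda>x. \<Phi> (pt x (q $ 2))) has_vector_derivative - (?M1 (pt x (q $ 2)) *v \<Phi> (pt x (q $ 2)))) (at x)"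
    if x: "x \<in> I1" for x
  proof -
    have "continuous_on {lo $ 1..hi $ 1} (\<lambda>x. ?M1 (pt x (q $ 2)) *v \<Phi> (pt x (q $ 2)))"
      using qI by (intro continuous_on_mv continuous_on_compose2[OF cM] continuous_on_compose2[OF \<Phi>c] continuous_on_pt continuous_intros)
        (auto simp: pt_in_box I2_def)
    from unit_integral_derivative[OF this, of "q $ 1" x]
    have "((\<lambda>x. w - (x - q $ 1) *\<^sub>R integral {0..1} (\<lambda>\<tau>. ?M1 (pt (q $ 1 + \<tau> * (x - q $ 1)) (q $ 2)) *v \<Phi> (pt (q $ 1 + \<tau> * (x - q $ 1)) (q $ 2))))
      has_vector_derivative 0 - ?M1 (pt x (q $ 2)) *v \<Phi> (pt x (q $ 2))) (at x)"
      using x qI by (intro has_vector_derivative_diff has_vector_derivative_const) (auto simp: I1_def)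
    then have "((\<lambda>x. w - (x - q $ 1) *\<^sub>R integral {0..1} (\<lambda>\<tau>. ?M1 (pt (q $ 1 + \<tau> * (x - q $ 1)) (q $ 2)) *v \<Phi> (pt (q $ 1 + \<tau> * (x - q $ 1)) (q $ 2))))
      has_vector_derivative - (?M1 (pt x (q $ 2)) *v \<Phi> (pt x (q $ 2)))) (at x)" by simp
    then show ?thesis
      by (rule has_vector_derivative_transform_within_open[where S = I1]) (use x hor in \<open>auto simp: I1_def\<close>)
  qed
  have vert: "((\<lambda>t. \<Phi> (pt x t)) has_vector_derivative - (?M2 (pt x y) *v \<Phi> (pt x y))) (at y)"
    if xy: "pt x y \<in> box lo hi" for x y
  proof -
    have x: "x \<in> I1" "y \<in> I2" using xy B by auto
    define c where "c = w - (x - q $ 1) *\<^sub>R integral {0..1} (\<lambda>\<tau>. ?M1 (pt (q $ 1 + \<tau> * (x - q $ 1)) (q $ 2)) *v \<Phi> (pt (q $ 1 + \<tau> * (x - q $ 1)) (q $ 2)))"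
    have "continuous_on {lo $ 2..hi $ 2} (\<lambda>y. ?M2 (pt x y) *v \<Phi> (pt x y))"
      using x by (intro continuous_on_mv continuous_on_compose2[OF cM] continuous_on_compose2[OF \<Phi>c] continuous_on_pt continuous_intros)
        (auto simp: pt_in_box I1_def)
    from unit_integral_derivative[OF this, of "q $ 2" y]
    have "((\<lambda>y. c - (y - q $ 2) *\<^sub>R integral {0..1} (\<lambda>\<tau>. ?M2 (pt x (q $ 2 + \<tau> * (y - q $ 2))) *v \<Phi> (pt x (q $ 2 + \<tau> * (y - q $ 2)))))
      has_vector_derivative 0 - ?M2 (pt x y) *v \<Phi> (pt x y)) (at y)"
      using x qI by (intro has_vector_derivative_diff has_vector_derivative_const) (auto simp: I2_def)
    then have "((\<lambda>y. c - (y - q $ 2) *\<^sub>R integral {0..1} (\<lambda>\<tau>. ?M2 (pt x (q $ 2 + \<tau> * (y - q $ 2))) *v \<Phi> (pt x (q $ 2 + \<tau> * (y - q $ 2)))))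
      has_vector_derivative - (?M2 (pt x y) *v \<Phi> (pt x y))) (at y)" by simp
    then show ?thesis
    proof (rule has_vector_derivative_transform_within_open[where S = I2])
      fix t assume "t \<in> I2"
      then show "c - (t - q $ 2) *\<^sub>R integral {0..1} (\<lambda>\<tau>. ?M2 (pt x (q $ 2 + \<tau> * (t - q $ 2))) *v \<Phi> (pt x (q $ 2 + \<tau> * (t - q $ 2)))) = \<Phi> (pt x t)"
        using fp[OF Q[OF x(1)], of t] by (simp add: c_def)
    qed (use x in \<open>auto simp: I2_def\<close>)
  qed
  \<comment> \<open>All pure vertical derivatives of \<open>Vrow\<close> are treated at once, since
    on the horizontal line they form the initial data for the vertical lines. For each of them the
    data at \<open>q\<close> are the mixed derivatives, all annihilated by \<open>w\<close>.\<close>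
  have horV: "covD_iter \<Gamma> (replicate m 2) (Vrow \<Gamma>) (pt x (q $ 2)) \<bullet> \<Phi> (pt x (q $ 2)) = 0" if x: "x \<in> I1" for x m
  proof -
    define T where "T = {lo $ 1 - q $ 1<..<hi $ 1 - q $ 1}"
    have T: "q $ 1 + t \<in> I1 \<longleftrightarrow> t \<in> T" for t by (auto simp: T_def I1_def)
    have line: "q + t *\<^sub>R axis 1 1 = pt (q $ 1 + t) (q $ 2)" for t by (rule line_pt)
    have "covD_iter \<Gamma> (replicate m 2) (Vrow \<Gamma>) (q + (x - q $ 1) *\<^sub>R axis 1 1) \<bullet> \<Phi> (q + (x - q $ 1) *\<^sub>R axis 1 1) = 0"
    proof (rule pairing_vanishes_on_line[where X = "covD_iter \<Gamma> (replicate m 2) (Vrow \<Gamma>)" and ?z0.0 = q and a = 1 and \<Psi> = \<Phi> and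
        t = "x - q $ 1" and T = T and ?t0.0 = 0 and B = "2 * norm w"])
      show "analytic_bounded_on S (\<lambda>u. covD_iter \<Gamma> (replicate m 2) (Vrow \<Gamma>) u $ j)" for j
        by (intro analytic_covD_iter analytic_Vrow)
      show "0 \<in> T" "x - q $ 1 \<in> T" using T[of 0] T[of "x - q $ 1"] qI x by auto
      fix t assume t: "t \<in> T"
      show "q + t *\<^sub>R axis 1 1 \<in> S" unfolding line using t T qI B BS by blast
      show "norm (\<Phi> (q + t *\<^sub>R axis 1 1)) \<le> 2 * norm w" unfolding line using t T qI Q \<Phi>b by blast
      have "((\<lambda>s. \<Phi> (pt (q $ 1 + t + s) (q $ 2))) has_vector_derivative - (?M1 (pt (q $ 1 + t) (q $ 2)) *v \<Phi> (pt (q $ 1 + t) (q $ 2)))) (at 0)"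
        using horD[of "q $ 1 + t"] t T
        by (subst has_vector_derivative_shift_0[where f = "\<lambda>x. \<Phi> (pt x (q $ 2))"]) auto
      then show "((\<lambda>s. \<Phi> (q + s *\<^sub>R axis 1 1)) has_vector_derivative - (?M1 (q + t *\<^sub>R axis 1 1) *v \<Phi> (q + t *\<^sub>R axis 1 1))) (at t)"
        unfolding line by (subst has_vector_derivative_shift_0[symmetric]) (simp add: add.assoc)
    qed (use w \<Phi>q in \<open>simp_all add: T_def covD_iter_append[symmetric]\<close>)
    then show ?thesis by (simp add: line)
  qed
  \<comment> \<open>Second application, along the vertical line through \<open>z\<close>, started at
    its intersection with the horizontal line through \<open>q\<close>.\<close>
  have V0: "Vrow \<Gamma> z \<bullet> \<Phi> z = 0" if z: "z \<in> box lo hi" for z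
  proof -
    define x where "x = z $ 1"
    have x: "x \<in> I1" "z $ 2 \<in> I2" using z B[of "z $ 1" "z $ 2"] by (auto simp: pt_eta x_def)
    define T where "T = {lo $ 2 - q $ 2<..<hi $ 2 - q $ 2}"
    have T: "q $ 2 + t \<in> I2 \<longleftrightarrow> t \<in> T" for t by (auto simp: T_def I2_def)
    have line: "pt x (q $ 2) + t *\<^sub>R axis 2 1 = pt x (q $ 2 + t)" for t by (simp add: line_pt)
    have "Vrow \<Gamma> (pt x (q $ 2) + (z $ 2 - q $ 2) *\<^sub>R axis 2 1) \<bullet> \<Phi> (pt x (q $ 2) + (z $ 2 - q $ 2) *\<^sub>R axis 2 1) = 0"
    proof (rule pairing_vanishes_on_line[where X = "Vrow \<Gamma>" and ?z0.0 = "pt x (q $ 2)" and a = 2 and \<Psi> = \<Phi> and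
        t = "z $ 2 - q $ 2" and T = T and ?t0.0 = 0 and B = "2 * norm w"])
      show "analytic_bounded_on S (\<lambda>u. Vrow \<Gamma> u $ j)" for j by (rule analytic_Vrow)
      show "0 \<in> T" "z $ 2 - q $ 2 \<in> T" using T[of 0] T[of "z $ 2 - q $ 2"] qI x by auto
      fix t assume t: "t \<in> T"
      show "pt x (q $ 2) + t *\<^sub>R axis 2 1 \<in> S" unfolding line using t T x B BS by blast
      show "norm (\<Phi> (pt x (q $ 2) + t *\<^sub>R axis 2 1)) \<le> 2 * norm w" unfolding line using t T x Q \<Phi>b by blast
      have "((\<lambda>s. \<Phi> (pt x (q $ 2 + t + s))) has_vector_derivative - (?M2 (pt x (q $ 2 + t)) *v \<Phi> (pt x (q $ 2 + t)))) (at 0)"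
        using vert[of x "q $ 2 + t"] t T x B
        by (subst has_vector_derivative_shift_0[where f = "\<lambda>y. \<Phi> (pt x y)"]) auto
      then show "((\<lambda>s. \<Phi> (pt x (q $ 2) + s *\<^sub>R axis 2 1)) has_vector_derivative - (?M2 (pt x (q $ 2) + t *\<^sub>R axis 2 1) *v \<Phi> (pt x (q $ 2) + t *\<^sub>R axis 2 1))) (at t)"
        unfolding line by (subst has_vector_derivative_shift_0[symmetric]) (simp add: add.assoc)
    qed (use horV x in \<open>simp_all add: T_def\<close>)
    then show ?thesis unfolding line by (simp add: x_def pt_eta)
  qed
  have horAll: "((\<lambda>s. \<Phi> (pt s y)) has_vector_derivative - (?M1 (pt x y) *v \<Phi> (pt x y))) (at x)"
    if xy: "pt x y \<in> box lo hi" for x y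
  proof (rule transport_is_parallel[where ?M2.0 = ?M2 and ?dM1.0 = "dOmega 2 1" and ?dM2.0 = "dOmega 1 2" and K = K and d = d and q = q,
      OF cM cM cdM cdM _ _ b(1) b(1) _ K d q \<Phi>c vert _ _ xy])
    fix x y assume xy: "pt x y \<in> box lo hi"
    show "((\<lambda>s. ?M2 (pt s y)) has_vector_derivative dOmega 1 2 (pt x y)) (at x)"
      using Omega_has_vector_derivative[OF BS[OF xy], of 2 1]
      by (subst has_vector_derivative_shift_0[symmetric]) (simp add: line_pt)
    show "((\<lambda>t. ?M1 (pt x t)) has_vector_derivative dOmega 2 1 (pt x y)) (at y)"
      using Omega_has_vector_derivative[OF BS[OF xy], of 1 2]
      by (subst has_vector_derivative_shift_0[symmetric]) (simp add: line_pt)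
  next
    show "norm (dOmega 1 2 z *v v) \<le> K * norm v" if "z \<in> box lo hi" for z v using b(2) that BQ by blast
    show "\<Phi> (pt x (q $ 2)) = \<Phi> q - (x - q $ 1) *\<^sub>R integral {0..1} (\<lambda>\<tau>. ?M1 (pt (q $ 1 + \<tau> * (x - q $ 1)) (q $ 2)) *v \<Phi> (pt (q $ 1 + \<tau> * (x - q $ 1)) (q $ 2)))"
      if "x \<in> {lo $ 1<..<hi $ 1}" for x using hor that \<Phi>q by (simp add: I1_def)
    show "dOmega 1 2 z *v \<Phi> z - dOmega 2 1 z *v \<Phi> z + ?M1 z *v (?M2 z *v \<Phi> z) - ?M2 z *v (?M1 z *v \<Phi> z) = 0"
      if "z \<in> box lo hi" for z by (rule curvature_mult[OF BS[OF that] V0[OF that]])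
  qed
  have par: "((\<lambda>t. \<Phi> (z + t *\<^sub>R axis a 1)) has_vector_derivative - (Omega a \<Gamma> z *v \<Phi> z)) (at 0)"
    if z: "z \<in> box lo hi" for z a
  proof (cases "a = 1")
    case True
    have "((\<lambda>t. \<Phi> (pt (z $ 1 + t) (z $ 2))) has_vector_derivative - (?M1 z *v \<Phi> z)) (at 0)"
      using horAll[of "z $ 1" "z $ 2"] z by (subst has_vector_derivative_shift_0[where f = "\<lambda>x. \<Phi> (pt x (z $ 2))"]) (simp add: pt_eta)
    then show ?thesis using True by (simp add: line_pt)
  next
    case False
    then have "a = 2" using exhaust_2 by metis
    have "((\<lambda>t. \<Phi> (pt (z $ 1) (z $ 2 + t))) has_vector_derivative - (?M2 z *v \<Phi> z)) (at 0)"
      using vert[of "z $ 1" "z $ 2"] z by (subst has_vector_derivative_shift_0[where f = "\<lambda>y. \<Phi> (pt (z $ 1) y)"]) (simp add: pt_eta)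
    then show ?thesis using \<open>a = 2\<close> by (simp add: line_pt)
  qed
  have "norm (\<Phi> z - w) \<le> 4 * K * norm w * dist z q" if z: "z \<in> box lo hi" for z
  proof -
    have zI: "z $ 1 \<in> I1" "z $ 2 \<in> I2" using z B[of "z $ 1" "z $ 2"] by (simp_all add: pt_eta)
    have bd: "norm (- (Omega a \<Gamma> (pt s t) *v \<Phi> (pt s t))) \<le> 2 * K * norm w" if "s \<in> I1" "t \<in> I2" for a s t
      using order_trans[OF b(1)[OF Q[OF that]] mult_left_mono[OF \<Phi>b[OF Q[OF that]] K], of a] by (simp add: mult_ac)
    have 1: "norm (\<Phi> (pt (z $ 1) (z $ 2)) - \<Phi> (pt (z $ 1) (q $ 2))) \<le> (2 * K * norm w) * \<bar>z $ 2 - q $ 2\<bar>"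
      by (rule norm_derivative_bound[where T = I2 and f = "\<lambda>t. \<Phi> (pt (z $ 1) t)", OF vert bd]) (use zI qI B in \<open>auto simp: I2_def\<close>)
    have 2: "norm (\<Phi> (pt (z $ 1) (q $ 2)) - \<Phi> (pt (q $ 1) (q $ 2))) \<le> (2 * K * norm w) * \<bar>z $ 1 - q $ 1\<bar>"
      by (rule norm_derivative_bound[where T = I1 and f = "\<lambda>s. \<Phi> (pt s (q $ 2))", OF horD bd]) (use zI qI B in \<open>auto simp: I1_def\<close>)
    have "norm (\<Phi> z - w) \<le> (2 * K * norm w) * \<bar>z $ 2 - q $ 2\<bar> + (2 * K * norm w) * \<bar>z $ 1 - q $ 1\<bar>"
      using norm_triangle_le[OF add_mono[OF 1 2]] by (simp add: pt_eta \<Phi>q)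
    also have "\<dots> \<le> (2 * K * norm w) * dist z q + (2 * K * norm w) * dist z q"
      using K component_le_norm_cart[of "z - q"] by (intro add_mono mult_left_mono) (auto simp: dist_norm)
    finally show ?thesis by simp
  qed
  moreover have "continuous_on (box lo hi) \<Phi>" by (rule continuous_on_subset[OF \<Phi>c BQ])
  ultimately show ?thesis using par unfolding parallel_on_def by blast
qed

lemma parallel_on_subset: "parallel_on N \<Phi> \<Longrightarrow> N' \<subseteq> N \<Longrightarrow> parallel_on N' \<Phi>"
  unfolding parallel_on_def using continuous_on_subset by blast

text \<open>Bootstrap: the equation expresses the first derivatives through smooth coefficients and
  the section itself, so each order of regularity yields the next.\<close>

lemma parallel_on_smooth:
  assumes N: "open N" "N \<subseteq> S" and par: "parallel_on N \<Phi>"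
  shows "smooth_on N (\<lambda>u. \<Phi> u $ i)"
    and "z \<in> N \<Longrightarrow> pd a (\<lambda>u. \<Phi> u $ i) z = - (Omega a \<Gamma> z *v \<Phi> z) $ i"
proof -
  have D: "((\<lambda>t. \<Phi> (z + t *\<^sub>R axis a 1) $ i) has_real_derivative - (Omega a \<Gamma> z *v \<Phi> z) $ i) (at 0)"
    if "z \<in> N" for z a i
  proof -
    have "((\<lambda>t. \<Phi> (z + t *\<^sub>R axis a 1)) has_vector_derivative - (Omega a \<Gamma> z *v \<Phi> z)) (at 0)"
      using par that by (simp add: parallel_on_def)
    from bounded_linear.has_vector_derivative[OF bounded_linear_vec_nth this, of i] show ?thesis
      by (simp add: has_real_derivative_iff_has_vector_derivative)
  qed
  then show pd: "pd a (\<lambda>u. \<Phi> u $ i) z = - (Omega a \<Gamma> z *v \<Phi> z) $ i" if "z \<in> N" for z a i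
    using that by (intro pd_eq)
  have c\<Phi>: "continuous_on N \<Phi>" using par by (simp add: parallel_on_def)
  have c\<Omega>: "continuous_on N (Omega a \<Gamma>)" for a by (rule continuous_on_subset[OF continuous_on_Omega N(2)])
  have diff: "(\<lambda>u. \<Phi> u $ i) differentiable (at z)" if "z \<in> N" for z i
    by (rule differentiable_if_continuous_partials[OF N(1) that D D])
      (auto intro!: continuous_intros continuous_on_mv c\<Phi> c\<Omega>)
  have "Ck_on k N (\<lambda>u. \<Phi> u $ i)" for k i
  proof (induction k arbitrary: i)
    case 0
    show ?case using c\<Phi> by (simp add: continuous_on_component)
  next
    case (Suc k)
    have "Ck_on k N (pd a (\<lambda>u. \<Phi> u $ i))" for a
    proof (rule Ck_on_cong[OF N(1)])
      show "Ck_on k N (\<lambda>u. (-1) * (\<Sum>j\<in>UNIV. Omega a \<Gamma> u $ i $ j * \<Phi> u $ j))"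
        unfolding sum_6
        by (intro Ck_on_mult Ck_on_add Ck_on_const N(1) Suc.IH smooth_on_Ck smooth_on_subset[OF open_S N(2) smooth_Omega])
      show "(-1) * (\<Sum>j\<in>UNIV. Omega a \<Gamma> u $ i $ j * \<Phi> u $ j) = pd a (\<lambda>u. \<Phi> u $ i) u" if "u \<in> N" for u
        using pd[OF that] by (simp add: matrix_vector_mult_def)
    qed
    then show ?case using diff by (simp add: differentiable_on_open[OF N(1)])
  qed
  then show "smooth_on N (\<lambda>u. \<Phi> u $ i)" by (simp add: smooth_on_def)
qed

text \<open>The order of choices matters: \<open>K\<close> and the box come from bounds near
  \<open>p\<close>, and only then is the neighbourhood of \<open>p\<close> chosen from which
  \<open>q\<close> is taken. Of the tolerance \<open>\<epsilon>\<close>, one half goes to the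
  continuity of \<open>W\<close> and the other to the transport from \<open>q\<close> to
  \<open>p\<close>.\<close>

lemma nondegenerate_parallel_section:
  assumes N: "open N" "p \<in> N" "N \<subseteq> S" and Wc: "continuous_on N W"
    and ker: "\<And>z. z \<in> N \<Longrightarrow> M_max \<Gamma> z *v W z = 0"
    and nd: "W p $ 1 * W p $ 3 - (W p $ 2)\<^sup>2 \<noteq> 0"
  shows "\<exists>N' \<Phi>. open N' \<and> p \<in> N' \<and> N' \<subseteq> S \<and> parallel_on N' \<Phi> \<and> \<Phi> p $ 1 * \<Phi> p $ 3 - (\<Phi> p $ 2)\<^sup>2 \<noteq> 0"
proof -
  define \<Delta> :: "real^6 \<Rightarrow> real" where "\<Delta> v = v $ 1 * v $ 3 - (v $ 2)\<^sup>2" for v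
  have "open {v. \<Delta> v \<noteq> 0}" unfolding \<Delta>_def by (intro open_Collect_neq continuous_intros)
  then obtain \<epsilon> where \<epsilon>: "\<epsilon> > 0" "\<And>v. dist v (W p) < \<epsilon> \<Longrightarrow> \<Delta> v \<noteq> 0"
    using nd unfolding open_dist \<Delta>_def by blast
  obtain r0 where r0: "r0 > 0" "cball p r0 \<subseteq> S" using open_S N open_contains_cball by blast
  have "\<exists>C. \<forall>z\<in>cball p r0. norm (F z) \<le> C" if "continuous_on S F" for F :: "real^2 \<Rightarrow> real^6^6"
    using compact_imp_bounded[OF compact_continuous_image[OF continuous_on_subset[OF that r0(2)] compact_cball]]
    by (auto simp: bounded_iff)
  then obtain C1 C2 C3 where C: "\<And>z. z \<in> cball p r0 \<Longrightarrow> norm (Omega 1 \<Gamma> z) \<le> C1"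
    "\<And>z. z \<in> cball p r0 \<Longrightarrow> norm (Omega 2 \<Gamma> z) \<le> C2" "\<And>z. z \<in> cball p r0 \<Longrightarrow> norm (dOmega 1 2 z) \<le> C3"
    using continuous_on_Omega continuous_on_dOmega by metis
  obtain L where L: "L > 0" "\<And>(A :: real^6^6) v. norm (A *v v) \<le> norm A * norm v * L"
    using bounded_bilinear.pos_bounded[OF bounded_bilinear_matrix_vector_mult] by blast
  define K where "K = (max C1 (max C2 C3)) * L"
  have "norm (Omega 1 \<Gamma> p) \<le> C1" using C(1) r0 by simp
  then have "C1 \<ge> 0" using norm_ge_zero order_trans by blast
  then have K: "K \<ge> 0" using L by (simp add: K_def le_max_iff_disj)
  have bK: "norm (A *v v) \<le> K * norm v" if "norm A \<le> max C1 (max C2 C3)" for A :: "real^6^6" and v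
  proof -
    have "norm (A *v v) \<le> norm A * (norm v * L)" using L(2)[of A v] by (simp add: mult_ac)
    also have "\<dots> \<le> max C1 (max C2 C3) * (norm v * L)" using that L by (intro mult_right_mono) auto
    finally show ?thesis by (simp add: K_def mult_ac)
  qed
  \<comment> \<open>The bound by \<open>r0\<close> puts the closed box inside the ball, as the
    coordinate deviations from \<open>p\<close> sum to at most \<open>d\<close>. The last entry
    gives \<open>d * K \<le> 1/4\<close>, and the added 1 covers \<open>K = 0\<close>.\<close>
  define d where "d = min 1 (min r0 (1 / (4 * K + 1)))"
  have d: "d > 0" "d \<le> 1" "d \<le> r0" "d * K \<le> 1/4"
  proof -
    show "d > 0" "d \<le> 1" "d \<le> r0" using r0 K by (auto simp: d_def)
    have "d * K \<le> 1 / (4 * K + 1) * K" using K by (intro mult_right_mono) (auto simp: d_def)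
    also have "\<dots> \<le> 1/4" using K by (simp add: field_simps)
    finally show "d * K \<le> 1/4" .
  qed
  define lo :: "real^2" where "lo = (\<chi> i. p $ i - d / 2)"
  define hi :: "real^2" where "hi = (\<chi> i. p $ i + d / 2)"
  have pB: "p \<in> box lo hi" using d by (simp add: mem_box_cart lo_def hi_def)
  have Qb: "cbox lo hi \<subseteq> cball p r0"
  proof
    fix z assume "z \<in> cbox lo hi"
    then have z: "\<bar>(z - p) $ i\<bar> \<le> d / 2" for i
    proof -
      have "lo $ i \<le> z $ i \<and> z $ i \<le> hi $ i" using \<open>z \<in> cbox lo hi\<close> by (simp add: mem_box_cart)
      then have "p $ i - d / 2 \<le> z $ i" "z $ i \<le> p $ i + d / 2" by (simp_all add: lo_def hi_def)
      then show ?thesis unfolding vector_minus_component abs_le_iff by linarith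
    qed
    have "norm (z - p) \<le> (\<Sum>i\<in>UNIV. \<bar>(z - p) $ i\<bar>)" by (rule norm_le_l1_cart)
    also have "\<dots> \<le> r0" using z[of 1] z[of 2] d by (simp add: sum_2)
    finally show "z \<in> cball p r0" by (simp add: dist_norm norm_minus_commute)
  qed
  have isc: "isCont W p" using Wc N continuous_on_eq_continuous_at by blast
  have "\<forall>\<^sub>F z in at p. dist (W z) (W p) < min (\<epsilon> / 2) 1"
    by (rule tendstoD[OF isc[unfolded isCont_def]]) (use \<epsilon> in simp)
  then have "\<forall>\<^sub>F z in nhds p. dist (W z) (W p) < min (\<epsilon> / 2) 1"
    unfolding eventually_nhds_conv_at by (rule conjI) (use \<epsilon> in simp)
  moreover have "\<forall>\<^sub>F z in nhds p. z \<in> N \<inter> box lo hi"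
    using N pB by (intro eventually_nhds_in_open) auto
  \<comment> \<open>Solves the transport estimate for the distance, after \<open>norm (W q)\<close>
    has been replaced by \<open>norm (W p) + 1\<close>.\<close>
  moreover define e where "e = \<epsilon> / 2 / (4 * K * (norm (W p) + 1) + 1)"
  have den: "4 * K * (norm (W p) + 1) + 1 > 0" using K by (intro add_nonneg_pos mult_nonneg_nonneg) auto
  then have "e > 0" using \<epsilon> by (simp add: e_def)
  then have "\<forall>\<^sub>F z in nhds p. dist z p < e" by (auto simp: eventually_nhds_metric)
  ultimately have "\<forall>\<^sub>F z in nhds p. z \<in> N \<inter> box lo hi \<and> dist (W z) (W p) < min (\<epsilon> / 2) 1 \<and> dist z p < e"
    by eventually_elim auto
  then obtain O' where O: "open O'" "p \<in> O'"
    "\<And>z. z \<in> O' \<Longrightarrow> z \<in> N \<and> z \<in> box lo hi \<and> dist (W z) (W p) < min (\<epsilon> / 2) 1 \<and> dist z p < e"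
    unfolding eventually_nhds by auto
  have ann: "covD_iter \<Gamma> as (Vrow \<Gamma>) u \<bullet> W u = 0" if "u \<in> O'" "length as \<le> 5" for u as
    using that O(3) N ker[of u] M_max_mult_eq_0 covD_iter_annihilated_iff[of u 5 "W u"] by blast
  \<comment> \<open>Nondegeneracy persists near \<open>p\<close> and excludes the zero vector, so
    \<open>W u\<close> is the nonzero kernel vector that \<open>exists_flat_point\<close> asks
    for.\<close>
  have "W u \<noteq> 0" if "u \<in> O'" for u
    using \<epsilon>(2)[of "W u"] O(3)[OF that] \<epsilon>(1) by (auto simp: \<Delta>_def)
  then obtain q where q: "q \<in> O'" and qall: "\<And>as. covD_iter \<Gamma> as (Vrow \<Gamma>) q \<bullet> W q = 0"
    using exists_flat_point[OF O(1)] O N ann by (metis empty_iff subset_iff)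
  have "\<exists>\<Phi>. parallel_on (box lo hi) \<Phi> \<and> (\<forall>z\<in>box lo hi. norm (\<Phi> z - W q) \<le> 4 * K * norm (W q) * dist z q)"
  proof (rule parallel_section_exists[where d = d])
    show "cbox lo hi \<subseteq> S" using Qb r0 by blast
    fix z :: "real^2" and v :: "real^6" assume z: "z \<in> cbox lo hi"
    show "norm (Omega a \<Gamma> z *v v) \<le> K * norm v" for a
      using C(1,2)[of z] z Qb exhaust_2[of a] by (intro bK) (auto simp: le_max_iff_disj)
    show "norm (dOmega 1 2 z *v v) \<le> K * norm v"
      using C(3)[of z] z Qb by (intro bK) (auto simp: le_max_iff_disj)
  qed (use K d qall O(3)[OF q] in \<open>auto simp: lo_def hi_def\<close>)
  then obtain \<Phi> where \<Phi>: "parallel_on (box lo hi) \<Phi>" "norm (\<Phi> p - W q) \<le> 4 * K * norm (W q) * dist p q"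
    using pB by blast
  have "norm (W q) \<le> norm (W p) + 1"
    using O(3)[OF q] norm_triangle_sub[of "W q" "W p"] by (simp add: dist_norm)
  then have "4 * K * norm (W q) * dist p q \<le> 4 * K * (norm (W p) + 1) * e"
    using K O(3)[OF q] by (intro mult_mono) (auto simp: dist_commute)
  also have "\<dots> \<le> (4 * K * (norm (W p) + 1) + 1) * e" using \<open>e > 0\<close> by (intro mult_right_mono) auto
  also have "\<dots> = \<epsilon> / 2" 
  proof -
    have "D * (\<epsilon> / 2 / D) = \<epsilon> / 2" if "D > 0" for D using that by simp
    from this[OF den] show ?thesis unfolding e_def .
  qed
  finally have "norm (\<Phi> p - W q) \<le> \<epsilon> / 2" using \<Phi>(2) by linarith
  then have "dist (\<Phi> p) (W p) < \<epsilon>"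
    using O(3)[OF q] dist_triangle[of "\<Phi> p" "W p" "W q"] by (simp add: dist_norm)
  then have "\<Delta> (\<Phi> p) \<noteq> 0" by (rule \<epsilon>(2))
  then show ?thesis using \<Phi>(1) pB Qb r0 box_subset_cbox[of lo hi]
    by (intro exI[of _ "box lo hi"] exI[of _ \<Phi>]) (auto simp: \<Delta>_def open_box)
qed

end

subsection \<open>Metrics and solutions of the linear system\<close>

lemma matrix_inv_2:
  fixes A :: "real^2^2"
  assumes "A $ 1 $ 1 * A $ 2 $ 2 - A $ 1 $ 2 * A $ 2 $ 1 \<noteq> 0" (is "?D \<noteq> 0")
  shows "matrix_inv A $ 1 $ 1 = A $ 2 $ 2 / ?D" "matrix_inv A $ 1 $ 2 = - A $ 1 $ 2 / ?D"
    "matrix_inv A $ 2 $ 1 = - A $ 2 $ 1 / ?D" "matrix_inv A $ 2 $ 2 = A $ 1 $ 1 / ?D"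
proof -
  define e where "e = inverse ?D"
  have e: "e * ?D = 1" using assms by (simp add: e_def)
  define B :: "real^2^2" where "B = vector [vector [A $ 2 $ 2 * e, - A $ 1 $ 2 * e], vector [- A $ 2 $ 1 * e, A $ 1 $ 1 * e]]"
  have "A ** B = mat 1" "B ** A = mat 1"
    using e by (simp_all add: vec_eq_iff forall_2 matrix_matrix_mult_def sum_2 B_def mat_def algebra_simps)
  moreover from this have "A ** matrix_inv A = mat 1"
    unfolding matrix_inv_def by (metis (mono_tags, lifting) someI_ex)
  ultimately have "matrix_inv A = B" by (metis matrix_mul_assoc matrix_mul_lid matrix_mul_rid)
  then show "matrix_inv A $ 1 $ 1 = A $ 2 $ 2 / ?D" "matrix_inv A $ 1 $ 2 = - A $ 1 $ 2 / ?D"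
    "matrix_inv A $ 2 $ 1 = - A $ 2 $ 1 / ?D" "matrix_inv A $ 2 $ 2 = A $ 1 $ 1 / ?D"
    by (simp_all add: B_def e_def divide_inverse)
qed

text \<open>The classical formulas in Gauss's notation, with \<open>H\<close> for the third
  coefficient. All entries are named by equations so that any expression known for a derivative can
  be substituted.\<close>

lemma levi_civita_2:
  fixes g :: "real^2 \<Rightarrow> real^2^2"
  assumes N: "open N" "z \<in> N" and sym: "\<And>u. u \<in> N \<Longrightarrow> g u $ 2 $ 1 = g u $ 1 $ 2"
    and D: "g z $ 1 $ 1 * g z $ 2 $ 2 - (g z $ 1 $ 2)\<^sup>2 = D" "D \<noteq> 0"
    and E: "E = g z $ 1 $ 1" "E1 = pd 1 (\<lambda>u. g u $ 1 $ 1) z" "E2 = pd 2 (\<lambda>u. g u $ 1 $ 1) z"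
    and F: "F = g z $ 1 $ 2" "F1 = pd 1 (\<lambda>u. g u $ 1 $ 2) z" "F2 = pd 2 (\<lambda>u. g u $ 1 $ 2) z"
    and H: "H = g z $ 2 $ 2" "H1 = pd 1 (\<lambda>u. g u $ 2 $ 2) z" "H2 = pd 2 (\<lambda>u. g u $ 2 $ 2) z"
  shows "levi_civita g 1 1 1 z = (H * E1 - F * (2 * F1 - E2)) / (2 * D)"
    "levi_civita g 2 1 1 z = (E * (2 * F1 - E2) - F * E1) / (2 * D)"
    "levi_civita g 1 1 2 z = (H * E2 - F * H1) / (2 * D)"
    "levi_civita g 2 1 2 z = (E * H1 - F * E2) / (2 * D)"
    "levi_civita g 1 2 2 z = (H * (2 * F2 - H1) - F * H2) / (2 * D)"
    "levi_civita g 2 2 2 z = (E * H2 - F * (2 * F2 - H1)) / (2 * D)"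
proof -
  have s: "pd a (\<lambda>u. g u $ 2 $ 1) z = pd a (\<lambda>u. g u $ 1 $ 2) z" for a
    by (rule pd_cong[OF N sym])
  have D': "g z $ 1 $ 1 * g z $ 2 $ 2 - g z $ 1 $ 2 * g z $ 2 $ 1 = D"
    using D(1) sym[OF N(2)] by (simp add: power2_eq_square)
  note inv = matrix_inv_2[of "g z", unfolded D', OF D(2)]
  show "levi_civita g 1 1 1 z = (H * E1 - F * (2 * F1 - E2)) / (2 * D)"
    "levi_civita g 2 1 1 z = (E * (2 * F1 - E2) - F * E1) / (2 * D)"
    "levi_civita g 1 1 2 z = (H * E2 - F * H1) / (2 * D)"
    "levi_civita g 2 1 2 z = (E * H1 - F * E2) / (2 * D)"
    "levi_civita g 1 2 2 z = (H * (2 * F2 - H1) - F * H2) / (2 * D)"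
    "levi_civita g 2 2 2 z = (E * H2 - F * (2 * F2 - H1)) / (2 * D)"
    unfolding levi_civita_def sum_2 inv s E F H sym[OF N(2)] using D(2)
    by (simp_all add: divide_simps algebra_simps)
qed

lemma levi_civita_symmetric:
  fixes g :: "real^2 \<Rightarrow> real^2^2"
  assumes N: "open N" "z \<in> N" and sym: "\<And>u. u \<in> N \<Longrightarrow> g u $ 2 $ 1 = g u $ 1 $ 2"
  shows "levi_civita g c a b z = levi_civita g c b a z"
proof -
  have "g u $ a $ b = g u $ b $ a" if "u \<in> N" for u
    using sym[OF that] exhaust_2[of a] exhaust_2[of b] by auto
  then have "pd d (\<lambda>u. g u $ a $ b) z = pd d (\<lambda>u. g u $ b $ a) z" for d
    by (rule pd_cong[OF N])
  then show ?thesis by (simp add: levi_civita_def algebra_simps)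
qed

lemma smooth_on_levi_civita:
  fixes g :: "real^2 \<Rightarrow> real^2^2"
  assumes N: "open N" and g: "\<And>a b. smooth_on N (\<lambda>u. g u $ a $ b)"
    and D: "\<And>u. u \<in> N \<Longrightarrow> g u $ 1 $ 1 * g u $ 2 $ 2 - g u $ 1 $ 2 * g u $ 2 $ 1 \<noteq> 0"
  shows "smooth_on N (levi_civita g c a b)"
proof -
  note sm = smooth_on_const smooth_on_add[OF N] smooth_on_diff[OF N] smooth_on_minus[OF N] smooth_on_mult[OF N]
    smooth_on_sum[OF N] smooth_on_pd g
  define D where "D u = g u $ 1 $ 1 * g u $ 2 $ 2 - g u $ 1 $ 2 * g u $ 2 $ 1" for u
  have "smooth_on N (\<lambda>u. inverse (D u))"
    unfolding D_def by (intro smooth_on_inverse[OF N] sm D)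
  then have cof: "smooth_on N (\<lambda>u. f u * inverse (D u))" if "smooth_on N f" for f
    using that by (intro sm)
  have "smooth_on N (\<lambda>u. matrix_inv (g u) $ c $ d)" for c d
  proof -
    have "smooth_on N (\<lambda>u. matrix_inv (g u) $ 1 $ 1)"
      by (rule smooth_on_cong[OF N _ cof[OF g[of 2 2]]]) (use matrix_inv_2(1) D in \<open>simp add: D_def divide_inverse\<close>)
    moreover have "smooth_on N (\<lambda>u. matrix_inv (g u) $ 1 $ 2)"
      by (rule smooth_on_cong[OF N _ cof[OF smooth_on_minus[OF N g[of 1 2]]]]) (use matrix_inv_2(2) D in \<open>simp add: D_def divide_inverse\<close>)
    moreover have "smooth_on N (\<lambda>u. matrix_inv (g u) $ 2 $ 1)"
      by (rule smooth_on_cong[OF N _ cof[OF smooth_on_minus[OF N g[of 2 1]]]]) (use matrix_inv_2(3) D in \<open>simp add: D_def divide_inverse\<close>)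
    moreover have "smooth_on N (\<lambda>u. matrix_inv (g u) $ 2 $ 2)"
      by (rule smooth_on_cong[OF N _ cof[OF g[of 1 1]]]) (use matrix_inv_2(4) D in \<open>simp add: D_def divide_inverse\<close>)
    ultimately show ?thesis using exhaust_2[of c] exhaust_2[of d] by auto
  qed
  then show ?thesis unfolding levi_civita_def[abs_def] by (intro sm)
qed

lemma metric_on_2:
  assumes "metric_on N g" "z \<in> N"
  shows "g z $ 2 $ 1 = g z $ 1 $ 2" "g z $ 1 $ 1 * g z $ 2 $ 2 - (g z $ 1 $ 2)\<^sup>2 \<noteq> 0"
proof -
  have t: "transpose (g z) = g z" and i: "invertible (g z)" using assms by (auto simp: metric_on_def)
  show s: "g z $ 2 $ 1 = g z $ 1 $ 2"
    using t by (simp add: vec_eq_iff transpose_def)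
  have "det (g z) \<noteq> 0" using i by (simp add: invertible_det_nz)
  then show "g z $ 1 $ 1 * g z $ 2 $ 2 - (g z $ 1 $ 2)\<^sup>2 \<noteq> 0"
    by (simp add: det_2 s power2_eq_square)
qed

lemma torsion_free_subset:
  "open U \<Longrightarrow> N \<subseteq> U \<Longrightarrow> torsion_free_connection_on U \<Gamma> \<Longrightarrow> torsion_free_connection_on N \<Gamma>"
  unfolding torsion_free_connection_on_def using smooth_on_subset by blast

text \<open>The one-form is read off from the coefficients with lower indices 1 and 2, where exactly
  one Kronecker delta survives; the other coefficients then agree because the four invariants
  do.\<close>

lemma projective_rel_if_A_eq:
  assumes N: "open N" and tf: "torsion_free_connection_on N \<Gamma>" "torsion_free_connection_on N \<Gamma>'"
    and A: "\<And>z. z \<in> N \<Longrightarrow> A0 \<Gamma>' z = A0 \<Gamma> z" "\<And>z. z \<in> N \<Longrightarrow> A1 \<Gamma>' z = A1 \<Gamma> z"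
      "\<And>z. z \<in> N \<Longrightarrow> A2 \<Gamma>' z = A2 \<Gamma> z" "\<And>z. z \<in> N \<Longrightarrow> A3 \<Gamma>' z = A3 \<Gamma> z"
  shows "(\<Gamma>, \<Gamma>') \<in> projective_rel N"
proof -
  define \<omega> :: "2 \<Rightarrow> real^2 \<Rightarrow> real" where
    "\<omega> a = (if a = 1 then (\<lambda>z. \<Gamma>' 2 1 2 z - \<Gamma> 2 1 2 z) else (\<lambda>z. \<Gamma>' 1 1 2 z - \<Gamma> 1 1 2 z))" for a
  have "smooth_on N (\<omega> a)" for a
    using tf by (auto simp: \<omega>_def torsion_free_connection_on_def intro: smooth_on_diff[OF N])
  moreover have "\<Gamma>' c a b z = \<Gamma> c a b z + kdelta c a * \<omega> b z + kdelta c b * \<omega> a z" if z: "z \<in> N" for c a b z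
  proof -
    have t: "\<Gamma> c 2 1 z = \<Gamma> c 1 2 z" "\<Gamma>' c 2 1 z = \<Gamma>' c 1 2 z" for c
      using tf z unfolding torsion_free_connection_on_def by blast+
    have "\<forall>c a b. \<Gamma>' c a b z = \<Gamma> c a b z + kdelta c a * \<omega> b z + kdelta c b * \<omega> a z"
      using A[OF z] unfolding forall_2 A0_def A1_def A2_def A3_def kdelta_def \<omega>_def t by simp
    then show ?thesis by blast
  qed
  ultimately show ?thesis
    using tf unfolding projective_rel_def projectively_equivalent_on_def by blast
qed

text \<open>Suffixes \<open>1\<close> and \<open>2\<close> stand for partial derivatives. The linear system does not determine all first
  derivatives of \<open>\<psi>\<close>: \<open>\<mu>\<close> and \<open>\<nu>\<close> are the free ones.\<close>

lemma levi_civita_of_solution: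
  fixes \<psi>1 \<psi>2 \<psi>3 \<Delta> :: real
  assumes \<Delta>: "\<Delta> = \<psi>1 * \<psi>3 - \<psi>2\<^sup>2" "\<Delta> \<noteq> 0"
    and D: "D = 1 / \<Delta> ^ 3"
    and P: "P1 = 2/3 * a1 * \<psi>1 - 2 * a0 * \<psi>2" "P2 = 4/3 * a2 * \<psi>1 - 2/3 * a1 * \<psi>2 - 2 * a0 * \<psi>3 - \<mu>"
    and Q: "Q1 = \<mu> / 2" "Q2 = \<nu> / 2"
    and R: "R1 = 2 * a3 * \<psi>1 + 2/3 * a2 * \<psi>2 - 4/3 * a1 * \<psi>3 - \<nu>" "R2 = 2 * a3 * \<psi>2 - 2/3 * a2 * \<psi>3"
    and \<Delta>': "\<Delta>1 = P1 * \<psi>3 + \<psi>1 * R1 - 2 * \<psi>2 * Q1" "\<Delta>2 = P2 * \<psi>3 + \<psi>1 * R2 - 2 * \<psi>2 * Q2"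
    and E: "E = \<psi>1 / \<Delta>\<^sup>2" "E1 = (P1 * \<Delta> - 2 * \<psi>1 * \<Delta>1) / \<Delta> ^ 3" "E2 = (P2 * \<Delta> - 2 * \<psi>1 * \<Delta>2) / \<Delta> ^ 3"
    and F: "F = \<psi>2 / \<Delta>\<^sup>2" "F1 = (Q1 * \<Delta> - 2 * \<psi>2 * \<Delta>1) / \<Delta> ^ 3" "F2 = (Q2 * \<Delta> - 2 * \<psi>2 * \<Delta>2) / \<Delta> ^ 3"
    and H: "H = \<psi>3 / \<Delta>\<^sup>2" "H1 = (R1 * \<Delta> - 2 * \<psi>3 * \<Delta>1) / \<Delta> ^ 3" "H2 = (R2 * \<Delta> - 2 * \<psi>3 * \<Delta>2) / \<Delta> ^ 3"
  shows "- ((E * (2 * F1 - E2) - F * E1) / (2 * D)) = a0"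
    "(H * E1 - F * (2 * F1 - E2)) / (2 * D) - 2 * ((E * H1 - F * E2) / (2 * D)) = a1"
    "2 * ((H * E2 - F * H1) / (2 * D)) - (E * H2 - F * (2 * F2 - H1)) / (2 * D) = a2"
    "(H * (2 * F2 - H1) - F * H2) / (2 * D) = a3"
proof -
  \<comment> \<open>The numerators of the derivatives of \<open>E\<close>, \<open>F\<close>,
    \<open>H\<close>. Keeping them opaque separates the cancellation of powers of
    \<open>\<Delta>\<close> in \<open>r\<close> from the polynomial identities in \<open>p\<close>,
    where \<open>\<Delta>\<close> is expanded.\<close>
  define e1 where "e1 = P1 * \<Delta> - 2 * \<psi>1 * \<Delta>1" define e2 where "e2 = P2 * \<Delta> - 2 * \<psi>1 * \<Delta>2"
  define f1 where "f1 = Q1 * \<Delta> - 2 * \<psi>2 * \<Delta>1" define f2 where "f2 = Q2 * \<Delta> - 2 * \<psi>2 * \<Delta>2"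
  define h1 where "h1 = R1 * \<Delta> - 2 * \<psi>3 * \<Delta>1" define h2 where "h2 = R2 * \<Delta> - 2 * \<psi>3 * \<Delta>2"
  note efh = E F H e1_def[symmetric] e2_def[symmetric] f1_def[symmetric] f2_def[symmetric] h1_def[symmetric] h2_def[symmetric]
  have r: "- ((E * (2 * F1 - E2) - F * E1) / (2 * D)) = - (\<psi>1 * (2 * f1 - e2) - \<psi>2 * e1) / (2 * \<Delta>\<^sup>2)"
    "(H * E1 - F * (2 * F1 - E2)) / (2 * D) - 2 * ((E * H1 - F * E2) / (2 * D))
      = (\<psi>3 * e1 - \<psi>2 * (2 * f1 - e2) - 2 * (\<psi>1 * h1 - \<psi>2 * e2)) / (2 * \<Delta>\<^sup>2)"
    "2 * ((H * E2 - F * H1) / (2 * D)) - (E * H2 - F * (2 * F2 - H1)) / (2 * D)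
      = (2 * (\<psi>3 * e2 - \<psi>2 * h1) - (\<psi>1 * h2 - \<psi>2 * (2 * f2 - h1))) / (2 * \<Delta>\<^sup>2)"
    "(H * (2 * F2 - H1) - F * H2) / (2 * D) = (\<psi>3 * (2 * f2 - h1) - \<psi>2 * h2) / (2 * \<Delta>\<^sup>2)"
    unfolding efh D using \<Delta>(2) by (simp_all add: divide_simps) (simp_all add: algebra_simps eval_nat_numeral)
  have p: "- (\<psi>1 * (2 * f1 - e2) - \<psi>2 * e1) = a0 * (2 * \<Delta>\<^sup>2)"
    "\<psi>3 * e1 - \<psi>2 * (2 * f1 - e2) - 2 * (\<psi>1 * h1 - \<psi>2 * e2) = a1 * (2 * \<Delta>\<^sup>2)"
    "2 * (\<psi>3 * e2 - \<psi>2 * h1) - (\<psi>1 * h2 - \<psi>2 * (2 * f2 - h1)) = a2 * (2 * \<Delta>\<^sup>2)"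
    "\<psi>3 * (2 * f2 - h1) - \<psi>2 * h2 = a3 * (2 * \<Delta>\<^sup>2)"
    unfolding e1_def e2_def f1_def f2_def h1_def h2_def \<Delta>' P Q R \<Delta>(1)
    by (simp_all add: field_simps power2_eq_square)
  show "- ((E * (2 * F1 - E2) - F * E1) / (2 * D)) = a0"
    "(H * E1 - F * (2 * F1 - E2)) / (2 * D) - 2 * ((E * H1 - F * E2) / (2 * D)) = a1"
    "2 * ((H * E2 - F * H1) / (2 * D)) - (E * H2 - F * (2 * F2 - H1)) / (2 * D) = a2"
    "(H * (2 * F2 - H1) - F * H2) / (2 * D) = a3"
    unfolding r p using \<Delta>(2) by simp_all
qed

text \<open>The linear system for \<open>\<psi> = \<bar>D\<bar> powr (-2/3) * g\<close>, divided by the common factor \<open>\<bar>D\<bar> powr (-2/3)\<close>.\<close>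

lemma solution_of_levi_civita:
  fixes E F H D :: real
  assumes D: "D = E * H - F\<^sup>2" "D \<noteq> 0"
    and D': "D1 = E1 * H + E * H1 - 2 * F * F1" "D2 = E2 * H + E * H2 - 2 * F * F2"
    and A: "a0 = - ((E * (2 * F1 - E2) - F * E1) / (2 * D))"
      "a1 = (H * E1 - F * (2 * F1 - E2)) / (2 * D) - 2 * ((E * H1 - F * E2) / (2 * D))"
      "a2 = 2 * ((H * E2 - F * H1) / (2 * D)) - (E * H2 - F * (2 * F2 - H1)) / (2 * D)"
      "a3 = (H * (2 * F2 - H1) - F * H2) / (2 * D)"
  shows "E1 - 2/3 * E * D1 / D = 2/3 * a1 * E - 2 * a0 * F"
    "H2 - 2/3 * H * D2 / D = 2 * a3 * F - 2/3 * a2 * H"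
    "(E2 - 2/3 * E * D2 / D) + 2 * (F1 - 2/3 * F * D1 / D) = 4/3 * a2 * E - 2/3 * a1 * F - 2 * a0 * H"
    "(H1 - 2/3 * H * D1 / D) + 2 * (F2 - 2/3 * F * D2 / D) = 2 * a3 * E - 4/3 * a1 * H + 2/3 * a2 * F"
proof -
  \<comment> \<open>The invariants multiplied by \<open>2 * D\<close>. After multiplication by
    \<open>6 * D\<close> the four equations become the polynomial identities in
    \<open>p\<close>.\<close>
  define B0 where "B0 = - (E * (2 * F1 - E2) - F * E1)"
  define B1 where "B1 = (H * E1 - F * (2 * F1 - E2)) - 2 * (E * H1 - F * E2)"
  define B2 where "B2 = 2 * (H * E2 - F * H1) - (E * H2 - F * (2 * F2 - H1))"
  define B3 where "B3 = H * (2 * F2 - H1) - F * H2"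
  have B: "a0 = B0 / (2 * D)" "a1 = B1 / (2 * D)" "a2 = B2 / (2 * D)" "a3 = B3 / (2 * D)"
    unfolding A B0_def B1_def B2_def B3_def by (simp_all add: diff_divide_distrib)
  have p: "6 * D * E1 - 4 * E * D1 = 2 * B1 * E - 6 * B0 * F"
    "6 * D * H2 - 4 * H * D2 = 6 * B3 * F - 2 * B2 * H"
    "(6 * D * E2 - 4 * E * D2) + 2 * (6 * D * F1 - 4 * F * D1) = 4 * B2 * E - 2 * B1 * F - 6 * B0 * H"
    "(6 * D * H1 - 4 * H * D1) + 2 * (6 * D * F2 - 4 * F * D2) = 6 * B3 * E - 4 * B1 * H + 2 * B2 * F"
    unfolding B0_def B1_def B2_def B3_def D' D(1) by (simp_all add: algebra_simps power2_eq_square)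
  show "E1 - 2/3 * E * D1 / D = 2/3 * a1 * E - 2 * a0 * F"
    "H2 - 2/3 * H * D2 / D = 2 * a3 * F - 2/3 * a2 * H"
    "(E2 - 2/3 * E * D2 / D) + 2 * (F1 - 2/3 * F * D1 / D) = 4/3 * a2 * E - 2/3 * a1 * F - 2 * a0 * H"
    "(H1 - 2/3 * H * D1 / D) + 2 * (F2 - 2/3 * F * D2 / D) = 2 * a3 * E - 4/3 * a1 * H + 2/3 * a2 * F"
    unfolding B using p D(2) by (simp_all add: divide_simps) (simp_all add: algebra_simps)
qed

lemma pd_divide_square:
  assumes N: "open N" and z: "z \<in> N" and sm: "smooth_on N f" "smooth_on N D" and D: "D z \<noteq> 0"
  shows "pd a (\<lambda>u. f u / (D u)\<^sup>2) z = (pd a f z * D z - 2 * f z * pd a D z) / D z ^ 3"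
proof (rule pd_eq)
  note d = pd_line[OF smooth_on_differentiable[OF N _ z], of _ a]
  have "((\<lambda>t. f (z + t *\<^sub>R axis a 1) / (D (z + t *\<^sub>R axis a 1))\<^sup>2) has_real_derivative
    (pd a f z * (D z)\<^sup>2 - f z * (2 * D z * pd a D z)) / ((D z)\<^sup>2 * (D z)\<^sup>2)) (at 0)"
    using D by (auto intro!: derivative_eq_intros d sm)
  moreover have "(pd a f z * (D z)\<^sup>2 - f z * (2 * D z * pd a D z)) / ((D z)\<^sup>2 * (D z)\<^sup>2)
    = (pd a f z * D z - 2 * f z * pd a D z) / D z ^ 3"
    using D by (simp add: field_simps eval_nat_numeral)
  ultimately show "((\<lambda>t. f (z + t *\<^sub>R axis a 1) / (D (z + t *\<^sub>R axis a 1))\<^sup>2) has_real_derivative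
    (pd a f z * D z - 2 * f z * pd a D z) / D z ^ 3) (at 0)" by simp
qed

text \<open>The square makes the base of the real power positive for either sign of
  \<open>D\<close>, so this is the weight |D|^(-2/3) in every signature.\<close>

lemma pd_times_powr:
  assumes N: "open N" and z: "z \<in> N" and sm: "smooth_on N f" "smooth_on N D" and D: "D z \<noteq> 0"
  shows "pd a (\<lambda>u. f u * ((D u)\<^sup>2) powr (-1/3)) z
    = ((D z)\<^sup>2) powr (-1/3) * (pd a f z - 2/3 * f z * pd a D z / D z)"
proof (rule pd_eq)
  note d = pd_line[OF smooth_on_differentiable[OF N _ z], of _ a]
  let ?l = "\<lambda>t. z + t *\<^sub>R axis a (1::real)"
  have sq: "((\<lambda>t. (D (?l t))\<^sup>2) has_real_derivative 2 * D z * pd a D z) (at 0)"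
    by (auto intro!: derivative_eq_intros d sm)
  have "((\<lambda>x. x powr (-1/3)) has_real_derivative (-1/3) * ((D z)\<^sup>2) powr (-1/3 - 1)) (at ((D (?l 0))\<^sup>2))"
    using D has_real_derivative_powr[of "(D z)\<^sup>2" "-1/3"] by simp
  from DERIV_chain2[OF this sq]
  have "((\<lambda>t. ((D (?l t))\<^sup>2) powr (-1/3)) has_real_derivative (-1/3) * ((D z)\<^sup>2) powr (-1/3 - 1) * (2 * D z * pd a D z)) (at 0)" .
  from DERIV_mult[OF d[OF sm(1)] this]
  have "((\<lambda>t. f (?l t) * ((D (?l t))\<^sup>2) powr (-1/3)) has_real_derivative
    pd a f z * ((D z)\<^sup>2) powr (-1/3) + (-1/3) * ((D z)\<^sup>2) powr (-1/3 - 1) * (2 * D z * pd a D z) * f z) (at 0)" by simp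
  moreover have pw: "((D z)\<^sup>2) powr (-1/3 - 1) = ((D z)\<^sup>2) powr (-1/3) / (D z)\<^sup>2"
    using D powr_diff[of "(D z)\<^sup>2" "-1/3" 1] by simp
  moreover have "pd a f z * W + (-1/3) * (W / (D z)\<^sup>2) * (2 * D z * pd a D z) * f z = W * (pd a f z - 2/3 * f z * pd a D z / D z)" for W
    using D by (simp add: field_simps power2_eq_square)
  ultimately show "((\<lambda>t. f (?l t) * ((D (?l t))\<^sup>2) powr (-1/3)) has_real_derivative
    ((D z)\<^sup>2) powr (-1/3) * (pd a f z - 2/3 * f z * pd a D z / D z)) (at 0)" by (simp only: pw)
qed

section \<open>Metrics correspond to nondegenerate parallel sections\<close>

context analytic_chart
begin

text \<open>The rows that can be read off directly: rows 1 to 3 are the linear system together with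
  the meaning of mu and nu, and the two simple rows for mu and nu introduce rho. The rest is
  obtained from integrability.\<close>

lemma Omega_mult_nth:
  "(Omega 1 \<Gamma> z *v v) $ 1 = - 2/3 * A1 \<Gamma> z * v $ 1 + 2 * A0 \<Gamma> z * v $ 2"
  "(Omega 1 \<Gamma> z *v v) $ 2 = - 1/2 * v $ 4"
  "(Omega 1 \<Gamma> z *v v) $ 3 = - 2 * A3 \<Gamma> z * v $ 1 - 2/3 * A2 \<Gamma> z * v $ 2 + 4/3 * A1 \<Gamma> z * v $ 3 + v $ 5"
  "(Omega 1 \<Gamma> z *v v) $ 5 = - v $ 6"
  "(Omega 2 \<Gamma> z *v v) $ 1 = - 4/3 * A2 \<Gamma> z * v $ 1 + 2/3 * A1 \<Gamma> z * v $ 2 + 2 * A0 \<Gamma> z * v $ 3 + v $ 4"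
  "(Omega 2 \<Gamma> z *v v) $ 2 = - 1/2 * v $ 5"
  "(Omega 2 \<Gamma> z *v v) $ 3 = - 2 * A3 \<Gamma> z * v $ 2 + 2/3 * A2 \<Gamma> z * v $ 3"
  "(Omega 2 \<Gamma> z *v v) $ 4 = - v $ 6"
  unfolding matrix_vector_mult_def vec_lambda_beta sum_6 Omega_12 Omega_nth by simp_all

text \<open>The equations \<open>d\<Phi> + \<Omega>\<Phi> = 0\<close> for one row \<open>i\<close> yield a linear relation between the failures
  of the other rows: this is how the prolongation closes up.\<close>

lemma integrability_relation:
  assumes N: "open N" "N \<subseteq> S" and sm: "\<And>k. smooth_on N (\<lambda>u. \<Phi> u $ k)"
    and row: "\<And>z a. z \<in> N \<Longrightarrow> pd a (\<lambda>u. \<Phi> u $ i) z = - (Omega a \<Gamma> z *v \<Phi> z) $ i" and z: "z \<in> N"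
  defines "e \<equiv> \<lambda>a k. pd a (\<lambda>u. \<Phi> u $ k) z + (Omega a \<Gamma> z *v \<Phi> z) $ k"
  shows "(\<Sum>k\<in>UNIV. Omega1 \<Gamma> z $ i $ k * e 2 k) - (\<Sum>k\<in>UNIV. Omega2 \<Gamma> z $ i $ k * e 1 k)
    = (if i = 6 then Vrow \<Gamma> z \<bullet> \<Phi> z else 0)"
proof -
  have zS: "z \<in> S" using z N by blast
  have smO: "smooth_on N (\<lambda>u. Omega b \<Gamma> u $ i $ k)" for b i k
    by (rule smooth_on_subset[OF open_S N(2) smooth_Omega])
  have dd: "pd a (pd b (\<lambda>u. \<Phi> u $ i)) z
    = - (\<Sum>k\<in>UNIV. pd a (\<lambda>u. Omega b \<Gamma> u $ i $ k) z * \<Phi> z $ k + Omega b \<Gamma> z $ i $ k * pd a (\<lambda>u. \<Phi> u $ k) z)" for a b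
  proof -
    have "pd a (pd b (\<lambda>u. \<Phi> u $ i)) z = pd a (\<lambda>u. - (\<Sum>k\<in>UNIV. Omega b \<Gamma> u $ i $ k * \<Phi> u $ k)) z"
      by (rule pd_cong[OF N(1) z]) (use row in \<open>simp add: matrix_vector_mult_def\<close>)
    also have "\<dots> = - pd a (\<lambda>u. \<Sum>k\<in>UNIV. Omega b \<Gamma> u $ i $ k * \<Phi> u $ k) z"
      by (intro pd_minus smooth_on_differentiable[OF N(1) _ z] smooth_on_sum[OF N(1)] smooth_on_mult[OF N(1)] smO sm)
    also have "pd a (\<lambda>u. \<Sum>k\<in>UNIV. Omega b \<Gamma> u $ i $ k * \<Phi> u $ k) z = (\<Sum>k\<in>UNIV. pd a (\<lambda>u. Omega b \<Gamma> u $ i $ k * \<Phi> u $ k) z)"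
      by (intro pd_sum smooth_on_differentiable[OF N(1) _ z] smooth_on_mult[OF N(1)] smO sm)
    also have "\<dots> = (\<Sum>k\<in>UNIV. pd a (\<lambda>u. Omega b \<Gamma> u $ i $ k) z * \<Phi> z $ k + Omega b \<Gamma> z $ i $ k * pd a (\<lambda>u. \<Phi> u $ k) z)"
      by (intro sum.cong refl pd_mult smooth_on_differentiable[OF N(1) _ z] smO sm)
    finally show ?thesis .
  qed
  have "pd 1 (pd 2 (\<lambda>u. \<Phi> u $ i)) z = pd 2 (pd 1 (\<lambda>u. \<Phi> u $ i)) z"
    by (rule smooth_pd_commute[OF N(1) sm z])
  then have comm: "(\<Sum>k\<in>UNIV. pd 1 (\<lambda>u. Omega2 \<Gamma> u $ i $ k) z * \<Phi> z $ k + Omega2 \<Gamma> z $ i $ k * pd 1 (\<lambda>u. \<Phi> u $ k) z)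
    = (\<Sum>k\<in>UNIV. pd 2 (\<lambda>u. Omega1 \<Gamma> u $ i $ k) z * \<Phi> z $ k + Omega1 \<Gamma> z $ i $ k * pd 2 (\<lambda>u. \<Phi> u $ k) z)"
    unfolding dd Omega_12 by simp
  have mm: "(\<Sum>k\<in>UNIV. A $ i $ k * (B *v \<Phi> z) $ k) = (\<Sum>j\<in>UNIV. (\<Sum>k\<in>UNIV. A $ i $ k * B $ k $ j) * \<Phi> z $ j)" for A B :: "real^6^6"
    unfolding matrix_vector_mult_def vec_lambda_beta sum_distrib_left sum_distrib_right
    by (subst sum.swap) (simp add: mult.assoc)
  have "(\<Sum>k\<in>UNIV. Omega1 \<Gamma> z $ i $ k * e 2 k) - (\<Sum>k\<in>UNIV. Omega2 \<Gamma> z $ i $ k * e 1 k)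
    = (\<Sum>j\<in>UNIV. (pd 1 (\<lambda>u. Omega2 \<Gamma> u $ i $ j) z - pd 2 (\<lambda>u. Omega1 \<Gamma> u $ i $ j) z
     + (\<Sum>k\<in>UNIV. Omega1 \<Gamma> z $ i $ k * Omega2 \<Gamma> z $ k $ j) - (\<Sum>k\<in>UNIV. Omega2 \<Gamma> z $ i $ k * Omega1 \<Gamma> z $ k $ j)) * \<Phi> z $ j)"
    using comm unfolding e_def Omega_12 distrib_left sum.distrib mm
    by (simp add: left_diff_distrib distrib_right sum_subtractf sum.distrib)
  also have "\<dots> = (\<Sum>j\<in>UNIV. (if i = 6 then Vrow \<Gamma> z $ j else 0) * \<Phi> z $ j)"
    unfolding curvature[OF zS] ..
  also have "\<dots> = (if i = 6 then Vrow \<Gamma> z \<bullet> \<Phi> z else 0)" by (simp add: inner_vec_def)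
  finally show ?thesis .
qed

lemma parallel_onI:
  assumes N: "open N" and sm: "\<And>k. smooth_on N (\<lambda>u. \<Phi> u $ k)"
    and pd: "\<And>z a k. z \<in> N \<Longrightarrow> pd a (\<lambda>u. \<Phi> u $ k) z = - (Omega a \<Gamma> z *v \<Phi> z) $ k"
  shows "parallel_on N \<Phi>"
  unfolding parallel_on_def
proof (intro conjI ballI allI)
  show "continuous_on N \<Phi>" by (intro continuous_on_cart smooth_on_continuous sm)
  fix z a assume z: "z \<in> N"
  show "((\<lambda>t. \<Phi> (z + t *\<^sub>R axis a 1)) has_vector_derivative - (Omega a \<Gamma> z *v \<Phi> z)) (at 0)"
  proof (rule has_vector_derivative_cart)
    fix k show "((\<lambda>t. \<Phi> (z + t *\<^sub>R axis a 1) $ k) has_vector_derivative (- (Omega a \<Gamma> z *v \<Phi> z)) $ k) (at 0)"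
      using pd_line[OF smooth_on_differentiable[OF N sm z], of a k] pd[OF z, of a k]
      by (simp add: has_real_derivative_iff_has_vector_derivative)
  qed
qed

text \<open>For a parallel section every failure in \<open>integrability_relation\<close> is zero,
  so row 6 leaves the pairing with \<open>Vrow\<close>. Differentiating an identically zero pairing
  then gives all higher orders.\<close>

lemma parallel_annihilated:
  assumes N: "open N" "N \<subseteq> S" and par: "parallel_on N \<Phi>" and z: "z \<in> N"
  shows "covD_iter \<Gamma> as (Vrow \<Gamma>) z \<bullet> \<Phi> z = 0"
  using z
proof (induction as arbitrary: z)
  case Nil
  have "0 = Vrow \<Gamma> z \<bullet> \<Phi> z"
    using integrability_relation[OF N parallel_on_smooth(1)[OF N par] parallel_on_smooth(2)[OF N par] Nil, of 6]
      parallel_on_smooth(2)[OF N par Nil] by simp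
  then show ?case by (simp add: covD_iter_def)
next
  case (Cons a as)
  let ?X = "covD_iter \<Gamma> as (Vrow \<Gamma>)"
  have "((\<lambda>t. \<Phi> (z + t *\<^sub>R axis a 1)) has_vector_derivative - (Omega a \<Gamma> z *v \<Phi> z)) (at 0)"
    using par Cons.prems by (simp add: parallel_on_def)
  from covD_pairing[OF smooth_vec_jet _ this, of as] Cons.prems N
  have "pd a (\<lambda>u. ?X u \<bullet> \<Phi> u) z = covD \<Gamma> a ?X z \<bullet> \<Phi> z" by (intro pd_eq) auto
  moreover have "pd a (\<lambda>u. ?X u \<bullet> \<Phi> u) z = pd a (\<lambda>u. 0) z"
    by (rule pd_cong[OF N(1) Cons.prems Cons.IH])
  ultimately show ?case by (simp add: covD_iter_Cons)
qed

text \<open>The rescaled metric solves the linear system of rows 1 to 3 once mu and nu are named.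
  The remaining equations are not computed: each is the single failure left over in the
  integrability relation of a row already known.\<close>

lemma metric_imp_parallel:
  assumes N: "open N" "N \<subseteq> S" and g: "metric_on N g"
    and A: "\<And>z. z \<in> N \<Longrightarrow> A0 (levi_civita g) z = A0 \<Gamma> z" "\<And>z. z \<in> N \<Longrightarrow> A1 (levi_civita g) z = A1 \<Gamma> z"
      "\<And>z. z \<in> N \<Longrightarrow> A2 (levi_civita g) z = A2 \<Gamma> z" "\<And>z. z \<in> N \<Longrightarrow> A3 (levi_civita g) z = A3 \<Gamma> z"
  shows "\<exists>\<Phi>. parallel_on N \<Phi> \<and> (\<forall>z\<in>N. \<Phi> z $ 1 * \<Phi> z $ 3 - (\<Phi> z $ 2)\<^sup>2 \<noteq> 0)"
proof -
  define E where "E u = g u $ 1 $ 1" for u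
  define F where "F u = g u $ 1 $ 2" for u
  define H where "H u = g u $ 2 $ 2" for u
  define D where "D u = E u * H u - (F u)\<^sup>2" for u
  have D0: "D z \<noteq> 0" if "z \<in> N" for z
    using metric_on_2(2)[OF g that] by (simp add: D_def E_def F_def H_def)
  note smN = smooth_on_const smooth_on_add[OF N(1)] smooth_on_diff[OF N(1)] smooth_on_mult[OF N(1)]
    smooth_on_power[OF N(1)] smooth_on_pd
  have smE: "smooth_on N E" "smooth_on N F" "smooth_on N H"
    unfolding E_def[abs_def] F_def[abs_def] H_def[abs_def] using g by (simp_all add: metric_on_def)
  have smD: "smooth_on N D" unfolding D_def[abs_def] by (intro smN smE)
  \<comment> \<open>The weight |D|^(-2/3), which undoes g = psi / Delta^2.\<close>
  define w where "w u = ((D u)\<^sup>2) powr (-1/3)" for u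
  have smw: "smooth_on N w" unfolding w_def[abs_def]
    by (intro smooth_on_powr[OF N(1)] smN smD) (simp add: D0)
  have w0: "w z \<noteq> 0" if "z \<in> N" for z using D0[OF that] by (simp add: w_def)
  define p1 where "p1 u = E u * w u" for u
  define p2 where "p2 u = F u * w u" for u
  define p3 where "p3 u = H u * w u" for u
  have smp: "smooth_on N p1" "smooth_on N p2" "smooth_on N p3"
    unfolding p1_def[abs_def] p2_def[abs_def] p3_def[abs_def] by (intro smN smE smw)+
  \<comment> \<open>Row 2 forces entries 4 and 5 to be twice the first derivatives of
    \<open>p2\<close>. Entry 6 is then their common mixed derivative, which settles one equation
    each of rows 4 and 5.\<close>
  define \<Phi> :: "real^2 \<Rightarrow> real^6" where
    "\<Phi> u = vector [p1 u, p2 u, p3 u, 2 * pd 1 p2 u, 2 * pd 2 p2 u, 2 * pd 1 (pd 2 p2) u]" for u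
  have \<Phi>: "\<Phi> u $ 1 = p1 u" "\<Phi> u $ 2 = p2 u" "\<Phi> u $ 3 = p3 u" "\<Phi> u $ 4 = 2 * pd 1 p2 u" "\<Phi> u $ 5 = 2 * pd 2 p2 u"
    "\<Phi> u $ 6 = 2 * pd 1 (pd 2 p2) u" for u
    unfolding \<Phi>_def by (simp_all only: vector_6)
  have sm: "smooth_on N (\<lambda>u. \<Phi> u $ k)" for k
  proof -
    have "\<forall>k. smooth_on N (\<lambda>u. \<Phi> u $ k)" unfolding forall_6 \<Phi> by (intro conjI smN smp)
    then show ?thesis by blast
  qed
  have liouville: "pd 1 p1 z = 2/3 * A1 \<Gamma> z * p1 z - 2 * A0 \<Gamma> z * p2 z"
    "pd 2 p3 z = 2 * A3 \<Gamma> z * p2 z - 2/3 * A2 \<Gamma> z * p3 z"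
    "pd 2 p1 z + 2 * pd 1 p2 z = 4/3 * A2 \<Gamma> z * p1 z - 2/3 * A1 \<Gamma> z * p2 z - 2 * A0 \<Gamma> z * p3 z"
    "pd 1 p3 z + 2 * pd 2 p2 z = 2 * A3 \<Gamma> z * p1 z - 4/3 * A1 \<Gamma> z * p3 z + 2/3 * A2 \<Gamma> z * p2 z"
    if z: "z \<in> N" for z
  proof -
    note dN = smooth_on_differentiable[OF N(1) _ z]
    have dD: "pd a D z = pd a E z * H z + E z * pd a H z - 2 * F z * pd a F z" for a
    proof -
      have "pd a D z = pd a (\<lambda>u. E u * H u - F u * F u) z" by (simp add: D_def[abs_def] power2_eq_square)
      also have "\<dots> = pd a (\<lambda>u. E u * H u) z - pd a (\<lambda>u. F u * F u) z"
        by (intro pd_diff dN smN smE)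
      also have "\<dots> = pd a E z * H z + E z * pd a H z - 2 * F z * pd a F z"
        by (simp add: pd_mult dN smE)
      finally show ?thesis .
    qed
    have dp: "pd a p1 z = w z * (pd a E z - 2/3 * E z * pd a D z / D z)"
      "pd a p2 z = w z * (pd a F z - 2/3 * F z * pd a D z / D z)"
      "pd a p3 z = w z * (pd a H z - 2/3 * H z * pd a D z / D z)" for a
      using pd_times_powr[OF N(1) z _ smD D0[OF z]] smE
      unfolding p1_def[abs_def] p2_def[abs_def] p3_def[abs_def] w_def[abs_def] by blast+
    note lc = levi_civita_2[OF N(1) z metric_on_2(1)[OF g], where D = "D z", OF _ _ D0[OF z] refl refl refl refl refl refl refl refl refl]
    have lcs: "levi_civita g 1 1 1 z = (H z * pd 1 E z - F z * (2 * pd 1 F z - pd 2 E z)) / (2 * D z)"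
      "levi_civita g 2 1 1 z = (E z * (2 * pd 1 F z - pd 2 E z) - F z * pd 1 E z) / (2 * D z)"
      "levi_civita g 1 1 2 z = (H z * pd 2 E z - F z * pd 1 H z) / (2 * D z)"
      "levi_civita g 2 1 2 z = (E z * pd 1 H z - F z * pd 2 E z) / (2 * D z)"
      "levi_civita g 1 2 2 z = (H z * (2 * pd 2 F z - pd 1 H z) - F z * pd 2 H z) / (2 * D z)"
      "levi_civita g 2 2 2 z = (E z * pd 2 H z - F z * (2 * pd 2 F z - pd 1 H z)) / (2 * D z)"
      by (rule lc[folded E_def F_def H_def]; simp add: D_def)+
    have A': "A0 \<Gamma> z = - ((E z * (2 * pd 1 F z - pd 2 E z) - F z * pd 1 E z) / (2 * D z))"
      "A1 \<Gamma> z = (H z * pd 1 E z - F z * (2 * pd 1 F z - pd 2 E z)) / (2 * D z) - 2 * ((E z * pd 1 H z - F z * pd 2 E z) / (2 * D z))"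
      "A2 \<Gamma> z = 2 * ((H z * pd 2 E z - F z * pd 1 H z) / (2 * D z)) - (E z * pd 2 H z - F z * (2 * pd 2 F z - pd 1 H z)) / (2 * D z)"
      "A3 \<Gamma> z = (H z * (2 * pd 2 F z - pd 1 H z) - F z * pd 2 H z) / (2 * D z)"
      using A[OF z] lcs unfolding A0_def A1_def A2_def A3_def by simp_all
    note sol = solution_of_levi_civita[OF D_def[of z] D0[OF z] dD dD A']
    show "pd 1 p1 z = 2/3 * A1 \<Gamma> z * p1 z - 2 * A0 \<Gamma> z * p2 z"
      unfolding dp sol p1_def p2_def p3_def by (simp add: algebra_simps)
    show "pd 2 p3 z = 2 * A3 \<Gamma> z * p2 z - 2/3 * A2 \<Gamma> z * p3 z"
      unfolding dp sol p1_def p2_def p3_def by (simp add: algebra_simps)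
    have "pd 2 p1 z + 2 * pd 1 p2 z = w z * ((pd 2 E z - 2/3 * E z * pd 2 D z / D z) + 2 * (pd 1 F z - 2/3 * F z * pd 1 D z / D z))"
      unfolding dp by (simp only: distrib_left mult.left_commute)
    then show "pd 2 p1 z + 2 * pd 1 p2 z = 4/3 * A2 \<Gamma> z * p1 z - 2/3 * A1 \<Gamma> z * p2 z - 2 * A0 \<Gamma> z * p3 z"
      unfolding sol p1_def p2_def p3_def by (simp add: algebra_simps)
    have "pd 1 p3 z + 2 * pd 2 p2 z = w z * ((pd 1 H z - 2/3 * H z * pd 1 D z / D z) + 2 * (pd 2 F z - 2/3 * F z * pd 2 D z / D z))"
      unfolding dp by (simp only: distrib_left mult.left_commute)
    then show "pd 1 p3 z + 2 * pd 2 p2 z = 2 * A3 \<Gamma> z * p1 z - 4/3 * A1 \<Gamma> z * p3 z + 2/3 * A2 \<Gamma> z * p2 z"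
      unfolding sol p1_def p2_def p3_def by (simp add: algebra_simps)
  qed
  define R where "R k \<longleftrightarrow> (\<forall>z\<in>N. \<forall>a. pd a (\<lambda>u. \<Phi> u $ k) z = - (Omega a \<Gamma> z *v \<Phi> z) $ k)" for k
  have cm: "pd a (\<lambda>u. 2 * f u) z = 2 * pd a f z" if "z \<in> N" "smooth_on N f" for a f z
    by (intro pd_cmult smooth_on_differentiable[OF N(1)] that)
  have RI: "R k" if "\<And>z. z \<in> N \<Longrightarrow> pd 1 (\<lambda>u. \<Phi> u $ k) z = - (Omega 1 \<Gamma> z *v \<Phi> z) $ k"
    "\<And>z. z \<in> N \<Longrightarrow> pd 2 (\<lambda>u. \<Phi> u $ k) z = - (Omega 2 \<Gamma> z *v \<Phi> z) $ k" for k
    unfolding R_def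
  proof (intro ballI allI)
    fix z a assume z: "z \<in> N"
    show "pd a (\<lambda>u. \<Phi> u $ k) z = - (Omega a \<Gamma> z *v \<Phi> z) $ k"
    proof (cases "a = 1")
      case True
      then show ?thesis using that(1)[OF z] by simp
    next
      case False
      then have "a = 2" using exhaust_2[of a] by simp
      then show ?thesis using that(2)[OF z] by simp
    qed
  qed
  have R1: "R 1"
    using liouville by (intro RI) (simp_all add: \<Phi> Omega_mult_nth algebra_simps)
  have R2: "R 2"
    by (intro RI) (simp_all add: \<Phi> Omega_mult_nth)
  have R3: "R 3"
    using liouville by (intro RI) (simp_all add: \<Phi> Omega_mult_nth algebra_simps)
  have e51: "pd 1 (\<lambda>u. \<Phi> u $ 5) z + (Omega 1 \<Gamma> z *v \<Phi> z) $ 5 = 0" if "z \<in> N" for z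
    using cm[OF that smooth_on_pd[OF smp(2)]] by (simp add: \<Phi> Omega_mult_nth)
  have e42: "pd 2 (\<lambda>u. \<Phi> u $ 4) z + (Omega 2 \<Gamma> z *v \<Phi> z) $ 4 = 0" if "z \<in> N" for z
    using cm[OF that smooth_on_pd[OF smp(2)]] smooth_pd_commute[OF N(1) smp(2) that, of 2 1] by (simp add: \<Phi> Omega_mult_nth)
  have rel: "(\<Sum>k\<in>UNIV. Omega1 \<Gamma> z $ i $ k * (pd 2 (\<lambda>u. \<Phi> u $ k) z + (Omega 2 \<Gamma> z *v \<Phi> z) $ k))
      - (\<Sum>k\<in>UNIV. Omega2 \<Gamma> z $ i $ k * (pd 1 (\<lambda>u. \<Phi> u $ k) z + (Omega 1 \<Gamma> z *v \<Phi> z) $ k)) = 0"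
    if "R i" "i \<noteq> 6" "z \<in> N" for i z
    using integrability_relation[OF N sm _ that(3), of i] that by (auto simp: R_def)
  have R0: "pd a (\<lambda>u. \<Phi> u $ k) z + (Omega a \<Gamma> z *v \<Phi> z) $ k = 0" if "R k" "z \<in> N" for k z a
    using that by (simp add: R_def)
  \<comment> \<open>In row 1 the only failure not yet known to vanish is entry 4 in direction 1,
    with coefficient 1 from \<open>Omega2\<close>; for \<open>e52\<close>, row 3 isolates entry 5 in
    direction 2 through \<open>Omega1\<close>.\<close>
  have e41: "pd 1 (\<lambda>u. \<Phi> u $ 4) z + (Omega 1 \<Gamma> z *v \<Phi> z) $ 4 = 0" if z: "z \<in> N" for z
    using rel[OF R1 _ z] unfolding sum_6 R0[OF R1 z] R0[OF R2 z] R0[OF R3 z] by (simp add: Omega_nth)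
  have e52: "pd 2 (\<lambda>u. \<Phi> u $ 5) z + (Omega 2 \<Gamma> z *v \<Phi> z) $ 5 = 0" if z: "z \<in> N" for z
    using rel[OF R3 _ z] unfolding sum_6 R0[OF R1 z] R0[OF R2 z] R0[OF R3 z] by (simp add: Omega_nth)
  have R4: "R 4" using e41 e42 by (intro RI) (simp_all add: eq_neg_iff_add_eq_0)
  have R5: "R 5" using e51 e52 by (intro RI) (simp_all add: eq_neg_iff_add_eq_0)
  \<comment> \<open>Rows 4 and 5 each isolate a failure of row 6, through the coefficients -1 in
    their last columns.\<close>
  have e61: "pd 1 (\<lambda>u. \<Phi> u $ 6) z + (Omega 1 \<Gamma> z *v \<Phi> z) $ 6 = 0" if z: "z \<in> N" for z
    using rel[OF R4 _ z] unfolding sum_6 R0[OF R1 z] R0[OF R2 z] R0[OF R3 z] R0[OF R4 z] R0[OF R5 z] by (simp add: Omega_nth)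
  have e62: "pd 2 (\<lambda>u. \<Phi> u $ 6) z + (Omega 2 \<Gamma> z *v \<Phi> z) $ 6 = 0" if z: "z \<in> N" for z
    using rel[OF R5 _ z] unfolding sum_6 R0[OF R1 z] R0[OF R2 z] R0[OF R3 z] R0[OF R4 z] R0[OF R5 z] by (simp add: Omega_nth)
  have R6: "R 6" using e61 e62 by (intro RI) (simp_all add: eq_neg_iff_add_eq_0)
  have "\<forall>k. R k" unfolding forall_6 using R1 R2 R3 R4 R5 R6 by blast
  then have "parallel_on N \<Phi>"
    by (intro parallel_onI[OF N(1) sm]) (auto simp: R_def)
  moreover have "\<Phi> z $ 1 * \<Phi> z $ 3 - (\<Phi> z $ 2)\<^sup>2 \<noteq> 0" if "z \<in> N" for z
  proof -
    have "\<Phi> z $ 1 * \<Phi> z $ 3 - (\<Phi> z $ 2)\<^sup>2 = (w z)\<^sup>2 * D z"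
      unfolding \<Phi> p1_def p2_def p3_def D_def by (simp add: algebra_simps power2_eq_square)
    then show ?thesis using w0[OF that] D0[OF that] by simp
  qed
  ultimately show ?thesis by blast
qed

text \<open>Only the equations of rows 1 to 3 enter the Christoffel symbols; mu and nu, the
  derivatives left free by the linear system, cancel from the four projective invariants.\<close>

lemma parallel_imp_metric:
  assumes N: "open N" "N \<subseteq> S" and par: "parallel_on N \<Phi>"
    and nd: "\<And>z. z \<in> N \<Longrightarrow> \<Phi> z $ 1 * \<Phi> z $ 3 - (\<Phi> z $ 2)\<^sup>2 \<noteq> 0"
  shows "\<exists>g. metric_on N g \<and> torsion_free_connection_on N (levi_civita g) \<and>
    (\<forall>z\<in>N. A0 (levi_civita g) z = A0 \<Gamma> z \<and> A1 (levi_civita g) z = A1 \<Gamma> z \<and>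
      A2 (levi_civita g) z = A2 \<Gamma> z \<and> A3 (levi_civita g) z = A3 \<Gamma> z)"
proof -
  define D where "D u = \<Phi> u $ 1 * \<Phi> u $ 3 - (\<Phi> u $ 2)\<^sup>2" for u
  have D0: "D z \<noteq> 0" if "z \<in> N" for z using nd[OF that] by (simp add: D_def)
  note smN = smooth_on_const smooth_on_add[OF N(1)] smooth_on_diff[OF N(1)] smooth_on_mult[OF N(1)]
    smooth_on_power[OF N(1)] smooth_on_pd
  note sm = parallel_on_smooth(1)[OF N par] and pd\<Phi> = parallel_on_smooth(2)[OF N par]
  have smD: "smooth_on N D" unfolding D_def[abs_def] by (intro smN sm)
  define g :: "real^2 \<Rightarrow> real^2^2" where
    "g u = vector [vector [\<Phi> u $ 1 / (D u)\<^sup>2, \<Phi> u $ 2 / (D u)\<^sup>2], vector [\<Phi> u $ 2 / (D u)\<^sup>2, \<Phi> u $ 3 / (D u)\<^sup>2]]" for u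
  have g: "g u $ 1 $ 1 = \<Phi> u $ 1 / (D u)\<^sup>2" "g u $ 1 $ 2 = \<Phi> u $ 2 / (D u)\<^sup>2"
    "g u $ 2 $ 1 = \<Phi> u $ 2 / (D u)\<^sup>2" "g u $ 2 $ 2 = \<Phi> u $ 3 / (D u)\<^sup>2" for u
    by (simp_all add: g_def)
  have q: "smooth_on N (\<lambda>u. \<Phi> u $ k / (D u)\<^sup>2)" for k
    unfolding divide_inverse by (intro smN sm smooth_on_inverse[OF N(1)] smD) (simp add: D0)
  have smg: "smooth_on N (\<lambda>u. g u $ a $ b)" for a b
  proof -
    have "\<forall>a b. smooth_on N (\<lambda>u. g u $ a $ b)" unfolding forall_2 g using q by blast
    then show ?thesis by blast
  qed
  \<comment> \<open>A quotient by the square of \<open>D\<close> in each entry divides the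
    determinant \<open>D\<close> by its fourth power.\<close>
  have det: "g z $ 1 $ 1 * g z $ 2 $ 2 - (g z $ 1 $ 2)\<^sup>2 = 1 / D z ^ 3" if "z \<in> N" for z
  proof -
    have "g z $ 1 $ 1 * g z $ 2 $ 2 - (g z $ 1 $ 2)\<^sup>2 = D z / ((D z)\<^sup>2 * (D z)\<^sup>2)"
      by (simp add: g D_def[of z] power_divide diff_divide_distrib power2_eq_square)
    also have "\<dots> = 1 / D z ^ 3" using D0[OF that] by (simp add: field_simps eval_nat_numeral)
    finally show ?thesis .
  qed
  have det0: "g z $ 1 $ 1 * g z $ 2 $ 2 - g z $ 1 $ 2 * g z $ 2 $ 1 \<noteq> 0" if "z \<in> N" for z
    using det[OF that] D0[OF that] by (simp add: g(2,3) power2_eq_square)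
  have sym: "g u $ 2 $ 1 = g u $ 1 $ 2" for u by (simp add: g)
  have metric: "metric_on N g"
    unfolding metric_on_def
  proof (intro conjI allI ballI smg)
    fix z assume z: "z \<in> N"
    show "transpose (g z) = g z" by (simp add: vec_eq_iff forall_2 transpose_def sym)
    show "invertible (g z)" using det0[OF z] by (simp add: invertible_det_nz det_2)
  qed
  have tf: "torsion_free_connection_on N (levi_civita g)"
    unfolding torsion_free_connection_on_def
    by (intro conjI allI ballI smooth_on_levi_civita[OF N(1) smg det0] levi_civita_symmetric[OF N(1) _ sym])
  have "A0 (levi_civita g) z = A0 \<Gamma> z \<and> A1 (levi_civita g) z = A1 \<Gamma> z \<and>
      A2 (levi_civita g) z = A2 \<Gamma> z \<and> A3 (levi_civita g) z = A3 \<Gamma> z" if z: "z \<in> N" for z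
  proof -
    note dN = smooth_on_differentiable[OF N(1) _ z]
    let ?p = "\<lambda>a k. pd a (\<lambda>u. \<Phi> u $ k) z"
    have dD: "pd a D z = ?p a 1 * \<Phi> z $ 3 + \<Phi> z $ 1 * ?p a 3 - 2 * \<Phi> z $ 2 * ?p a 2" for a
    proof -
      have "pd a D z = pd a (\<lambda>u. \<Phi> u $ 1 * \<Phi> u $ 3 - \<Phi> u $ 2 * \<Phi> u $ 2) z" by (simp add: D_def[abs_def] power2_eq_square)
      also have "\<dots> = pd a (\<lambda>u. \<Phi> u $ 1 * \<Phi> u $ 3) z - pd a (\<lambda>u. \<Phi> u $ 2 * \<Phi> u $ 2) z"
        by (intro pd_diff dN smN sm)
      also have "\<dots> = ?p a 1 * \<Phi> z $ 3 + \<Phi> z $ 1 * ?p a 3 - 2 * \<Phi> z $ 2 * ?p a 2"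
        by (simp add: pd_mult dN sm)
      finally show ?thesis .
    qed
    have dg: "pd a (\<lambda>u. \<Phi> u $ k / (D u)\<^sup>2) z = (?p a k * D z - 2 * \<Phi> z $ k * pd a D z) / D z ^ 3" for a k
      by (rule pd_divide_square[OF N(1) z sm smD D0[OF z]])
    have P: "?p 1 1 = 2/3 * A1 \<Gamma> z * \<Phi> z $ 1 - 2 * A0 \<Gamma> z * \<Phi> z $ 2"
      "?p 2 1 = 4/3 * A2 \<Gamma> z * \<Phi> z $ 1 - 2/3 * A1 \<Gamma> z * \<Phi> z $ 2 - 2 * A0 \<Gamma> z * \<Phi> z $ 3 - \<Phi> z $ 4"
      "?p 1 2 = \<Phi> z $ 4 / 2" "?p 2 2 = \<Phi> z $ 5 / 2"
      "?p 1 3 = 2 * A3 \<Gamma> z * \<Phi> z $ 1 + 2/3 * A2 \<Gamma> z * \<Phi> z $ 2 - 4/3 * A1 \<Gamma> z * \<Phi> z $ 3 - \<Phi> z $ 5"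
      "?p 2 3 = 2 * A3 \<Gamma> z * \<Phi> z $ 2 - 2/3 * A2 \<Gamma> z * \<Phi> z $ 3"
      unfolding pd\<Phi>[OF z] Omega_mult_nth by simp_all
    note lc = levi_civita_2[where g = g and D = "1 / D z ^ 3", OF N(1) z sym det[OF z], unfolded g, OF _ refl dg[symmetric] dg[symmetric] refl dg[symmetric] dg[symmetric] refl dg[symmetric] dg[symmetric]]
    have D3: "1 / D z ^ 3 \<noteq> 0" using D0[OF z] by simp
    show ?thesis
      unfolding A0_def A1_def A2_def A3_def lc[OF D3]
      using levi_civita_of_solution[OF D_def[of z] D0[OF z] refl P dD dD refl refl refl refl refl refl refl refl refl] 
      unfolding A0_def A1_def A2_def A3_def by blast
  qed
  then show ?thesis using metric tf by blast
qed

end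

section \<open>Passage from a projective structure to a chart, and both implications\<close>

lemma projective_structure_members:
  assumes "P \<in> projective_structures U" "\<Gamma> \<in> P" "\<Gamma>' \<in> P"
  shows "torsion_free_connection_on U \<Gamma>"
    and "z \<in> U \<Longrightarrow> A0 \<Gamma>' z = A0 \<Gamma> z \<and> A1 \<Gamma>' z = A1 \<Gamma> z \<and> A2 \<Gamma>' z = A2 \<Gamma> z \<and> A3 \<Gamma>' z = A3 \<Gamma> z"
proof -
  obtain \<Gamma>0 where P: "P = projective_rel U `` {\<Gamma>0}"
    using assms(1) unfolding projective_structures_def quotient_def by blast
  then have r: "(\<Gamma>0, \<Gamma>) \<in> projective_rel U" "(\<Gamma>0, \<Gamma>') \<in> projective_rel U" using assms by auto
  then show "torsion_free_connection_on U \<Gamma>" by (simp add: projective_rel_def)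
  show "A0 \<Gamma>' z = A0 \<Gamma> z \<and> A1 \<Gamma>' z = A1 \<Gamma> z \<and> A2 \<Gamma>' z = A2 \<Gamma> z \<and> A3 \<Gamma>' z = A3 \<Gamma> z" if "z \<in> U"
    using A_projective_invariant[OF r(1) that] A_projective_invariant[OF r(2) that] by simp
qed

theorem theorem1p4:
  fixes U :: "(real^2) set" and P :: "connection set" and \<Gamma> :: connection and p :: "real^2"
  assumes "open U"
    and "real_analytic_projective_structure U P"
    and "\<Gamma> \<in> P"
    and "p \<in> U"
    and "\<forall>\<^sub>F z in nhds p. rank (M_mat \<Gamma> z) = rank (M_mat \<Gamma> p)"
  shows "metrisable_near U P p \<longleftrightarrow>
    (\<exists>N. open N \<and> p \<in> N \<and> N \<subseteq> U \<and>
       (\<forall>z\<in>N. rank (M_max \<Gamma> z) < 6) \<and>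
       (\<exists>W :: real^2 \<Rightarrow> real^6. continuous_on N W \<and> (\<forall>z\<in>N. M_max \<Gamma> z *v W z = 0) \<and>
          W p $ 1 * W p $ 3 - (W p $ 2)\<^sup>2 \<noteq> 0))"
    (is "_ \<longleftrightarrow> ?R")
proof -
  note U = assms(1)
  have PU: "P \<in> projective_structures U" using assms(2) by (simp add: real_analytic_projective_structure_def)
  have tf: "torsion_free_connection_on U \<Gamma>'" if "\<Gamma>' \<in> P" for \<Gamma>'
    using projective_structure_members(1)[OF PU that that] .
  have sm: "smooth_on U (\<Gamma> c a b)" for c a b using tf[OF assms(3)] by (simp add: torsion_free_connection_on_def)
  have smA: "smooth_on U (A0 \<Gamma>)" "smooth_on U (A1 \<Gamma>)" "smooth_on U (A2 \<Gamma>)" "smooth_on U (A3 \<Gamma>)"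
    unfolding A0_def[abs_def] A1_def[abs_def] A2_def[abs_def] A3_def[abs_def]
    by (intro smooth_on_minus[OF U] smooth_on_diff[OF U] smooth_on_mult[OF U] smooth_on_const sm)+
  have ra: "real_analytic_on U (A0 \<Gamma>)" "real_analytic_on U (A1 \<Gamma>)" "real_analytic_on U (A2 \<Gamma>)" "real_analytic_on U (A3 \<Gamma>)"
    using assms(2,3) by (simp_all add: real_analytic_projective_structure_def)
  obtain r0 where r0: "r0 > 0" "ball p r0 \<subseteq> U" "analytic_bounded_on (ball p r0) (A0 \<Gamma>)"
    using real_analytic_imp_analytic_bounded[OF ra(1) smA(1) U assms(4)] by blast
  obtain r1 where r1: "r1 > 0" "analytic_bounded_on (ball p r1) (A1 \<Gamma>)"
    using real_analytic_imp_analytic_bounded[OF ra(2) smA(2) U assms(4)] by blast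
  obtain r2 where r2: "r2 > 0" "analytic_bounded_on (ball p r2) (A2 \<Gamma>)"
    using real_analytic_imp_analytic_bounded[OF ra(3) smA(3) U assms(4)] by blast
  obtain r3 where r3: "r3 > 0" "analytic_bounded_on (ball p r3) (A3 \<Gamma>)"
    using real_analytic_imp_analytic_bounded[OF ra(4) smA(4) U assms(4)] by blast
  \<comment> \<open>The four expansions have different radii; the smallest ball serves all of
    them.\<close>
  define S where "S = ball p (min (min r0 r1) (min r2 r3))"
  have pS: "p \<in> S" and SU: "S \<subseteq> U" and oS: "open S"
    using r0 r1 r2 r3 by (auto simp: S_def)
  interpret analytic_chart \<Gamma> S
  proof
    show "analytic_bounded_on S (A0 \<Gamma>)" by (rule analytic_bounded_on_subset[OF open_ball _ r0(3)]) (auto simp: S_def)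
    show "analytic_bounded_on S (A1 \<Gamma>)" by (rule analytic_bounded_on_subset[OF open_ball _ r1(2)]) (auto simp: S_def)
    show "analytic_bounded_on S (A2 \<Gamma>)" by (rule analytic_bounded_on_subset[OF open_ball _ r2(2)]) (auto simp: S_def)
    show "analytic_bounded_on S (A3 \<Gamma>)" by (rule analytic_bounded_on_subset[OF open_ball _ r3(2)]) (auto simp: S_def)
  qed (rule oS)
  show ?thesis
  proof
    assume "metrisable_near U P p"
    then obtain N g where N: "open N" "p \<in> N" "N \<subseteq> U" and g: "metric_on N g"
      and rel: "(\<Gamma>, levi_civita g) \<in> projective_rel N"
      using assms(3) unfolding metrisable_near_def by blast
    let ?N = "N \<inter> S"
    have oN: "open ?N" "?N \<subseteq> S" using N oS by auto
    have g': "metric_on ?N g"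
      using g smooth_on_subset[OF N(1), of ?N] by (auto simp: metric_on_def)
    obtain \<Phi> where \<Phi>: "parallel_on ?N \<Phi>" "\<And>z. z \<in> ?N \<Longrightarrow> \<Phi> z $ 1 * \<Phi> z $ 3 - (\<Phi> z $ 2)\<^sup>2 \<noteq> 0"
      using metric_imp_parallel[OF oN g'] A_projective_invariant[OF rel] by blast
    have ker: "M_max \<Gamma> z *v \<Phi> z = 0" if "z \<in> ?N" for z
      using parallel_annihilated[OF oN \<Phi>(1) that] that
      by (simp add: M_max_mult_eq_0 covD_iter_annihilated_iff)
    have "rank (M_max \<Gamma> z) < 6" if "z \<in> ?N" for z
    proof -
      have "\<Phi> z \<noteq> 0" using \<Phi>(2)[OF that] by auto
      then have "rank (M_max \<Gamma> z) \<noteq> CARD(6)"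
        using ker[OF that] matrix_nonfull_linear_equations_eq[of "M_max \<Gamma> z"] by blast
      moreover have "rank (M_max \<Gamma> z) \<le> min CARD(21) CARD(6)" by (rule rank_bound)
      ultimately show ?thesis by simp
    qed
    moreover have "continuous_on ?N \<Phi>" using \<Phi>(1) by (simp add: parallel_on_def)
    ultimately show ?R using ker \<Phi>(2)[of p] oN N pS
      by (intro exI[of _ ?N] conjI exI[of _ \<Phi>]) auto
  next
    assume ?R
    then obtain N W where N: "open N" "p \<in> N" "N \<subseteq> U" and W: "continuous_on N W"
      "\<And>z. z \<in> N \<Longrightarrow> M_max \<Gamma> z *v W z = 0" "W p $ 1 * W p $ 3 - (W p $ 2)\<^sup>2 \<noteq> 0" by blast
    have "\<exists>N' \<Phi>. open N' \<and> p \<in> N' \<and> N' \<subseteq> S \<and> parallel_on N' \<Phi> \<and> \<Phi> p $ 1 * \<Phi> p $ 3 - (\<Phi> p $ 2)\<^sup>2 \<noteq> 0"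
      by (rule nondegenerate_parallel_section[of "N \<inter> S" p W])
        (use N W pS oS in \<open>auto intro: continuous_on_subset\<close>)
    then obtain N' \<Phi> where N': "open N'" "p \<in> N'" "N' \<subseteq> S" and \<Phi>: "parallel_on N' \<Phi>"
      "\<Phi> p $ 1 * \<Phi> p $ 3 - (\<Phi> p $ 2)\<^sup>2 \<noteq> 0" by blast
    \<comment> \<open>Nondegeneracy is known at \<open>p\<close> only, so the domain shrinks to the
      open set where it holds.\<close>
    define N'' where "N'' = {z \<in> N'. \<Phi> z $ 1 * \<Phi> z $ 3 - (\<Phi> z $ 2)\<^sup>2 \<in> - {0}}"
    have "continuous_on N' (\<lambda>z. \<Phi> z $ 1 * \<Phi> z $ 3 - (\<Phi> z $ 2)\<^sup>2)"
      using \<Phi>(1) by (intro continuous_intros) (simp_all add: parallel_on_def)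
    from continuous_open_preimage[OF this N'(1) open_Compl[OF closed_singleton[of "0::real"]]]
    have o: "open N''" by (simp add: N''_def vimage_def Int_def)
    have N'': "N'' \<subseteq> N'" "N'' \<subseteq> S" "p \<in> N''" using N' \<Phi>(2) by (auto simp: N''_def)
    obtain g where g: "metric_on N'' g" "torsion_free_connection_on N'' (levi_civita g)"
      "\<And>z. z \<in> N'' \<Longrightarrow> A0 (levi_civita g) z = A0 \<Gamma> z \<and> A1 (levi_civita g) z = A1 \<Gamma> z \<and>
        A2 (levi_civita g) z = A2 \<Gamma> z \<and> A3 (levi_civita g) z = A3 \<Gamma> z"
      using parallel_imp_metric[OF o N''(2) parallel_on_subset[OF \<Phi>(1) N''(1)]] by (auto simp: N''_def)
    have rel: "(\<Gamma>', levi_civita g) \<in> projective_rel N''" if \<Gamma>': "\<Gamma>' \<in> P" for \<Gamma>'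
    proof -
      have A: "A0 (levi_civita g) z = A0 \<Gamma>' z \<and> A1 (levi_civita g) z = A1 \<Gamma>' z \<and>
        A2 (levi_civita g) z = A2 \<Gamma>' z \<and> A3 (levi_civita g) z = A3 \<Gamma>' z" if z: "z \<in> N''" for z
      proof -
        have "z \<in> U" using z N''(2) SU by blast
        from projective_structure_members(2)[OF PU \<Gamma>' assms(3) this] g(3)[OF z] show ?thesis by simp
      qed
      have "N'' \<subseteq> U" using N''(2) SU by (rule order_trans)
      then have "torsion_free_connection_on N'' \<Gamma>'" by (rule torsion_free_subset[OF U _ tf[OF \<Gamma>']])
      then show ?thesis by (rule projective_rel_if_A_eq[OF o _ g(2)]) (simp_all add: A)
    qed
    show "metrisable_near U P p"
      unfolding metrisable_near_def
      by (intro exI[of _ N''] exI[of _ g] conjI ballI rel o g(1) N''(3)) (use N'' SU in blast)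
  qed
qed

end
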